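(* Let $\eta\ge 4$ be even, $P=\left(\frac{\eta-1}{2},\frac{\eta-1}{2}\right)$, let $U(\xi)=\sum_{k\in Q_\eta^2}[e^{2\pi\xi\wedge k}]\circledast A_k$ be a matrix-valued trigonometric polynomial with $(A_k)_{k\in Q_\eta^2}\subset \mathsf S^{4\times 4}$, and let $\mathbf U=(U_j)_{j\in Q_\eta^2}$ with $U_j=U(\frac{j}{\eta})$. In the parts where a scaling function $\varphi$ or wavelets $\psi^\varepsilon$ appear, $U(\xi)$ is the wavelet matrix associated with $\varphi$ and $\{\psi^{\varepsilon}\}_{\varepsilon=1}^3$. Then the following hold. (a) $U(\xi)$ is unitary for every $\xi\in\mathbb R^2$ if and only if all the samples (matrices) in the ensembles $\mathbf U^{(\ell)}=\mathcal F_\eta\chi_\ell\mathcal F_\eta^{-1}\mathbf U$, $\ell=0,1,2,3$, are unitary. (b) If $\hat\varphi(0)=1$, then $U_0\in[1]\otimes\mathcal U^{3\times3}$. (c) If the wavelets $\{\psi^\varepsilon\}_{\varepsilon=1}^3$ have $\mu+1$ vanishing moments, then the following are equivalent: (i) $\partial^\alpha U(\xi)\big|_{\xi=0}\in\mathsf S\otimes\mathsf S^{3\times3}$ for $0\le|\alpha|\le\mu$; (ii) $\sum_{k\in Q_\eta^2}[k_2^{\alpha_1}k_1^{\alpha_2}]\circledast A_k\in\mathsf S\otimes\mathsf S^{3\times3}$ for $0\le|\alpha|\le\mu$; (iii) $\sum_{j\in Q_\eta^2}[c_{\alpha j}]\circledast U_j\in\mathsf S\otimes\mathsf S^{3\times3}$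 for $0\le|\alpha|\le\mu$, where $[c_{\alpha j}]=\sum_{k\in Q_\eta^2}[k_2^{\alpha_1}k_1^{\alpha_2}][e^{2\pi k\wedge j/\eta}]$. (d) The following are equivalent: (i) $U(\xi+\frac{v_1}{2})=\sigma_1U(\xi)$ and $U(\xi+\frac{v_2}{2})=\sigma_2U(\xi)$ for all $\xi\in\mathbb R^2$; (ii) $\sigma_1A_k=(-1)^{k_2}A_k$ and $\sigma_2A_k=(-1)^{k_1}A_k$ for all $k=(k_1,k_2)\in Q_\eta^2$; (iii) $U_{j+\eta v_1/2}=\sigma_1U_j$ and $U_{j+\eta v_2/2}=\sigma_2U_j$ for all $j\in Q_\eta^2$. (e) The following are equivalent: (i) $U(-\xi)=\tau U(\xi)\tau$ for all $\xi\in\mathbb R^2$; (ii) $A_k=\tau A_k\tau$ for all $k\in Q_\eta^2$; (iii) $U_{\eta v_3-j}=\tau U_j\tau$ for all $j\in Q_\eta^2$. (f) The following are equivalent: (i) $\varphi(x)=\varphi(2P-x)$ for all $x\in\mathbb R^2$; (ii) $U(\xi)[0,0]+U(\xi)[0,1]=e^{4\pi\xi\wedge P}\big(U(-\xi)[0,0]+U(-\xi)[0,1]\big)$ for all $\xi\in\mathbb R^2$; (iii) $A_k[0,0]+A_k[0,1]=A_{2P-k}[0,0]+A_{2P-k}[0,1]$ for all $k\in Q_\eta^2$; (iv) $U_j[0,0]+U_j[0,1]=e^{4\pi j\wedge P/\eta}\big(U_{\eta v_3-j}[0,0]+U_{\eta v_3-j}[0,1]\big)$ for all $j\in Q_\e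ta^2$.
   Context: Quaternions: $\mathbb R_2=\{x_0+x_1e_1+x_2e_2+x_{12}e_{12}: x_0,x_1,x_2,x_{12}\in\mathbb R\}$ with $e_1^2=e_2^2=e_{12}^2=e_1e_2e_{12}=-1$ (so $e_{12}=e_1e_2=-e_2e_1$). The spinor part of $x$ is $x_s=x_0+x_{12}e_{12}$ and the vector part is $x_v=x_1e_1+x_2e_2$. For $x,y\in\mathbb R^2$, $x\wedge y=e_{12}(x_1y_2-x_2y_1)$. For $f:\mathbb R^2\to\mathbb R_2$ the spinor and vector parts $f_s,f_v$ are taken pointwise, and the spinor-vector matrix of $f$ is $$[f(x)]=\begin{bmatrix}f_s(x)&f_v(x)\\ f_v(-x)&f_s(-x)\end{bmatrix}.$$ In particular $[e^{2\pi\xi\wedge k}]=\mathrm{diag}(e^{2\pi\xi\wedge k},e^{-2\pi\xi\wedge k})$, $[e^{2\pi k\wedge j/\eta}]=\mathrm{diag}(e^{2\pi k\wedge j/\eta},e^{-2\pi k\wedge j/\eta})$, and for a real constant $c$, $[c]=cI_2$. $\mathsf S$ is the set of $2\times2$ matrices $\begin{bmatrix} s_1 & v_1 \\ v_2 & s_2 \end{bmatrix}$ with $s_1,s_2\in\mathbb R\oplus\mathbb Re_{12}$ and $v_1,v_2\in\mathbb Re_1\oplus\mathbb Re_2$; $\mathsf S^{m\times m}$ is the set of $m\times m$ block matrices with blocks in $\mathsf S$ (also viewed as $2m\times 2m$ quaternion matrices); $\mathcal U^{m\times m}$ is the set of unitary elements of $\mathsf S^{m\times m}$ (with $A^*=\overline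 A^{\top}$). $\mathsf S\otimes\mathsf S^{3\times3}$ (resp. $[1]\otimes\mathcal U^{3\times3}$) is the set of block diagonal matrices with first diagonal block in $\mathsf S$ (resp. equal to $I_2$) and second diagonal block in $\mathsf S^{3\times3}$ (resp. $\mathcal U^{3\times3}$). For $s\in\mathsf S$ and $A\in\mathsf S^{4\times4}$, $s\circledast A$ is obtained by multiplying every $2\times2$ block of $A$ on the left by $s$. $A[i,j]$ is the $(i,j)$ scalar (quaternion) entry of the $8\times8$ matrix $A$, indices starting at $0$. $v_0=(0,0),v_1=(1,0),v_2=(0,1),v_3=(1,1)$. $Q_\eta^2=\{0,1,\dots,\eta-1\}^2$. Indices of samples $U_j$ are read modulo $\eta$ in each coordinate. For ensembles $\mathbf B=(B_k)_{k\in Q_\eta^2}$ with $B_k\in\mathsf S^{4\times4}$: $(\mathcal F_\eta\mathbf B)_j=\sum_{k\in Q_\eta^2}[e^{2\pi j\wedge k/\eta}]\circledast B_k$, $(\mathcal F_\eta^{-1}\mathbf C)_k=\frac1{\eta^2}\sum_{j\in Q_\eta^2}[e^{2\pi k\wedge j/\eta}]\circledast C_j$, and $(\chi_\ell\mathbf B)_k=[e^{\pi v_\ell\wedge k/\eta}]\circledast B_k$. With $0,1$ denoting the $2\times 2$ blocks $0$ and $I_2$, $$\sigma_1=\begin{bmatrix} 0&1&0&0 \\ 1&0&0&0 \\ 0&0&0&1 \\ 0&0&1&0 \end{bmatrix},\qquad \sigma_2=\begin{bmatrix} 0&0&1&0 \\ 0&0&0&1 \\ 1&0&0&0 \\ 0&1&0&0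 \end{bmatrix},$$ and $\tau=\mathrm{diag}(\tau_0,\tau_0,\tau_0,\tau_0)$ with $\tau_0=\begin{bmatrix} 0&1 \\ 1&0 \end{bmatrix}$. For a multi-index $\alpha=(\alpha_1,\alpha_2)\in\mathbb Z_{\ge0}^2$, $|\alpha|=\alpha_1+\alpha_2$, $\partial^\alpha=(\partial/\partial\xi_1)^{\alpha_1}(\partial/\partial\xi_2)^{\alpha_2}$, $x^\alpha=x_1^{\alpha_1}x_2^{\alpha_2}$; $\partial^\alpha U(\xi)$ is the entrywise derivative of the matrix function $U$. The wavelets have $\mu+1$ vanishing moments if $\int_{\mathbb R^2}x^\alpha\psi^\varepsilon(x)\,dx=0$ for $0\le|\alpha|\le\mu$ and $\varepsilon\in\{1,2,3\}$. Quaternionic Fourier transform: $\hat f(\xi)=\int_{\mathbb R^2}e^{2\pi\xi\wedge x}f(x)\,dx$ (extended to $L^2$). A multiresolution analysis (MRA) for $L^2(\mathbb R^2,\mathbb R_2)$ is a sequence of closed right $\mathbb R_2$-linear submodules $(V_j)_{j\in\mathbb Z}$ and a scaling function $\varphi\in V_0$ with: $V_j\subset V_{j+1}$; $\overline{\bigcup_jV_j}=L^2(\mathbb R^2,\mathbb R_2)$ and $\bigcap_jV_j=\{0\}$; $f\in V_0\iff f(\cdot-k)\in V_0$ for all $k\in\mathbb Z^2$; $f\in V_0\iff f(2^j\cdot)\in V_j$; $\{\varphi(\cdot-k)\}_{k\in\mathbb Z^2}$ is an orthonormal basis of $V_0$. Associated wavelets $\psi^1,\psi^2,\psi^3$ are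 such that $\{2^j\psi^\varepsilon(2^j\cdot-k):k\in\mathbb Z^2,\varepsilon\in\{1,2,3\}\}$ is an orthonormal basis of $W_j$, the orthogonal complement of $V_j$ in $V_{j+1}$, for each $j$; together over all $j\in\mathbb Z$ these form an orthonormal basis of $L^2(\mathbb R^2,\mathbb R_2)$. The coefficients $(a_k^\varepsilon)_{k\in\mathbb{Z}^2}\in\ell^2(\mathbb Z^2,\mathbb R_2)$ are given by $\frac14\varphi(\frac x2)=\sum_k\varphi(x-k)a_k^0$ and $\frac14\psi^\varepsilon(\frac x2)=\sum_k\varphi(x-k)a_k^\varepsilon$, and the scaling filter $m_0$ and wavelet filters $m_1,m_2,m_3$ are $m_\varepsilon(\xi)=\sum_{k\in\mathbb Z^2}e^{2\pi\xi\wedge k}a_k^\varepsilon$. The wavelet matrix $U(\xi)$ is the $4\times4$ block matrix whose block in row $j$, column $\varepsilon$ ($0\le j,\varepsilon\le3$) is $[m_\varepsilon(\xi+\frac{v_j}{2})]$; it is of the trigonometric polynomial form in the claim when $\varphi$ and the $\psi^\varepsilon$ are supported on $[0,\eta-1]^2$.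
   Formalization: In (b) and (f) the scaling function φ is assumed integrable (automatic for φ supported on [0,η−1]²; without it (f)(ii)⇒(i) fails), the moments of ψ in (c) are assumed absolutely convergent, and φ(x)=φ(2P−x) in (f)(i) is understood for almost every x. *)

theory Defs
  imports "HOL-Analysis.Analysis"
begin

section \<open>Quaternions\<close>

text \<open>The algebra with basis \<open>1, e\<^sub>1, e\<^sub>2, e\<^sub>1\<^sub>2 = e\<^sub>1 e\<^sub>2\<close>.\<close>

datatype quat = Quat (qc0: real) (qc1: real) (qc2: real) (qc12: real)

lemma quat_eq_iff: "x = y \<longleftrightarrow> qc0 x = qc0 y \<and> qc1 x = qc1 y \<and> qc2 x = qc2 y \<and> qc12 x = qc12 y"
  by (rule quat.expand[THEN iffI, rotated] | cases x; cases y; simp)+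

instantiation quat :: "{zero, one, plus, minus, uminus, times, inverse, scaleR}"
begin

definition "0 = Quat 0 0 0 0"
definition "1 = Quat 1 0 0 0"
definition "x + y = Quat (qc0 x + qc0 y) (qc1 x + qc1 y) (qc2 x + qc2 y) (qc12 x + qc12 y)"
definition "x - y = Quat (qc0 x - qc0 y) (qc1 x - qc1 y) (qc2 x - qc2 y) (qc12 x - qc12 y)"
definition "- x = Quat (- qc0 x) (- qc1 x) (- qc2 x) (- qc12 x)"
definition "x * y = Quat
  (qc0 x * qc0 y - qc1 x * qc1 y - qc2 x * qc2 y - qc12 x * qc12 y)
  (qc0 x * qc1 y + qc1 x * qc0 y + qc2 x * qc12 y - qc12 x * qc2 y)
  (qc0 x * qc2 y + qc2 x * qc0 y + qc12 x * qc1 y - qc1 x * qc12 y)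
  (qc0 x * qc12 y + qc12 x * qc0 y + qc1 x * qc2 y - qc2 x * qc1 y)"
definition "scaleR r x = Quat (r * qc0 x) (r * qc1 x) (r * qc2 x) (r * qc12 x)"
definition "inverse x = scaleR (1 / ((qc0 x)\<^sup>2 + (qc1 x)\<^sup>2 + (qc2 x)\<^sup>2 + (qc12 x)\<^sup>2))
  (Quat (qc0 x) (- qc1 x) (- qc2 x) (- qc12 x))"
definition "x div y = x * inverse (y :: quat)"

instance ..

end

lemma quat_sel_simps [simp]:
  "qc0 0 = 0" "qc1 0 = 0" "qc2 0 = 0" "qc12 0 = 0"
  "qc0 1 = 1" "qc1 1 = 0" "qc2 1 = 0" "qc12 1 = 0"
  "qc0 (x + y) = qc0 x + qc0 y" "qc1 (x + y) = qc1 x + qc1 y"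
  "qc2 (x + y) = qc2 x + qc2 y" "qc12 (x + y) = qc12 x + qc12 y"
  "qc0 (x - y) = qc0 x - qc0 y" "qc1 (x - y) = qc1 x - qc1 y"
  "qc2 (x - y) = qc2 x - qc2 y" "qc12 (x - y) = qc12 x - qc12 y"
  "qc0 (- x) = - qc0 x" "qc1 (- x) = - qc1 x" "qc2 (- x) = - qc2 x" "qc12 (- x) = - qc12 x"
  "qc0 (scaleR r x) = r * qc0 x" "qc1 (scaleR r x) = r * qc1 x"
  "qc2 (scaleR r x) = r * qc2 x" "qc12 (scaleR r x) = r * qc12 x"
  by (simp_all add: zero_quat_def one_quat_def plus_quat_def minus_quat_def uminus_quat_def
      scaleR_quat_def)

lemma quat_sel_times:
  "qc0 (x * y) = qc0 x * qc0 y - qc1 x * qc1 y - qc2 x * qc2 y - qc12 x * qc12 y"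
  "qc1 (x * y) = qc0 x * qc1 y + qc1 x * qc0 y + qc2 x * qc12 y - qc12 x * qc2 y"
  "qc2 (x * y) = qc0 x * qc2 y + qc2 x * qc0 y + qc12 x * qc1 y - qc1 x * qc12 y"
  "qc12 (x * y) = qc0 x * qc12 y + qc12 x * qc0 y + qc1 x * qc2 y - qc2 x * qc1 y"
  by (simp_all add: times_quat_def)

instance quat :: ring_1
  by standard (simp_all add: quat_eq_iff quat_sel_times algebra_simps)

instance quat :: real_algebra_1
  by standard (simp_all add: quat_eq_iff quat_sel_times algebra_simps)

lemma quat_sum_squares_eq_0:
  "(qc0 x)\<^sup>2 + (qc1 x)\<^sup>2 + (qc2 x)\<^sup>2 + (qc12 x)\<^sup>2 = 0 \<longleftrightarrow> x = 0"
  by (simp add: quat_eq_iff add_nonneg_eq_0_iff)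

instance quat :: division_ring
proof
  fix x y :: quat
  show "inverse x * x = 1" "x * inverse x = 1" if "x \<noteq> 0"
    using that quat_sum_squares_eq_0[of x]
    by (simp_all add: quat_eq_iff inverse_quat_def quat_sel_times)
       (simp_all add: power2_eq_square add_divide_distrib[symmetric])
  show "inverse (0 :: quat) = 0"
    by (simp add: quat_eq_iff inverse_quat_def)
  show "x div y = x * inverse y"
    by (simp add: divide_quat_def)
qed

instantiation quat :: real_inner
begin

definition "inner x y = qc0 x * qc0 y + qc1 x * qc1 y + qc2 x * qc2 y + qc12 x * qc12 y"
definition "norm (x :: quat) = sqrt (inner x x)"
definition "sgn x = scaleR (inverse (norm x)) (x :: quat)"
definition "dist x y = norm (x - y :: quat)"
definition "(uniformity :: (quat \<times> quat) filter) = (INF e\<in>{0<..}. principal {(x, y). dist x y < e})"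
definition "open (U :: quat set) \<longleftrightarrow> (\<forall>x\<in>U. eventually (\<lambda>(x', y). x' = x \<longrightarrow> y \<in> U) uniformity)"

instance
proof
  fix x y z :: quat and r :: real
  show "inner x y = inner y x" "inner (x + y) z = inner x z + inner y z"
       "inner (scaleR r x) y = r * inner x y" "0 \<le> inner x x"
    by (simp_all add: inner_quat_def algebra_simps)
  show "inner x x = 0 \<longleftrightarrow> x = 0"
    using quat_sum_squares_eq_0[of x] by (simp add: inner_quat_def power2_eq_square)
qed (simp_all add: norm_quat_def sgn_quat_def dist_quat_def uniformity_quat_def open_quat_def)

end

instance quat :: real_normed_div_algebra
proof
  fix x y :: quat
  have "inner (x * y) (x * y) = inner x x * inner y y"
    by (simp add: inner_quat_def quat_sel_times) algebra
  then show "norm (x * y) = norm x * norm y"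
    by (simp add: norm_quat_def real_sqrt_mult)
qed

definition quat_e1 :: quat where "quat_e1 = Quat 0 1 0 0"
definition quat_e2 :: quat where "quat_e2 = Quat 0 0 1 0"
definition quat_e12 :: quat where "quat_e12 = Quat 0 0 0 1"

lemma quat_e_relations:
  "quat_e1 * quat_e1 = -1" "quat_e2 * quat_e2 = -1" "quat_e12 * quat_e12 = -1"
  "quat_e1 * quat_e2 * quat_e12 = -1"
  "quat_e1 * quat_e2 = quat_e12" "quat_e2 * quat_e1 = - quat_e12"
  by (simp_all add: quat_eq_iff quat_sel_times quat_e1_def quat_e2_def quat_e12_def)

lemma quat_expansion:
  "x = of_real (qc0 x) + qc1 x *\<^sub>R quat_e1 + qc2 x *\<^sub>R quat_e2 + qc12 x *\<^sub>R quat_e12"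
  by (simp add: quat_eq_iff of_real_def quat_e1_def quat_e2_def quat_e12_def)

instantiation quat :: euclidean_space
begin

definition "Basis = {1, quat_e1, quat_e2, quat_e12}"

instance
proof
  fix u v x :: quat
  show "(Basis :: quat set) \<noteq> {}" "finite (Basis :: quat set)"
    by (simp_all add: Basis_quat_def)
  show "inner u v = (if u = v then 1 else 0)" if "u \<in> Basis" "v \<in> Basis"
    using that
    by (auto simp: Basis_quat_def inner_quat_def quat_eq_iff quat_e1_def quat_e2_def quat_e12_def)
  show "(\<forall>u\<in>Basis. inner x u = 0) \<longleftrightarrow> x = 0"
    by (simp add: Basis_quat_def inner_quat_def quat_eq_iff[of x] quat_e1_def quat_e2_def quat_e12_def)
qed

end

definition qcnj :: "quat \<Rightarrow> quat" where
  "qcnj x = Quat (qc0 x) (- qc1 x) (- qc2 x) (- qc12 x)"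

definition spinor_part :: "quat \<Rightarrow> quat" where
  "spinor_part x = of_real (qc0 x) + qc12 x *\<^sub>R quat_e12"

definition vector_part :: "quat \<Rightarrow> quat" where
  "vector_part x = qc1 x *\<^sub>R quat_e1 + qc2 x *\<^sub>R quat_e2"

type_synonym r2 = "real \<times> real"
type_synonym z2 = "int \<times> int"

definition emb :: "z2 \<Rightarrow> r2" where
  "emb k = (real_of_int (fst k), real_of_int (snd k))"

definition wedge :: "r2 \<Rightarrow> r2 \<Rightarrow> quat" where
  "wedge x y = (fst x * snd y - snd x * fst y) *\<^sub>R quat_e12"

section \<open>Block matrices\<close>

text \<open>
  Indices are elements of the numeral types and count from 0 (in type \<open>2\<close> they are \<open>0, 1\<close>, in
  type \<open>4\<close> they are \<open>0, 1, 2, 3\<close>).  A matrix with \<open>m \<times> m\<close> blocks of size \<open>2 \<times> 2\<close> has index type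
  \<open>m \<times> 2\<close>: the index \<open>(i, p)\<close> is position \<open>p\<close> inside block \<open>i\<close>, that is the scalar index \<open>2 i + p\<close>.
\<close>

type_synonym 'm bmat = "quat ^ ('m \<times> 2) ^ ('m \<times> 2)"

definition mat2 :: "quat \<Rightarrow> quat \<Rightarrow> quat \<Rightarrow> quat \<Rightarrow> quat ^ 2 ^ 2" where
  "mat2 a b c d = (\<chi> p q. if p = 0 then (if q = 0 then a else b) else (if q = 0 then c else d))"

definition blk :: "'m::finite bmat \<Rightarrow> 'm \<Rightarrow> 'm \<Rightarrow> quat ^ 2 ^ 2" where
  "blk A i j = (\<chi> p q. A $ (i, p) $ (j, q))"

definition from_blocks :: "('m \<Rightarrow> 'm \<Rightarrow> quat ^ 2 ^ 2) \<Rightarrow> 'm::finite bmat" where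
  "from_blocks B = (\<chi> r c. B (fst r) (fst c) $ snd r $ snd c)"

definition SV :: "(quat ^ 2 ^ 2) set" where
  "SV = {mat2 s1 v1 v2 s2 | s1 v1 v2 s2.
     s1 \<in> range spinor_part \<and> s2 \<in> range spinor_part \<and>
     v1 \<in> range vector_part \<and> v2 \<in> range vector_part}"

definition SVmat :: "'m::finite bmat set" where
  "SVmat = {A. \<forall>i j. blk A i j \<in> SV}"

definition qadjoint :: "quat ^ 'n ^ 'm \<Rightarrow> quat ^ 'm ^ 'n" where
  "qadjoint A = (\<chi> i j. qcnj (A $ j $ i))"

definition qunitary :: "quat ^ 'n ^ 'n \<Rightarrow> bool" where
  "qunitary A \<longleftrightarrow> A ** qadjoint A = mat 1 \<and> qadjoint A ** A = mat 1"

definition USVmat :: "'m::finite bmat set" where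
  "USVmat = {A \<in> SVmat. qunitary A}"

text \<open>The block index \<open>i \<noteq> 0\<close> of a \<open>4 \<times> 4\<close> block matrix is index \<open>i - 1\<close> of the lower right part.\<close>

definition lower_index :: "4 \<Rightarrow> 3" where
  "lower_index i = (if i = 1 then 0 else if i = 2 then 1 else 2)"

definition block_diag :: "quat ^ 2 ^ 2 \<Rightarrow> 3 bmat \<Rightarrow> 4 bmat" where
  "block_diag s B = from_blocks (\<lambda>i j.
     if i = 0 \<and> j = 0 then s
     else if i \<noteq> 0 \<and> j \<noteq> 0 then blk B (lower_index i) (lower_index j)
     else 0)"

definition block_tensor :: "(quat ^ 2 ^ 2) set \<Rightarrow> 3 bmat set \<Rightarrow> 4 bmat set"
    (infixr \<open>\<otimes>\<^sub>b\<close> 70) where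
  "X \<otimes>\<^sub>b Y = {block_diag s B | s B. s \<in> X \<and> B \<in> Y}"

definition circ_mult :: "quat ^ 2 ^ 2 \<Rightarrow> 'm::finite bmat \<Rightarrow> 'm bmat" (infixr \<open>\<circledast>\<close> 75) where
  "s \<circledast> A = from_blocks (\<lambda>i j. s ** blk A i j)"

definition sigma1 :: "4 bmat" where
  "sigma1 = from_blocks (\<lambda>i j. if (i, j) \<in> {(0,1), (1,0), (2,3), (3,2)} then mat 1 else 0)"

definition sigma2 :: "4 bmat" where
  "sigma2 = from_blocks (\<lambda>i j. if (i, j) \<in> {(0,2), (1,3), (2,0), (3,1)} then mat 1 else 0)"

definition tau :: "4 bmat" where
  "tau = from_blocks (\<lambda>i j. if i = j then mat2 0 1 1 0 else 0)"

section \<open>Spinor-vector matrices and the discrete Fourier transform\<close>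

definition svmat :: "(r2 \<Rightarrow> quat) \<Rightarrow> r2 \<Rightarrow> quat ^ 2 ^ 2" where
  "svmat f x = mat2 (spinor_part (f x)) (vector_part (f x))
                    (vector_part (f (- x))) (spinor_part (f (- x)))"

definition svconst :: "real \<Rightarrow> quat ^ 2 ^ 2" where
  "svconst c = svmat (\<lambda>_. of_real c) 0"

text \<open>\<open>svexp t y x\<close> is the matrix of the function \<open>y \<mapsto> exp (t y \<and> x)\<close>, which equals
  \<open>diag (exp (t y \<and> x), exp (- t y \<and> x))\<close>.\<close>

definition svexp :: "real \<Rightarrow> r2 \<Rightarrow> r2 \<Rightarrow> quat ^ 2 ^ 2" where
  "svexp t y x = svmat (\<lambda>y. exp (t *\<^sub>R wedge y x)) y"

definition corner :: "4 \<Rightarrow> r2" where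
  "corner l = (if l = 0 then (0,0) else if l = 1 then (1,0) else if l = 2 then (0,1) else (1,1))"

definition Q2 :: "int \<Rightarrow> z2 set" where
  "Q2 \<eta> = {0..<\<eta>} \<times> {0..<\<eta>}"

text \<open>Sample indices are read modulo \<open>\<eta>\<close> in each coordinate.\<close>

definition samples :: "int \<Rightarrow> (r2 \<Rightarrow> 4 bmat) \<Rightarrow> z2 \<Rightarrow> 4 bmat" where
  "samples \<eta> U j = U ((1 / real_of_int \<eta>) *\<^sub>R emb (fst j mod \<eta>, snd j mod \<eta>))"

definition dft :: "int \<Rightarrow> (z2 \<Rightarrow> 4 bmat) \<Rightarrow> z2 \<Rightarrow> 4 bmat" where
  "dft \<eta> B j = (\<Sum>k\<in>Q2 \<eta>. svexp (2 * pi / real_of_int \<eta>) (emb j) (emb k) \<circledast> B k)"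

definition idft :: "int \<Rightarrow> (z2 \<Rightarrow> 4 bmat) \<Rightarrow> z2 \<Rightarrow> 4 bmat" where
  "idft \<eta> C k = (1 / (real_of_int \<eta>)\<^sup>2) *\<^sub>R
     (\<Sum>j\<in>Q2 \<eta>. svexp (2 * pi / real_of_int \<eta>) (emb k) (emb j) \<circledast> C j)"

definition modulate :: "int \<Rightarrow> 4 \<Rightarrow> (z2 \<Rightarrow> 4 bmat) \<Rightarrow> z2 \<Rightarrow> 4 bmat" where
  "modulate \<eta> l B k = svexp (pi / real_of_int \<eta>) (corner l) (emb k) \<circledast> B k"

definition trig_poly :: "int \<Rightarrow> (z2 \<Rightarrow> 4 bmat) \<Rightarrow> r2 \<Rightarrow> 4 bmat" where
  "trig_poly \<eta> A \<xi> = (\<Sum>k\<in>Q2 \<eta>. svexp (2 * pi) \<xi> (emb k) \<circledast> A k)"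

definition partial1 :: "(r2 \<Rightarrow> quat) \<Rightarrow> r2 \<Rightarrow> quat" where
  "partial1 f \<xi> = vector_derivative (\<lambda>t. f (t, snd \<xi>)) (at (fst \<xi>))"

definition partial2 :: "(r2 \<Rightarrow> quat) \<Rightarrow> r2 \<Rightarrow> quat" where
  "partial2 f \<xi> = vector_derivative (\<lambda>t. f (fst \<xi>, t)) (at (snd \<xi>))"

definition matrix_partial :: "nat \<times> nat \<Rightarrow> (r2 \<Rightarrow> 4 bmat) \<Rightarrow> r2 \<Rightarrow> 4 bmat" where
  "matrix_partial \<alpha> U \<xi> =
     (\<chi> i j. (partial1 ^^ fst \<alpha>) ((partial2 ^^ snd \<alpha>) (\<lambda>\<xi>. U \<xi> $ i $ j)) \<xi>)"

section \<open>The right module $L^2$\<close>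

text \<open>Elements of $L^2$ are represented by functions; almost everywhere equal functions are at
  \<open>l2norm\<close>-distance 0, so closed sets are saturated under almost everywhere equality.\<close>

definition L2 :: "r2 measure \<Rightarrow> (r2 \<Rightarrow> quat) set" where
  "L2 M = {f \<in> borel_measurable M. integrable M (\<lambda>x. (norm (f x))\<^sup>2)}"

definition l2norm :: "r2 measure \<Rightarrow> (r2 \<Rightarrow> quat) \<Rightarrow> real" where
  "l2norm M f = sqrt (\<integral>x. (norm (f x))\<^sup>2 \<partial>M)"

definition l2inner :: "(r2 \<Rightarrow> quat) \<Rightarrow> (r2 \<Rightarrow> quat) \<Rightarrow> quat" where
  "l2inner f g = (\<integral>x. qcnj (f x) * g x \<partial>lborel)"

definition l2closure :: "(r2 \<Rightarrow> quat) set \<Rightarrow> (r2 \<Rightarrow> quat) set" where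
  "l2closure V = {f \<in> L2 lborel. \<forall>e>0. \<exists>g\<in>V. l2norm lborel (\<lambda>x. f x - g x) < e}"

definition l2_has_sum :: "r2 measure \<Rightarrow> ('i \<Rightarrow> r2 \<Rightarrow> quat) \<Rightarrow> (r2 \<Rightarrow> quat) \<Rightarrow> bool" where
  "l2_has_sum M b f \<longleftrightarrow> f \<in> L2 M \<and> (\<forall>i. b i \<in> L2 M) \<and>
     ((\<lambda>F. l2norm M (\<lambda>x. f x - (\<Sum>i\<in>F. b i x))) \<longlongrightarrow> 0) (finite_subsets_at_top UNIV)"

definition closed_right_submodule :: "(r2 \<Rightarrow> quat) set \<Rightarrow> bool" where
  "closed_right_submodule V \<longleftrightarrow> V \<subseteq> L2 lborel \<and> (\<lambda>_. 0) \<in> V \<and>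
     (\<forall>f\<in>V. \<forall>g\<in>V. (\<lambda>x. f x + g x) \<in> V) \<and>
     (\<forall>f\<in>V. \<forall>c. (\<lambda>x. f x * c) \<in> V) \<and>
     l2closure V \<subseteq> V"

definition right_span :: "'i set \<Rightarrow> ('i \<Rightarrow> r2 \<Rightarrow> quat) \<Rightarrow> (r2 \<Rightarrow> quat) set" where
  "right_span I b = {\<lambda>x. \<Sum>i\<in>F. b i x * c i | F c. finite F \<and> F \<subseteq> I}"

definition orthonormal_basis ::
    "'i set \<Rightarrow> ('i \<Rightarrow> r2 \<Rightarrow> quat) \<Rightarrow> (r2 \<Rightarrow> quat) set \<Rightarrow> bool" where
  "orthonormal_basis I b V \<longleftrightarrow> (\<forall>i\<in>I. b i \<in> V) \<and>
     (\<forall>i\<in>I. \<forall>j\<in>I. l2inner (b i) (b j) = (if i = j then 1 else 0)) \<and>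
     l2closure (right_span I b) = V"

section \<open>Multiresolution analyses and wavelet matrices\<close>

definition mra :: "(int \<Rightarrow> (r2 \<Rightarrow> quat) set) \<Rightarrow> (r2 \<Rightarrow> quat) \<Rightarrow> bool" where
  "mra V \<phi> \<longleftrightarrow>
     (\<forall>j. closed_right_submodule (V j)) \<and>
     (\<forall>j. V j \<subseteq> V (j + 1)) \<and>
     l2closure (\<Union>j. V j) = L2 lborel \<and>
     (\<Inter>j. V j) = {f \<in> L2 lborel. AE x in lborel. f x = 0} \<and>
     (\<forall>f. f \<in> V 0 \<longleftrightarrow> (\<forall>k. (\<lambda>x. f (x - emb k)) \<in> V 0)) \<and>
     (\<forall>f j. f \<in> V 0 \<longleftrightarrow> (\<lambda>x. f ((2 powi j) *\<^sub>R x)) \<in> V j) \<and>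
     \<phi> \<in> V 0 \<and>
     orthonormal_basis UNIV (\<lambda>k x. \<phi> (x - emb k)) (V 0)"

definition detail_space :: "(int \<Rightarrow> (r2 \<Rightarrow> quat) set) \<Rightarrow> int \<Rightarrow> (r2 \<Rightarrow> quat) set" where
  "detail_space V j = {f \<in> V (j + 1). \<forall>g\<in>V j. l2inner g f = 0}"

text \<open>The three wavelets are \<open>\<psi> 1, \<psi> 2, \<psi> 3\<close>; the value \<open>\<psi> 0\<close> is not used.  That the systems of all
  levels together form an orthonormal basis of $L^2$ is a consequence and not required separately.\<close>

definition wavelet_system ::
    "(int \<Rightarrow> (r2 \<Rightarrow> quat) set) \<Rightarrow> (4 \<Rightarrow> r2 \<Rightarrow> quat) \<Rightarrow> bool" where
  "wavelet_system V \<psi> \<longleftrightarrow> (\<forall>j. orthonormal_basis ({1, 2, 3} \<times> UNIV)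
     (\<lambda>(\<epsilon>, k) x. (2 powi j) *\<^sub>R \<psi> \<epsilon> ((2 powi j) *\<^sub>R x - emb k)) (detail_space V j))"

definition refinement_coeffs ::
    "(r2 \<Rightarrow> quat) \<Rightarrow> (r2 \<Rightarrow> quat) \<Rightarrow> (z2 \<Rightarrow> quat) \<Rightarrow> bool" where
  "refinement_coeffs \<phi> f a \<longleftrightarrow> (\<lambda>k. (norm (a k))\<^sup>2) summable_on UNIV \<and>
     l2_has_sum lborel (\<lambda>k x. \<phi> (x - emb k) * a k) (\<lambda>x. (1/4) *\<^sub>R f ((1/2) *\<^sub>R x))"

text \<open>For square summable coefficients the filter series converges in $L^2$ of the unit cell.\<close>

definition has_filter :: "(z2 \<Rightarrow> quat) \<Rightarrow> (r2 \<Rightarrow> quat) \<Rightarrow> bool" where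
  "has_filter a m \<longleftrightarrow> (\<forall>\<xi> k. m (\<xi> + emb k) = m \<xi>) \<and>
     l2_has_sum (restrict_space lborel ({0..1} \<times> {0..1}))
       (\<lambda>k \<xi>. exp ((2 * pi) *\<^sub>R wedge \<xi> (emb k)) * a k) m"

definition wavelet_matrix ::
    "(r2 \<Rightarrow> quat) \<Rightarrow> (4 \<Rightarrow> r2 \<Rightarrow> quat) \<Rightarrow> (r2 \<Rightarrow> 4 bmat) \<Rightarrow> bool" where
  "wavelet_matrix \<phi> \<psi> U \<longleftrightarrow> (\<exists>V a m. mra V \<phi> \<and> wavelet_system V \<psi> \<and>
     (\<forall>\<epsilon>. refinement_coeffs \<phi> ((\<psi>(0 := \<phi>)) \<epsilon>) (a \<epsilon>) \<and> has_filter (a \<epsilon>) (m \<epsilon>)) \<and>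
     (\<forall>\<xi>. U \<xi> = from_blocks (\<lambda>j \<epsilon>. svmat (m \<epsilon>) (\<xi> + (1/2) *\<^sub>R corner j))))"

text \<open>Only used for integrable functions.\<close>

definition quat_fourier :: "(r2 \<Rightarrow> quat) \<Rightarrow> r2 \<Rightarrow> quat" where
  "quat_fourier f \<xi> = (\<integral>x. exp ((2 * pi) *\<^sub>R wedge \<xi> x) * f x \<partial>lborel)"

text \<open>Integrability is required explicitly since the integral of a non-integrable function
  is 0 by convention.\<close>

definition vanishing_moments :: "nat \<Rightarrow> (4 \<Rightarrow> r2 \<Rightarrow> quat) \<Rightarrow> bool" where
  "vanishing_moments \<mu> \<psi> \<longleftrightarrow> (\<forall>\<epsilon>\<in>{1, 2, 3}. \<forall>\<alpha>1 \<alpha>2. \<alpha>1 + \<alpha>2 \<le> \<mu> \<longrightarrow>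
     integrable lborel (\<lambda>x. (fst x ^ \<alpha>1 * snd x ^ \<alpha>2) *\<^sub>R \<psi> \<epsilon> x) \<and>
     (\<integral>x. (fst x ^ \<alpha>1 * snd x ^ \<alpha>2) *\<^sub>R \<psi> \<epsilon> x \<partial>lborel) = 0)"

text \<open>The matrix \<open>[c\<^bsub>\<alpha> j\<^esub>]\<close> of moments of the exponentials.\<close>

definition moment_coeff :: "int \<Rightarrow> nat \<times> nat \<Rightarrow> z2 \<Rightarrow> quat ^ 2 ^ 2" where
  "moment_coeff \<eta> \<alpha> j = (\<Sum>k\<in>Q2 \<eta>.
     svconst (real_of_int (snd k ^ fst \<alpha> * fst k ^ snd \<alpha>)) **
     svexp (2 * pi / real_of_int \<eta>) (emb k) (emb j))"

end

theory Submission
  imports Defs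
begin

text \<open>
  Spinors commute with \<open>e\<^sub>1\<^sub>2\<close> and vectors anticommute with it. Therefore matrices with spinor-vector
  blocks form a complex algebra in disguise: multiplying all blocks by \<open>[exp (\<theta> e\<^sub>1\<^sub>2)]\<close> amounts to
  scalar multiplication by a complex unit and commutes with matrix products (\<open>pure_commute\<close>,
  \<open>phase_mult_right\<close>). With this, the orthogonality of exponentials on a grid shows that a
  trigonometric polynomial with frequencies in \<open>Q2 \<eta>\<close> is determined by \<open>\<eta>\<^sup>2\<close> samples
  (\<open>trig_sum_eq_iff\<close>). The symmetries under half-integer shifts and under reflection, and the
  symmetry of the scaling filter, are equations between two such polynomials and can be read off
  from coefficients or samples. For the moment conditions, derivatives at the origin, moments of
  the coefficients and weighted sums of samples differ only by invertible spinor factors, which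
  respect block-diagonality (\<open>matrix_partial_block_diag_iff\<close>, \<open>sum_moment_coeff_samples\<close>).

  For unitarity, \<open>U\<^sup>* U\<close> and \<open>U U\<^sup>*\<close> have the differences of the frequencies of \<open>U\<close> as frequencies.
  These are distinct modulo \<open>2 \<eta>\<close>, so it suffices to test on the grid of step \<open>1 / (2 \<eta>)\<close>, which
  is the union of the four half-shifted grids (\<open>difference_sum_const\<close>, \<open>half_grid\<close>).

  The value at the origin uses the wavelets. Uniqueness of Fourier coefficients turns the filters
  into polynomials, hence the refinement equations into finite sums. Orthonormality of the wavelets
  then says that the sums of \<open>a\<^sub>k\<^sup>* b\<^sub>k\<^sub>+\<^sub>2\<^sub>n\<close> over \<open>k\<close> are 1/4 or 0, so the values of the filters at the
  corners form a unitary matrix of quaternions (\<open>polyphase_orthonormal\<close>). Its first entry is 1,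
  since integrating the refinement equation shows that the coefficients of the scaling filter add
  up to 1; unitarity clears the rest of the first row and column (\<open>wavelet_matrix_at_0\<close>).

  If \<open>\<phi>\<close> is symmetric, its refinement coefficients are symmetric because they are inner products of
  \<open>\<phi>\<close> with shifts of itself on two scales. Conversely, if the coefficients are symmetric, then \<open>\<phi>\<close>
  and its reflection satisfy the same refinement equation and have the same integral. Their
  difference \<open>g\<close> is refinable with mean zero and must vanish (\<open>refinable_zero_mean_eq_0\<close>). In the
  commutative case this follows from the infinite product for the Fourier transform. The proof
  here avoids transforms: expressing \<open>g\<close> through its translates on a fine scale, the integral over
  a box only sees the lattice cells at the boundary, and the coefficients are small by
  orthonormality.
\<close>

section \<open>Unit spinors and conjugation\<close>

definition det2 :: "r2 \<Rightarrow> r2 \<Rightarrow> real" where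
  "det2 x y = fst x * snd y - snd x * fst y"

text \<open>
  The spinors form a copy of the complex numbers in which \<open>e\<^sub>1\<^sub>2\<close> plays the part of the imaginary
  unit. Exponentials and sums of roots of unity are computed there and carried over.
\<close>

definition quat_of_complex :: "complex \<Rightarrow> quat" where
  "quat_of_complex z = Quat (Re z) 0 0 (Im z)"

definition qcis :: "real \<Rightarrow> quat" where
  "qcis \<theta> = quat_of_complex (cis \<theta>)"

lemma quat_of_real_sel [simp]:
  "qc0 (of_real r) = r" "qc1 (of_real r) = 0" "qc2 (of_real r) = 0" "qc12 (of_real r) = 0"
  by (simp_all add: of_real_def)

lemma quat_of_int_sel [simp]:
  "qc0 (of_int n) = of_int n" "qc1 (of_int n) = 0" "qc2 (of_int n) = 0" "qc12 (of_int n) = 0"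
  by (metis of_real_of_int_eq quat_of_real_sel)+

lemma qcis_sel [simp]: "qc0 (qcis \<theta>) = cos \<theta>" "qc1 (qcis \<theta>) = 0" "qc2 (qcis \<theta>) = 0"
  "qc12 (qcis \<theta>) = sin \<theta>"
  by (simp_all add: qcis_def quat_of_complex_def)

lemma quat_of_complex_mult: "quat_of_complex (x * y) = quat_of_complex x * quat_of_complex y"
  by (simp add: quat_of_complex_def quat_eq_iff quat_sel_times)

lemma quat_of_complex_power: "quat_of_complex (x ^ n) = quat_of_complex x ^ n"
  by (induction n) (simp_all add: quat_of_complex_mult, simp add: quat_of_complex_def quat_eq_iff)

lemma bounded_linear_quat_of_complex: "bounded_linear quat_of_complex"
proof (rule bounded_linear_intro[where K = 1])
  show "norm (quat_of_complex z) \<le> norm z * 1" for z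
    by (simp add: quat_of_complex_def norm_quat_def inner_quat_def cmod_def power2_eq_square)
qed (simp_all add: quat_of_complex_def quat_eq_iff)

lemma quat_of_complex_exp: "quat_of_complex (exp z) = exp (quat_of_complex z)"
proof -
  interpret bounded_linear quat_of_complex by (rule bounded_linear_quat_of_complex)
  have "(\<lambda>n. quat_of_complex (z ^ n /\<^sub>R fact n)) sums quat_of_complex (exp z)"
    by (intro sums exp_converges)
  then have "(\<lambda>n. quat_of_complex z ^ n /\<^sub>R fact n) sums quat_of_complex (exp z)"
    by (simp add: scaleR quat_of_complex_power)
  then show ?thesis
    using exp_converges sums_unique2 by blast
qed

lemma exp_e12: "exp (t *\<^sub>R quat_e12) = qcis t"
proof -
  have "t *\<^sub>R quat_e12 = quat_of_complex (\<i> * of_real t)"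
    by (simp add: quat_of_complex_def quat_e12_def quat_eq_iff)
  then show ?thesis
    by (simp add: quat_of_complex_exp[symmetric] qcis_def cis_conv_exp)
qed

lemma exp_wedge: "exp (t *\<^sub>R wedge x y) = qcis (t * det2 x y)"
  by (simp add: wedge_def det2_def exp_e12)

lemma qcis_add: "qcis (a + b) = qcis a * qcis b"
  by (simp add: qcis_def cis_mult[symmetric] quat_of_complex_mult)

lemma qcis_0 [simp]: "qcis 0 = 1"
  by (simp add: quat_eq_iff)

lemma norm_qcis [simp]: "norm (qcis \<theta>) = 1"
  by (simp add: norm_quat_def inner_quat_def flip: power2_eq_square)

lemma qcis_plus_2pi_int: "qcis (\<theta> + 2 * pi * of_int n) = qcis \<theta>"
proof -
  have "cis (2 * pi * of_int n) = 1" by (rule cis_multiple_2pi) simp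
  then show ?thesis by (simp add: qcis_def cis_mult[symmetric])
qed

text \<open>
  Half-integer frequencies give real signs, which commute with every quaternion.
\<close>

lemma qcis_pi_int: "qcis (pi * of_int n) = of_real ((-1) powi n)"
  by (cases "even n") (simp_all add: quat_eq_iff of_real_def power_int_minus_left)

lemma qcnj_sel [simp]: "qc0 (qcnj x) = qc0 x" "qc1 (qcnj x) = - qc1 x" "qc2 (qcnj x) = - qc2 x"
  "qc12 (qcnj x) = - qc12 x"
  by (simp_all add: qcnj_def)

lemma qcnj_simps [simp]: "qcnj 0 = 0" "qcnj 1 = 1" "qcnj (qcnj x) = x" 
  "qcnj (x + y) = qcnj x + qcnj y" "qcnj (x - y) = qcnj x - qcnj y" "qcnj (- x) = - qcnj x"
  "qcnj (r *\<^sub>R x) = r *\<^sub>R qcnj x" "qcnj (qcis \<theta>) = qcis (- \<theta>)"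
  by (simp_all add: quat_eq_iff)

lemma qcnj_mult: "qcnj (x * y) = qcnj y * qcnj x"
  by (simp add: quat_eq_iff quat_sel_times)

lemma norm_qcnj [simp]: "norm (qcnj x) = norm x"
  by (simp add: norm_quat_def inner_quat_def)

lemma bounded_linear_qcnj: "bounded_linear qcnj"
  by (rule bounded_linear_intro[where K = 1]) simp_all

lemma qcnj_sum: "qcnj (sum f S) = (\<Sum>i\<in>S. qcnj (f i))"
  by (rule linear_sum) (rule bounded_linear.linear[OF bounded_linear_qcnj])

lemma qcnj_mult_self: "qcnj x * x = of_real ((norm x)\<^sup>2)"
  by (simp add: quat_eq_iff quat_sel_times norm_quat_def inner_quat_def of_real_def power2_eq_square)

section \<open>Orthogonality of exponentials on a grid\<close>

lemma sum_cis_roots: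
  assumes "N > 0"
  shows "(\<Sum>j\<in>{0..<N}. cis (2 * pi * of_int (j * n) / of_int N)) = (if N dvd n then of_int N else 0)"
proof -
  define z where "z = cis (2 * pi * of_int n / of_int N)"
  have zj: "cis (2 * pi * of_int (int j * n) / of_int N) = z ^ j" for j
    unfolding z_def Complex.DeMoivre by (rule arg_cong[where f = cis]) (simp add: field_simps)
  have "(\<Sum>j\<in>{0..<N}. cis (2 * pi * of_int (j * n) / of_int N))
      = (\<Sum>j\<in>{..<nat N}. z ^ j)"
    by (rule sum.reindex_bij_witness[where i = int and j = nat]) (use assms in \<open>auto simp flip: zj\<close>)
  moreover have "z ^ nat N = 1"
  proof -
    have "z ^ nat N = cis (2 * pi * of_int n)"
      using assms by (simp add: z_def Complex.DeMoivre)
    then show ?thesis by (simp add: cis_multiple_2pi)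
  qed
  moreover have "z = 1 \<longleftrightarrow> N dvd n"
  proof
    assume "z = 1"
    then have "cos (2 * pi * of_int n / of_int N) = 1"
      by (simp add: z_def complex_eq_iff)
    then obtain m :: int where "2 * pi * of_int n / of_int N = of_int m * 2 * pi"
      using cos_one_2pi_int by blast
    then have "real_of_int n = real_of_int (m * N)"
      using assms by (simp add: field_simps)
    then show "N dvd n" by (metis dvd_triv_right of_int_eq_iff)
  next
    assume "N dvd n"
    then obtain m where "n = N * m" ..
    then have "2 * pi * of_int n / of_int N = 2 * pi * real_of_int m"
      using assms by simp
    then show "z = 1" unfolding z_def by (simp add: cis_multiple_2pi)
  qed
  ultimately show ?thesis
    using assms by (auto simp: geometric_sum)
qed

lemma sum_qcis_roots:
  assumes "N > 0"
  shows "(\<Sum>j\<in>{0..<N}. qcis (2 * pi * of_int (j * n) / of_int N)) = (if N dvd n then of_int N else 0)"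
proof -
  interpret bounded_linear quat_of_complex by (rule bounded_linear_quat_of_complex)
  have "(\<Sum>j\<in>{0..<N}. qcis (2 * pi * of_int (j * n) / of_int N))
     = quat_of_complex (if N dvd n then of_int N else 0)"
    by (simp only: qcis_def sum[symmetric] sum_cis_roots[OF assms])
  then show ?thesis
    by (simp add: quat_of_complex_def quat_eq_iff)
qed

text \<open>
  The sum over the grid factors into two sums of roots of unity. The sign \<open>s\<close> is there because the
  second row of a spinor-vector block carries the inverse exponential.
\<close>

lemma sum_qcis_grid:
  assumes "N > 0" and s: "s \<in> {1, -1}"
  shows "(\<Sum>j\<in>Q2 N. qcis (s * (2 * pi / of_int N * det2 (emb j) (emb k)))) =
    (if N dvd fst k \<and> N dvd snd k then of_int (N ^ 2) else 0)"
proof -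
  obtain \<sigma> :: int where \<sigma>: "s = of_int \<sigma>" "\<bar>\<sigma>\<bar> = 1"
    using s by (metis abs_1 abs_minus insertE of_int_1 of_int_minus singletonD)
  have dvd: "N dvd \<sigma> * m \<longleftrightarrow> N dvd m" "N dvd - (\<sigma> * m) \<longleftrightarrow> N dvd m" for m
    using \<sigma>(2) by (auto simp: abs_if split: if_splits)
  have split: "qcis (s * (2 * pi / of_int N * det2 (emb j) (emb k))) =
      qcis (2 * pi * of_int (fst j * (\<sigma> * snd k)) / of_int N) *
      qcis (2 * pi * of_int (snd j * (- (\<sigma> * fst k))) / of_int N)" for j
    unfolding qcis_add[symmetric]
    by (rule arg_cong[where f = qcis]) (simp add: det2_def emb_def \<sigma> diff_divide_distrib algebra_simps)
  have "(\<Sum>j\<in>Q2 N. qcis (s * (2 * pi / of_int N * det2 (emb j) (emb k)))) =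
     (\<Sum>j\<in>{0..<N}. qcis (2 * pi * of_int (j * (\<sigma> * snd k)) / of_int N)) *
     (\<Sum>j\<in>{0..<N}. qcis (2 * pi * of_int (j * (- (\<sigma> * fst k))) / of_int N))"
    by (simp only: split Q2_def sum_product sum.cartesian_product) (simp add: case_prod_beta)
  also have "\<dots> = (if N dvd fst k \<and> N dvd snd k then of_int (N ^ 2) else 0)"
    by (simp only: sum_qcis_roots[OF \<open>N > 0\<close>] dvd) (auto simp: power2_eq_square)
  finally show ?thesis .
qed

lemma finite_Q2 [simp]: "finite (Q2 N)"
  by (simp add: Q2_def)

lemma det2_simps: "det2 (x + y) z = det2 x z + det2 y z" "det2 z (x + y) = det2 z x + det2 z y"
   "det2 (x - y) z = det2 x z - det2 y z" "det2 z (x - y) = det2 z x - det2 z y"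
   "det2 (- x) z = - det2 x z" "det2 z (- x) = - det2 z x"
   "det2 (c *\<^sub>R x) z = c * det2 x z" "det2 z (c *\<^sub>R x) = c * det2 z x" "det2 0 z = 0" "det2 z 0 = 0"
  by (simp_all add: det2_def algebra_simps)

lemma emb_simps [simp]: "emb (x + y) = emb x + emb y" "emb (x - y) = emb x - emb y" "emb (- x) = - emb x" "emb 0 = 0"
  by (simp_all add: emb_def prod_eq_iff)

lemma det2_emb: "det2 (emb j) (emb k) = of_int (fst j * snd k - snd j * fst k)"
  by (simp add: det2_def emb_def)

text \<open>
  Multiplying by the opposite exponential and summing over the grid keeps only the frequency \<open>k0\<close>,
  because no other element of \<open>K\<close> is congruent to it. Apart from \<open>K = Q2 N\<close>, this covers
  differences of frequencies from \<open>Q2 \<eta>\<close>, for which \<open>N = 2 \<eta>\<close> is fine enough.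
\<close>

lemma dft_inversion:
  fixes c :: "z2 \<Rightarrow> quat"
  assumes N: "N > 0" and s: "s \<in> {1, -1}" and fin: "finite K" and k0: "k0 \<in> K"
    and inj: "\<And>k. k \<in> K \<Longrightarrow> N dvd fst k - fst k0 \<Longrightarrow> N dvd snd k - snd k0 \<Longrightarrow> k = k0"
  shows "(\<Sum>j\<in>Q2 N. qcis (s * (2 * pi / of_int N * det2 (emb k0) (emb j))) *
     (\<Sum>k\<in>K. qcis (s * (2 * pi / of_int N * det2 (emb j) (emb k))) * c k)) = of_int (N ^ 2) * c k0"
proof -
  have shift: "qcis (s * (2 * pi / of_int N * det2 (emb k0) (emb j))) * qcis (s * (2 * pi / of_int N * det2 (emb j) (emb k)))
      = qcis (s * (2 * pi / of_int N * det2 (emb j) (emb (k - k0))))" for j k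
    unfolding qcis_add[symmetric]
    by (rule arg_cong[where f = qcis]) (simp add: det2_def emb_def diff_divide_distrib algebra_simps)
  have "(\<Sum>j\<in>Q2 N. qcis (s * (2 * pi / of_int N * det2 (emb k0) (emb j))) *
     (\<Sum>k\<in>K. qcis (s * (2 * pi / of_int N * det2 (emb j) (emb k))) * c k))
    = (\<Sum>j\<in>Q2 N. \<Sum>k\<in>K. qcis (s * (2 * pi / of_int N * det2 (emb j) (emb (k - k0)))) * c k)"
    by (simp only: sum_distrib_left mult.assoc[symmetric, where 'a = quat] shift)
  also have "\<dots> = (\<Sum>k\<in>K. (\<Sum>j\<in>Q2 N. qcis (s * (2 * pi / of_int N * det2 (emb j) (emb (k - k0))))) * c k)"
    by (subst sum.swap) (simp add: sum_distrib_right)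
  also have "\<dots> = (\<Sum>k\<in>K. if k = k0 then of_int (N ^ 2) * c k else 0)"
  proof (intro sum.cong refl)
    fix k assume "k \<in> K"
    then have "N dvd fst (k - k0) \<and> N dvd snd (k - k0) \<longleftrightarrow> k = k0"
      using inj[OF \<open>k \<in> K\<close>] by auto
    then show "(\<Sum>j\<in>Q2 N. qcis (s * (2 * pi / of_int N * det2 (emb j) (emb (k - k0))))) * c k =
      (if k = k0 then of_int (N ^ 2) * c k else 0)"
      by (simp only: sum_qcis_grid[OF N s] if_distrib[of "\<lambda>x. x * c k"] mult_zero_left)
  qed
  also have "\<dots> = of_int (N ^ 2) * c k0"
    using fin k0 by simp
  finally show ?thesis .
qed

lemma trig_coeff_zero:
  fixes c :: "z2 \<Rightarrow> quat"
  assumes N: "N > 0" and s: "s \<in> {1, -1}" and fin: "finite K"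
    and inj: "\<And>k k'. k \<in> K \<Longrightarrow> k' \<in> K \<Longrightarrow> N dvd fst k - fst k' \<Longrightarrow> N dvd snd k - snd k' \<Longrightarrow> k = k'"
    and zero: "\<And>j. j \<in> Q2 N \<Longrightarrow> (\<Sum>k\<in>K. qcis (s * (2 * pi / of_int N * det2 (emb j) (emb k))) * c k) = 0"
    and "k \<in> K"
  shows "c k = 0"
proof -
  have "of_int (N ^ 2) * c k = (\<Sum>j\<in>Q2 N. qcis (s * (2 * pi / of_int N * det2 (emb k) (emb j))) *
     (\<Sum>k\<in>K. qcis (s * (2 * pi / of_int N * det2 (emb j) (emb k))) * c k))"
    by (rule dft_inversion[OF N s fin \<open>k \<in> K\<close>, symmetric]) (rule inj[OF _ \<open>k \<in> K\<close>])
  also have "\<dots> = (\<Sum>j\<in>Q2 N. 0)"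
    by (intro sum.cong refl) (simp only: zero mult_zero_right)
  also have "\<dots> = 0" by simp
  finally have "of_int (N ^ 2) * c k = 0" .
  moreover have "(of_int (N ^ 2) :: quat) \<noteq> 0"
    using N by (simp only: of_int_eq_0_iff) simp
  ultimately show ?thesis
    by (simp only: mult_eq_0_iff) simp
qed

lemma Q2_inj_mod:
  assumes "k \<in> Q2 N" "k' \<in> Q2 N" "N dvd fst k - fst k'" "N dvd snd k - snd k'"
  shows "k = k'"
proof -
  have *: "a = b" if ab: "a \<in> {0..<N}" "b \<in> {0..<N}" and "N dvd a - b" for a b
  proof (rule ccontr)
    assume "a \<noteq> b"
    then have 1: "a - b \<noteq> 0" by simp
    have "\<bar>N\<bar> \<le> \<bar>a - b\<bar>"
      by (rule dvd_imp_le_int[OF 1 \<open>N dvd a - b\<close>])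
    moreover have "\<bar>a - b\<bar> < N" using ab by auto
    ultimately show False by linarith
  qed
  have "fst k = fst k'"
    by (rule *) (use assms in \<open>auto simp add: Q2_def\<close>)
  have "snd k = snd k'"
    by (rule *) (use assms in \<open>auto simp add: Q2_def\<close>)
  with \<open>fst k = fst k'\<close> show ?thesis by (rule prod_eqI)
qed

section \<open>Phases acting on spinor-vector block matrices\<close>

lemma exhaust_2_from_0: fixes p :: 2 shows "p = 0 \<or> p = 1"
  using exhaust_2[of p] by auto

lemma sum_UNIV_2: "sum f (UNIV :: 2 set) = f 0 + f 1"
proof -
  have "(UNIV :: 2 set) = {0, 1}" using exhaust_2_from_0 by blast
  moreover have "sum f {0, 1 :: 2} = f 0 + f 1" by simp
  ultimately show ?thesis by (simp only:)
qed

text \<open>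
  Position inside a block, turned into the sign with which exponentials act on that row.
\<close>

definition psign :: "2 \<Rightarrow> real" where "psign p = (if p = 0 then 1 else - 1)"

lemma psign_simps [simp]: "psign 0 = 1" "psign 1 = - 1" "psign p * psign p = 1"
  by (simp_all add: psign_def)

text \<open>
  This is the action of \<open>diag (exp (\<theta> e\<^sub>1\<^sub>2), exp (- \<theta> e\<^sub>1\<^sub>2))\<close> on all blocks, so that
  \<open>\<circledast>\<close> with an exponential becomes scalar multiplication by a complex unit.
\<close>

definition phase :: "real \<Rightarrow> 'm::finite bmat \<Rightarrow> 'm bmat" where
  "phase \<theta> A = (\<chi> r c. qcis (psign (snd r) * \<theta>) * A $ r $ c)"

lemma phase_nth [simp]: "phase \<theta> A $ r $ c = qcis (psign (snd r) * \<theta>) * A $ r $ c"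
  by (simp add: phase_def)

lemma phase_0 [simp]: "phase 0 A = A" "phase \<theta> 0 = 0"
  by (simp_all add: vec_eq_iff)

lemma phase_phase: "phase a (phase b A) = phase (a + b) A"
  by (simp add: vec_eq_iff mult.assoc[symmetric] qcis_add[symmetric] distrib_left)

lemma phase_sum: "phase \<theta> (sum f S) = (\<Sum>i\<in>S. phase \<theta> (f i))"
  by (simp add: vec_eq_iff sum_distrib_left)

lemma phase_diff: "phase \<theta> (A - B) = phase \<theta> A - phase \<theta> B"
  by (simp add: vec_eq_iff algebra_simps)

lemma phase_plus_2pi_int: "phase (\<theta> + 2 * pi * of_int n) A = phase \<theta> A"
proof -
  have "qcis (psign p * (\<theta> + 2 * pi * of_int n)) = qcis (psign p * \<theta>)" for p
    using exhaust_2_from_0[of p] qcis_plus_2pi_int[of \<theta> n] qcis_plus_2pi_int[of "- \<theta>" "- n"]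
    by auto
  then show ?thesis by (simp add: vec_eq_iff)
qed

lemma phase_pi_int: "phase (pi * of_int n) A = ((-1) powi n) *\<^sub>R A"
proof -
  have "qcis (psign p * (pi * of_int n)) * x = ((-1) powi n) *\<^sub>R x" for p x
    using qcis_pi_int[of n] qcis_pi_int[of "- n"] exhaust_2_from_0[of p]
    by (auto simp add: power_int_minus_one_minus scaleR_conv_of_real)
  then show ?thesis
    by (simp add: vec_eq_iff)
qed

lemma mat2_nth [simp]: "mat2 a b c d $ 0 $ 0 = a" "mat2 a b c d $ 0 $ 1 = b"
  "mat2 a b c d $ 1 $ 0 = c" "mat2 a b c d $ 1 $ 1 = d"
  by (simp_all add: mat2_def)

lemma blk_nth [simp]: "blk A i j $ p $ q = A $ (i, p) $ (j, q)"
  by (simp add: blk_def)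

lemma from_blocks_nth [simp]: "from_blocks B $ r $ c = B (fst r) (fst c) $ snd r $ snd c"
  by (simp add: from_blocks_def)

lemma mat2_eqI: fixes M N :: "quat ^ 2 ^ 2"
  assumes "\<And>p q. M $ p $ q = N $ p $ q" shows "M = N"
  using assms by (simp add: vec_eq_iff)

lemma circ_mult_nth: "(s \<circledast> A) $ r $ c = s $ snd r $ 0 * A $ (fst r, 0) $ c + s $ snd r $ 1 * A $ (fst r, 1) $ c"
  by (simp add: circ_mult_def matrix_matrix_mult_def sum_UNIV_2)

lemma spinor_part_qcis [simp]: "spinor_part (qcis \<theta>) = qcis \<theta>" "vector_part (qcis \<theta>) = 0"
  by (simp_all add: quat_eq_iff spinor_part_def vector_part_def quat_e12_def)

lemma svexp_eq: "svexp t y x = mat2 (qcis (t * det2 y x)) 0 0 (qcis (- (t * det2 y x)))"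
  by (simp add: svexp_def svmat_def exp_wedge det2_simps)

lemma svexp_circ: "svexp t y x \<circledast> A = phase (t * det2 y x) A"
  unfolding vec_eq_iff
proof (intro allI)
  fix r c
  show "(svexp t y x \<circledast> A) $ r $ c = phase (t * det2 y x) A $ r $ c"
    using exhaust_2_from_0[of "snd r"] by (cases r) (auto simp: circ_mult_nth svexp_eq)
qed

lemma svconst_eq: "svconst c = mat2 (of_real c) 0 0 (of_real c)"
  by (simp add: svconst_def svmat_def spinor_part_def vector_part_def)

lemma svconst_circ: "svconst a \<circledast> A = a *\<^sub>R A"
  unfolding vec_eq_iff
proof (intro allI)
  fix r c
  show "(svconst a \<circledast> A) $ r $ c = (a *\<^sub>R A) $ r $ c"
    using exhaust_2_from_0[of "snd r"]
    by (cases r) (auto simp: circ_mult_nth svconst_eq of_real_def)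
qed

lemma circ_mult_assoc: "(s ** t) \<circledast> A = s \<circledast> (t \<circledast> A)"
  by (simp add: vec_eq_iff circ_mult_nth matrix_matrix_mult_def sum_UNIV_2 algebra_simps)

lemma circ_mult_sum_left: "sum s S \<circledast> A = (\<Sum>i\<in>S. s i \<circledast> A)"
  by (simp add: vec_eq_iff circ_mult_nth sum_distrib_right sum.distrib)

text \<open>
  The condition that an entry of a block in \<open>SV\<close> satisfies at position \<open>(p, q)\<close>: spinors on the
  diagonal, vectors off it. In this form it is a grading by the two positions, compatible with products.
\<close>

definition pure :: "2 \<Rightarrow> 2 \<Rightarrow> quat \<Rightarrow> bool" where
  "pure p q x \<longleftrightarrow> (if p = q then qc1 x = 0 \<and> qc2 x = 0 else qc0 x = 0 \<and> qc12 x = 0)"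

lemma pure_0 [simp]: "pure p q 0"
  by (simp add: pure_def)

lemma pure_sum: "(\<And>i. i \<in> S \<Longrightarrow> pure p q (f i)) \<Longrightarrow> pure p q (sum f S)"
  by (induction S rule: infinite_finite_induct) (auto simp: pure_def split: if_splits)

lemma pure_scaleR: "pure p q x \<Longrightarrow> pure p q (c *\<^sub>R x)"
  by (auto simp: pure_def)

lemma pure_mult: "pure p q x \<Longrightarrow> pure q r y \<Longrightarrow> pure p r (x * y)"
  using exhaust_2_from_0[of p] exhaust_2_from_0[of q] exhaust_2_from_0[of r]
  by (auto simp: pure_def quat_sel_times)

lemma pure_qcnj: "pure p q (qcnj x) \<longleftrightarrow> pure q p x"
  by (auto simp: pure_def)

lemma pure_qcis [simp]: "pure p p (qcis \<theta>)"
  by (simp add: pure_def)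

text \<open>
  Spinors commute with \<open>e\<^sub>1\<^sub>2\<close> and vectors anticommute with it. The sign lost when an exponential
  moves past a vector is the one by which the two positions differ.
\<close>

lemma pure_commute:
  assumes "pure p q x"
  shows "x * qcis (psign q * \<theta>) = qcis (psign p * \<theta>) * x"
  using exhaust_2_from_0[of p] exhaust_2_from_0[of q] assms
  by (auto simp: pure_def quat_eq_iff quat_sel_times)

lemma range_spinor_part: "s \<in> range spinor_part \<longleftrightarrow> qc1 s = 0 \<and> qc2 s = 0"
proof
  assume "qc1 s = 0 \<and> qc2 s = 0"
  then have "s = spinor_part s" by (simp add: quat_eq_iff spinor_part_def quat_e12_def)
  then show "s \<in> range spinor_part" by blast
qed (auto simp: spinor_part_def quat_e12_def)

lemma range_vector_part: "s \<in> range vector_part \<longleftrightarrow> qc0 s = 0 \<and> qc12 s = 0"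
proof
  assume "qc0 s = 0 \<and> qc12 s = 0"
  then have "s = vector_part s" by (simp add: quat_eq_iff vector_part_def quat_e1_def quat_e2_def)
  then show "s \<in> range vector_part" by blast
qed (auto simp: vector_part_def quat_e1_def quat_e2_def)

lemma SV_iff: "M \<in> SV \<longleftrightarrow> (\<forall>p q. pure p q (M $ p $ q))"
proof
  assume "M \<in> SV"
  then obtain s1 v1 v2 s2 where M: "M = mat2 s1 v1 v2 s2"
    and "s1 \<in> range spinor_part" "s2 \<in> range spinor_part" "v1 \<in> range vector_part" "v2 \<in> range vector_part"
    unfolding SV_def by blast
  then have "pure 0 0 s1" "pure 1 1 s2" "pure 0 1 v1" "pure 1 0 v2"
    by (simp_all only: range_spinor_part range_vector_part pure_def) simp_all
  then have "pure p q (M $ p $ q)" for p q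
    using exhaust_2_from_0[of p] exhaust_2_from_0[of q] unfolding M by auto
  then show "\<forall>p q. pure p q (M $ p $ q)" by blast
next
  assume *: "\<forall>p q. pure p q (M $ p $ q)"
  have "M $ p $ q = mat2 (M $ 0 $ 0) (M $ 0 $ 1) (M $ 1 $ 0) (M $ 1 $ 1) $ p $ q" for p q
    using exhaust_2_from_0[of p] exhaust_2_from_0[of q] by auto
  then have "M = mat2 (M $ 0 $ 0) (M $ 0 $ 1) (M $ 1 $ 0) (M $ 1 $ 1)"
    by (rule mat2_eqI)
  moreover have "M $ 0 $ 0 \<in> range spinor_part" "M $ 1 $ 1 \<in> range spinor_part"
    "M $ 0 $ 1 \<in> range vector_part" "M $ 1 $ 0 \<in> range vector_part"
    unfolding range_spinor_part range_vector_part
    using *[rule_format, of 0 0] *[rule_format, of 1 1] *[rule_format, of 1 0] *[rule_format, of 0 1]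
    by (simp_all add: pure_def)
  ultimately show "M \<in> SV"
    unfolding SV_def by blast
qed

lemma SVmat_iff: "A \<in> SVmat \<longleftrightarrow> (\<forall>r c. pure (snd r) (snd c) (A $ r $ c))"
  by (auto simp: SVmat_def SV_iff)

lemma SVmat_pure: "A \<in> SVmat \<Longrightarrow> pure (snd r) (snd c) (A $ r $ c)"
  unfolding SVmat_iff by blast

lemma SVmat_sum: "(\<And>i. i \<in> S \<Longrightarrow> f i \<in> SVmat) \<Longrightarrow> sum f S \<in> SVmat"
  by (auto simp: SVmat_iff intro!: pure_sum)

lemma SVmat_scaleR: "A \<in> SVmat \<Longrightarrow> c *\<^sub>R A \<in> SVmat"
  by (auto simp: SVmat_iff intro!: pure_scaleR)

lemma qadjoint_nth [simp]: "qadjoint A $ i $ j = qcnj (A $ j $ i)"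
  by (simp add: qadjoint_def)

lemma SVmat_qadjoint: "A \<in> SVmat \<Longrightarrow> qadjoint A \<in> SVmat"
  by (simp add: SVmat_iff pure_qcnj)

lemma matrix_mult_nth: "(A ** B) $ i $ j = (\<Sum>k\<in>UNIV. A $ i $ k * B $ k $ j)"
  by (simp add: matrix_matrix_mult_def)

lemma phase_mult_left: "phase \<theta> A ** B = phase \<theta> (A ** B)"
  by (simp add: vec_eq_iff matrix_mult_nth sum_distrib_left mult.assoc)

text \<open>
  Here lies the reason why the quaternionic statements behave like complex ones: phases are
  central for matrices with spinor-vector blocks, although quaternions do not commute.
\<close>

lemma phase_mult_right:
  assumes "A \<in> SVmat"
  shows "A ** phase \<theta> B = phase \<theta> (A ** B)"
proof -
  have "A $ r $ t * (qcis (psign (snd t) * \<theta>) * x) = qcis (psign (snd r) * \<theta>) * (A $ r $ t * x)" for r t x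
    using pure_commute[OF SVmat_pure[OF assms], of r t \<theta>] by (simp add: mult.assoc[symmetric])
  then show ?thesis
    by (simp add: vec_eq_iff matrix_mult_nth sum_distrib_left)
qed

lemma qadjoint_phase:
  assumes "A \<in> SVmat"
  shows "qadjoint (phase \<theta> A) = phase (- \<theta>) (qadjoint A)"
proof -
  have "pure (snd r) (snd t) (qcnj (A $ t $ r))" for r t
    using SVmat_pure[OF assms, of t r] by (simp add: pure_qcnj)
  from pure_commute[OF this, of _ _ "- \<theta>"] show ?thesis
    by (simp add: vec_eq_iff qcnj_mult)
qed

lemma qadjoint_sum: "qadjoint (sum f S) = (\<Sum>i\<in>S. qadjoint (f i))"
  by (simp add: vec_eq_iff qcnj_sum)

lemma matrix_mult_sum_left:
  fixes f :: "'i \<Rightarrow> 'a::semiring_1 ^ 'n ^ 'm"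
  shows "sum f S ** B = (\<Sum>i\<in>S. f i ** B)"
  by (simp add: vec_eq_iff matrix_mult_nth sum_distrib_right) (auto intro: sum.swap)

lemma matrix_mult_sum_right:
  fixes f :: "'i \<Rightarrow> 'a::semiring_1 ^ 'n ^ 'm"
  shows "B ** sum f S = (\<Sum>i\<in>S. B ** f i)"
  by (simp add: vec_eq_iff matrix_mult_nth sum_distrib_left) (auto intro: sum.swap)

section \<open>Trigonometric polynomials and their samples\<close>

definition trig_sum :: "z2 set \<Rightarrow> (z2 \<Rightarrow> 'm::finite bmat) \<Rightarrow> r2 \<Rightarrow> 'm bmat" where
  "trig_sum K C \<xi> = (\<Sum>k\<in>K. phase (2 * pi * det2 \<xi> (emb k)) (C k))"

lemma trig_poly_eq: "trig_poly \<eta> A = trig_sum (Q2 \<eta>) A"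
  by (simp add: fun_eq_iff trig_poly_def trig_sum_def svexp_circ)

lemma trig_sum_nth: "trig_sum K C \<xi> $ r $ c = (\<Sum>k\<in>K. qcis (psign (snd r) * (2 * pi * det2 \<xi> (emb k))) * C k $ r $ c)"
  by (simp add: trig_sum_def)

text \<open>
  Uniqueness of coefficients, entry by entry. With \<open>\<sigma> = - 1\<close> the samples are taken on the
  reflected grid, as needed for symmetries under \<open>\<xi> \<mapsto> - \<xi>\<close>.
\<close>

lemma trig_sum_coeff_zero:
  fixes C :: "z2 \<Rightarrow> 'm::finite bmat"
  assumes N: "N > 0" and fin: "finite K"
    and inj: "\<And>k k'. k \<in> K \<Longrightarrow> k' \<in> K \<Longrightarrow> N dvd fst k - fst k' \<Longrightarrow> N dvd snd k - snd k' \<Longrightarrow> k = k'"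
    and \<sigma>: "\<sigma> \<in> {1, -1}"
    and zero: "\<And>j. j \<in> Q2 N \<Longrightarrow> trig_sum K C ((\<sigma> / of_int N) *\<^sub>R emb j) = 0"
    and "k \<in> K"
  shows "C k = 0"
  unfolding vec_eq_iff
proof (intro allI)
  fix r c
  have "C k $ r $ c = 0"
  proof (rule trig_coeff_zero[where s = "psign (snd r) * \<sigma>" and c = "\<lambda>k. C k $ r $ c", OF N _ fin inj _ \<open>k \<in> K\<close>])
    fix j assume "j \<in> Q2 N"
    from zero[OF this] have "trig_sum K C ((\<sigma> / of_int N) *\<^sub>R emb j) $ r $ c = 0" by simp
    then show "(\<Sum>k\<in>K. qcis (psign (snd r) * \<sigma> * (2 * pi / of_int N * det2 (emb j) (emb k))) * C k $ r $ c) = 0"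
      by (simp add: trig_sum_nth det2_simps mult_ac)
  qed (use \<sigma> in \<open>auto simp add: psign_def\<close>)
  then show "C k $ r $ c = 0 $ r $ c" by simp
qed

lemma trig_sum_diff: "trig_sum K C \<xi> - trig_sum K D \<xi> = trig_sum K (\<lambda>k. C k - D k) \<xi>"
  by (simp add: trig_sum_def sum_subtractf phase_diff)

lemma trig_sum_Q2_eqI:
  assumes N: "N > 0" and \<sigma>: "\<sigma> \<in> {1, -1}"
    and eq: "\<And>j. j \<in> Q2 N \<Longrightarrow> trig_sum (Q2 N) C ((\<sigma> / of_int N) *\<^sub>R emb j) = trig_sum (Q2 N) D ((\<sigma> / of_int N) *\<^sub>R emb j)"
    and "k \<in> Q2 N"
  shows "C k = D k"
proof -
  have "C k - D k = 0"
    by (rule trig_sum_coeff_zero[OF N finite_Q2 Q2_inj_mod \<sigma> _ \<open>k \<in> Q2 N\<close>])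
      (use eq in \<open>simp_all add: trig_sum_diff[symmetric]\<close>)
  then show ?thesis by simp
qed

lemma trig_sum_cong: "(\<And>k. k \<in> K \<Longrightarrow> C k = D k) \<Longrightarrow> trig_sum K C = trig_sum K D"
  by (simp add: trig_sum_def fun_eq_iff)

lemma trig_sum_periodic: "trig_sum K C (\<xi> + emb m) = trig_sum K C \<xi>"
  by (simp add: trig_sum_def det2_simps det2_emb distrib_left phase_plus_2pi_int del: of_int_diff of_int_mult)

text \<open>
  Reading indices modulo \<open>\<eta>\<close> is harmless for functions with integer periods.
\<close>

lemma samples_periodic:
  assumes "\<eta> > 0" and per: "\<And>\<xi> m. U (\<xi> + emb m) = U \<xi>"
  shows "samples \<eta> U j = U ((1 / of_int \<eta>) *\<^sub>R emb j)"
proof -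
  have mod: "real_of_int (a mod \<eta>) / of_int \<eta> = of_int a / of_int \<eta> - of_int (a div \<eta>)" for a
    using assms(1) by (simp add: field_simps flip: of_int_mult of_int_add)
  have "(1 / of_int \<eta>) *\<^sub>R emb (fst j mod \<eta>, snd j mod \<eta>) = (1 / of_int \<eta>) *\<^sub>R emb j + emb (- (fst j div \<eta>), - (snd j div \<eta>))"
    by (simp add: emb_def mod)
  then show ?thesis
    by (simp only: samples_def per)
qed

text \<open>
  A linear identity between trigonometric polynomials with frequencies in \<open>Q2 N\<close> can be tested on
  the function, on the coefficients, or on \<open>N\<^sup>2\<close> samples. All equivalences about symmetries are
  instances of this.
\<close>

lemma trig_sum_eq_iff:
  assumes N: "N > 0" and \<sigma>: "\<sigma> \<in> {1, -1}"
  shows "(\<forall>\<xi>. trig_sum (Q2 N) C (\<sigma> *\<^sub>R \<xi>) = trig_sum (Q2 N) D (\<sigma> *\<^sub>R \<xi>)) \<longleftrightarrow> (\<forall>k\<in>Q2 N. C k = D k)"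
    and "(\<forall>k\<in>Q2 N. C k = D k) \<longleftrightarrow> (\<forall>j\<in>Q2 N. trig_sum (Q2 N) C ((\<sigma> / of_int N) *\<^sub>R emb j) = trig_sum (Q2 N) D ((\<sigma> / of_int N) *\<^sub>R emb j))"
proof -
  have 1: "trig_sum (Q2 N) C = trig_sum (Q2 N) D" if "\<forall>k\<in>Q2 N. C k = D k"
    using that by (intro trig_sum_cong) auto
  have 2: "\<forall>k\<in>Q2 N. C k = D k" 
    if "\<forall>j\<in>Q2 N. trig_sum (Q2 N) C ((\<sigma> / of_int N) *\<^sub>R emb j) = trig_sum (Q2 N) D ((\<sigma> / of_int N) *\<^sub>R emb j)"
    using trig_sum_Q2_eqI[OF N \<sigma>, of C D] that by blast
  have 3: "trig_sum (Q2 N) C ((\<sigma> / of_int N) *\<^sub>R emb j) = trig_sum (Q2 N) D ((\<sigma> / of_int N) *\<^sub>R emb j)"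
    if "\<forall>\<xi>. trig_sum (Q2 N) C (\<sigma> *\<^sub>R \<xi>) = trig_sum (Q2 N) D (\<sigma> *\<^sub>R \<xi>)" for j
    using that[rule_format, of "(1 / of_int N) *\<^sub>R emb j"] by simp
  show "(\<forall>\<xi>. trig_sum (Q2 N) C (\<sigma> *\<^sub>R \<xi>) = trig_sum (Q2 N) D (\<sigma> *\<^sub>R \<xi>)) \<longleftrightarrow> (\<forall>k\<in>Q2 N. C k = D k)"
    using 1 2 3 by metis
  show "(\<forall>k\<in>Q2 N. C k = D k) \<longleftrightarrow> (\<forall>j\<in>Q2 N. trig_sum (Q2 N) C ((\<sigma> / of_int N) *\<^sub>R emb j) = trig_sum (Q2 N) D ((\<sigma> / of_int N) *\<^sub>R emb j))"
    using 1 2 by metis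
qed

lemma samples_trig_poly:
  assumes "\<eta> > 0"
  shows "samples \<eta> (trig_poly \<eta> A) j = trig_sum (Q2 \<eta>) A ((1 / of_int \<eta>) *\<^sub>R emb j)"
  unfolding trig_poly_eq by (rule samples_periodic[OF assms trig_sum_periodic])

lemma trig_sum_inversion:
  assumes N: "N > 0" and "k \<in> Q2 N"
  shows "(\<Sum>j\<in>Q2 N. phase (2 * pi / of_int N * det2 (emb k) (emb j)) (trig_sum (Q2 N) A ((1 / of_int N) *\<^sub>R emb j)))
    = (of_int N)\<^sup>2 *\<^sub>R A k"
  unfolding vec_eq_iff
proof (intro allI)
  fix r c
  have "(\<Sum>j\<in>Q2 N. qcis (psign (snd r) * (2 * pi / of_int N * det2 (emb k) (emb j))) *
     (\<Sum>l\<in>Q2 N. qcis (psign (snd r) * (2 * pi / of_int N * det2 (emb j) (emb l))) * A l $ r $ c)) = of_int (N ^ 2) * A k $ r $ c"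
    by (rule dft_inversion[OF N _ finite_Q2 \<open>k \<in> Q2 N\<close> Q2_inj_mod]) (use \<open>k \<in> Q2 N\<close> in \<open>auto simp: psign_def\<close>)
  moreover have "of_int (N ^ 2) * x = (of_int N)\<^sup>2 *\<^sub>R x" for x :: quat
    by (metis of_int_power of_real_of_int_eq scaleR_conv_of_real)
  ultimately show "(\<Sum>j\<in>Q2 N. phase (2 * pi / of_int N * det2 (emb k) (emb j)) (trig_sum (Q2 N) A ((1 / of_int N) *\<^sub>R emb j))) $ r $ c
    = ((of_int N)\<^sup>2 *\<^sub>R A k) $ r $ c"
    by (simp add: trig_sum_nth det2_simps)
qed

lemma idft_samples:
  assumes "\<eta> > 0" "k \<in> Q2 \<eta>"
  shows "idft \<eta> (samples \<eta> (trig_poly \<eta> A)) k = A k"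
  unfolding idft_def svexp_circ samples_trig_poly[OF assms(1)] trig_sum_inversion[OF assms]
  using assms by simp

text \<open>
  The inverse transform recovers the coefficients from the samples; modulation then shifts the grid
  by half a step in the direction of a corner.
\<close>

lemma dft_modulate_idft_samples:
  assumes "\<eta> > 0"
  shows "dft \<eta> (modulate \<eta> l (idft \<eta> (samples \<eta> (trig_poly \<eta> A)))) j =
    trig_sum (Q2 \<eta>) A ((1 / of_int \<eta>) *\<^sub>R (emb j + (1/2) *\<^sub>R corner l))"
  unfolding dft_def modulate_def trig_sum_def
proof (rule sum.cong[OF refl])
  fix k assume "k \<in> Q2 \<eta>"
  have "2 * pi / of_int \<eta> * det2 (emb j) (emb k) + pi / of_int \<eta> * det2 (corner l) (emb k)
    = 2 * pi * det2 ((1 / of_int \<eta>) *\<^sub>R (emb j + (1/2) *\<^sub>R corner l)) (emb k)"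
    using assms by (simp add: det2_simps field_simps)
  then show "svexp (2 * pi / of_int \<eta>) (emb j) (emb k) \<circledast> svexp (pi / of_int \<eta>) (corner l) (emb k) \<circledast>
      idft \<eta> (samples \<eta> (trig_poly \<eta> A)) k =
      phase (2 * pi * det2 ((1 / of_int \<eta>) *\<^sub>R (emb j + (1/2) *\<^sub>R corner l)) (emb k)) (A k)"
    by (simp only: idft_samples[OF assms \<open>k \<in> Q2 \<eta>\<close>] svexp_circ phase_phase)
qed

section \<open>Unitarity tested on finitely many samples\<close>

text \<open>
  Centrality of the phases lets all exponentials be collected in front, with the difference of the
  two frequencies.
\<close>

lemma qadjoint_trig_sum_mult:
  assumes "\<And>k. k \<in> K \<Longrightarrow> A k \<in> SVmat"
  shows "qadjoint (trig_sum K A \<xi>) ** trig_sum K A \<xi> =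
    (\<Sum>(k, l)\<in>K \<times> K. phase (2 * pi * det2 \<xi> (emb (l - k))) (qadjoint (A k) ** A l))"
proof -
  have "phase (- (2 * pi * det2 \<xi> (emb k))) (qadjoint (A k)) ** phase (2 * pi * det2 \<xi> (emb l)) (A l)
    = phase (2 * pi * det2 \<xi> (emb (l - k))) (qadjoint (A k) ** A l)" if "k \<in> K" for k l
  proof -
    have "2 * pi * det2 \<xi> (emb (l - k)) = 2 * pi * det2 \<xi> (emb l) + - (2 * pi * det2 \<xi> (emb k))"
      by (simp add: det2_simps algebra_simps)
    then show ?thesis
      by (simp only: phase_mult_left phase_mult_right[OF SVmat_qadjoint[OF assms[OF that]]] phase_phase add.commute)
  qed
  then show ?thesis
    by (simp add: trig_sum_def qadjoint_sum matrix_mult_sum_left matrix_mult_sum_right qadjoint_phase assms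
       sum.cartesian_product[symmetric] cong: sum.cong) (subst sum.swap, simp)
qed

lemma trig_sum_mult_qadjoint:
  assumes "\<And>k. k \<in> K \<Longrightarrow> A k \<in> SVmat"
  shows "trig_sum K A \<xi> ** qadjoint (trig_sum K A \<xi>) =
    (\<Sum>(k, l)\<in>K \<times> K. phase (2 * pi * det2 \<xi> (emb (l - k))) (A l ** qadjoint (A k)))"
proof -
  have "phase (2 * pi * det2 \<xi> (emb l)) (A l) ** phase (- (2 * pi * det2 \<xi> (emb k))) (qadjoint (A k))
    = phase (2 * pi * det2 \<xi> (emb (l - k))) (A l ** qadjoint (A k))" if "l \<in> K" for k l
  proof -
    have "2 * pi * det2 \<xi> (emb (l - k)) = 2 * pi * det2 \<xi> (emb l) + - (2 * pi * det2 \<xi> (emb k))"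
      by (simp add: det2_simps algebra_simps)
    then show ?thesis
      by (simp only: phase_mult_left phase_mult_right[OF assms[OF that]] phase_phase)
  qed
  then show ?thesis
    by (simp add: trig_sum_def qadjoint_sum matrix_mult_sum_left matrix_mult_sum_right qadjoint_phase assms
       sum.cartesian_product[symmetric] cong: sum.cong)
qed

text \<open>
  Differences of elements of \<open>Q2 \<eta>\<close> have coordinates of absolute value less than \<open>\<eta>\<close>, so they are
  distinct modulo \<open>2 \<eta>\<close>. Hence a polynomial in these frequencies that agrees with a constant on the
  grid of step \<open>1 / (2 \<eta>)\<close> is that constant.
\<close>

lemma difference_sum_const:
  fixes B :: "z2 \<Rightarrow> z2 \<Rightarrow> 'm::finite bmat" and M :: "'m bmat" and \<eta> :: int
  defines "G \<equiv> \<lambda>\<xi>. \<Sum>(k, l)\<in>Q2 \<eta> \<times> Q2 \<eta>. phase (2 * pi * det2 \<xi> (emb (l - k))) (B k l)"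
  assumes \<eta>: "\<eta> > 0" and grid: "\<And>i. i \<in> Q2 (2 * \<eta>) \<Longrightarrow> G ((1 / of_int (2 * \<eta>)) *\<^sub>R emb i) = M"
  shows "G \<xi> = M"
proof -
  define K where "K = {- (\<eta> - 1)..\<eta> - 1} \<times> {- (\<eta> - 1)..\<eta> - 1}"
  \<comment> \<open>The coefficients of \<open>G - M\<close>; the constant \<open>M\<close> belongs to the frequency 0.\<close>
  define D where "D n = (\<Sum>p\<in>{p \<in> Q2 \<eta> \<times> Q2 \<eta>. snd p - fst p = n}. B (fst p) (snd p)) - (if n = 0 then M else 0)" for n
  have fin: "finite K" by (simp add: K_def)
  have GD: "G \<xi> - M = trig_sum K D \<xi>" for \<xi>
  proof -
    have "trig_sum K D \<xi> = (\<Sum>n\<in>K. \<Sum>p\<in>{p \<in> Q2 \<eta> \<times> Q2 \<eta>. snd p - fst p = n}. phase (2 * pi * det2 \<xi> (emb (snd p - fst p))) (B (fst p) (snd p)))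
       - (\<Sum>n\<in>K. if n = 0 then M else 0)"
      unfolding trig_sum_def D_def sum_subtractf[symmetric] phase_diff phase_sum
      by (intro sum.cong refl arg_cong2[where f = "(-)"]) (auto simp: det2_simps)
    also have "(\<Sum>n\<in>K. \<Sum>p\<in>{p \<in> Q2 \<eta> \<times> Q2 \<eta>. snd p - fst p = n}. phase (2 * pi * det2 \<xi> (emb (snd p - fst p))) (B (fst p) (snd p)))
       = G \<xi>"
      unfolding G_def case_prod_beta
      by (rule sum.group) (use fin in \<open>auto simp: K_def Q2_def\<close>)
    also have "(\<Sum>n\<in>K. if n = 0 then M else 0) = M"
      using \<eta> fin by (simp add: K_def zero_prod_def)
    finally show ?thesis by simp
  qed
  have "D n = 0" if "n \<in> K" for n
  proof (rule trig_sum_coeff_zero[of "2 * \<eta>" K 1 D, OF _ fin _ _ _ that])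
    show "trig_sum K D ((1 / of_int (2 * \<eta>)) *\<^sub>R emb j) = 0" if "j \<in> Q2 (2 * \<eta>)" for j
      using grid[OF that] by (simp only: GD[symmetric]) simp
    show "k = k'" if "k \<in> K" "k' \<in> K" "2 * \<eta> dvd fst k - fst k'" "2 * \<eta> dvd snd k - snd k'" for k k'
    proof -
      have *: "a = b" if "2 * \<eta> dvd a - b" "\<bar>a - b\<bar> < 2 * \<eta>" for a b
      proof (rule ccontr)
        assume "a \<noteq> b"
        then have "a - b \<noteq> 0" by simp
        from dvd_imp_le_int[OF this \<open>2 * \<eta> dvd a - b\<close>] that(2) show False by linarith
      qed
      have "\<bar>fst k - fst k'\<bar> < 2 * \<eta>" "\<bar>snd k - snd k'\<bar> < 2 * \<eta>"
        using that(1,2) by (auto simp: K_def)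
      with *[OF that(3)] *[OF that(4)] show ?thesis by (simp add: prod_eq_iff)
    qed
  qed (use \<eta> in simp_all)
  then have "trig_sum K D \<xi> = 0"
    by (simp add: trig_sum_def)
  with GD[of \<xi>] show ?thesis by simp
qed

text \<open>
  The four shifted grids of step \<open>1 / \<eta>\<close> together make up the grid of step \<open>1 / (2 \<eta>)\<close>; the
  corner records the parities.
\<close>

lemma half_grid:
  assumes "\<eta> > 0" "i \<in> Q2 (2 * \<eta>)"
  obtains j l where "j \<in> Q2 \<eta>" 
    "(1 / of_int \<eta>) *\<^sub>R (emb j + (1/2) *\<^sub>R corner l) = (1 / of_int (2 * \<eta>)) *\<^sub>R emb i"
proof
  define j where "j = (fst i div 2, snd i div 2)"
  define l :: 4 where "l = (if even (fst i) then (if even (snd i) then 0 else 2) else (if even (snd i) then 1 else 3))"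
  show "j \<in> Q2 \<eta>"
    using assms(2) by (auto simp: Q2_def j_def)
  have c: "corner l = emb (fst i mod 2, snd i mod 2)"
    by (auto simp: corner_def l_def emb_def odd_iff_mod_2_eq_one)
  have d: "real_of_int a = 2 * of_int (a div 2) + of_int (a mod 2)" for a :: int
    by (metis mult_div_mod_eq of_int_add of_int_mult of_int_numeral)
  show "(1 / of_int \<eta>) *\<^sub>R (emb j + (1/2) *\<^sub>R corner l) = (1 / of_int (2 * \<eta>)) *\<^sub>R emb i"
    using assms(1) d[of "fst i"] d[of "snd i"] unfolding c
    by (simp add: emb_def j_def field_simps)
qed

lemma qunitary_trig_poly_iff:
  assumes "\<eta> > 0" and A: "\<And>k. k \<in> Q2 \<eta> \<Longrightarrow> A k \<in> SVmat"
  shows "(\<forall>\<xi>. qunitary (trig_poly \<eta> A \<xi>)) \<longleftrightarrow>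
    (\<forall>l. \<forall>j\<in>Q2 \<eta>. qunitary (dft \<eta> (modulate \<eta> l (idft \<eta> (samples \<eta> (trig_poly \<eta> A)))) j))"
proof
  assume "\<forall>\<xi>. qunitary (trig_poly \<eta> A \<xi>)"
  then show "\<forall>l. \<forall>j\<in>Q2 \<eta>. qunitary (dft \<eta> (modulate \<eta> l (idft \<eta> (samples \<eta> (trig_poly \<eta> A)))) j)"
    unfolding dft_modulate_idft_samples[OF assms(1)] unfolding trig_poly_eq by blast
next
  assume *: "\<forall>l. \<forall>j\<in>Q2 \<eta>. qunitary (dft \<eta> (modulate \<eta> l (idft \<eta> (samples \<eta> (trig_poly \<eta> A)))) j)"
  have grid: "qunitary (trig_sum (Q2 \<eta>) A ((1 / of_int (2 * \<eta>)) *\<^sub>R emb i))" if i: "i \<in> Q2 (2 * \<eta>)" for i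
  proof -
    obtain j l where j: "j \<in> Q2 \<eta>" and
      eq: "(1 / of_int \<eta>) *\<^sub>R (emb j + (1/2) *\<^sub>R corner l) = (1 / of_int (2 * \<eta>)) *\<^sub>R emb i"
      by (rule half_grid[OF assms(1) i])
    from *[rule_format, OF j, of l] show ?thesis
      unfolding dft_modulate_idft_samples[OF assms(1)] eq .
  qed
  have gram1: "qadjoint (trig_sum (Q2 \<eta>) A \<xi>) ** trig_sum (Q2 \<eta>) A \<xi> =
      (\<Sum>(k, l)\<in>Q2 \<eta> \<times> Q2 \<eta>. phase (2 * pi * det2 \<xi> (emb (l - k))) (qadjoint (A k) ** A l))" for \<xi>
    by (rule qadjoint_trig_sum_mult) (rule A)
  have gram2: "trig_sum (Q2 \<eta>) A \<xi> ** qadjoint (trig_sum (Q2 \<eta>) A \<xi>) =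
      (\<Sum>(k, l)\<in>Q2 \<eta> \<times> Q2 \<eta>. phase (2 * pi * det2 \<xi> (emb (l - k))) (A l ** qadjoint (A k)))" for \<xi>
    by (rule trig_sum_mult_qadjoint) (rule A)
  have "qadjoint (trig_sum (Q2 \<eta>) A \<xi>) ** trig_sum (Q2 \<eta>) A \<xi> = mat 1" for \<xi>
    unfolding gram1
  proof (rule difference_sum_const[OF assms(1)])
    fix i assume "i \<in> Q2 (2 * \<eta>)"
    from grid[OF this] show "(\<Sum>(k, l)\<in>Q2 \<eta> \<times> Q2 \<eta>. phase (2 * pi * det2 ((1 / of_int (2 * \<eta>)) *\<^sub>R emb i) (emb (l - k)))
        (qadjoint (A k) ** A l)) = mat 1"
      unfolding qunitary_def gram1 by (rule conjunct2)
  qed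
  moreover have "trig_sum (Q2 \<eta>) A \<xi> ** qadjoint (trig_sum (Q2 \<eta>) A \<xi>) = mat 1" for \<xi>
    unfolding gram2
  proof (rule difference_sum_const[OF assms(1)])
    fix i assume "i \<in> Q2 (2 * \<eta>)"
    from grid[OF this] show "(\<Sum>(k, l)\<in>Q2 \<eta> \<times> Q2 \<eta>. phase (2 * pi * det2 ((1 / of_int (2 * \<eta>)) *\<^sub>R emb i) (emb (l - k)))
        (A l ** qadjoint (A k))) = mat 1"
      unfolding qunitary_def gram2 by (rule conjunct1)
  qed
  ultimately show "\<forall>\<xi>. qunitary (trig_poly \<eta> A \<xi>)"
    by (simp add: trig_poly_eq qunitary_def)
qed

section \<open>Symmetries under shifts and reflections\<close>

lemma trig_sum_shift_corner:
  "trig_sum K A (\<xi> + (1/2) *\<^sub>R corner 1) = trig_sum K (\<lambda>k. ((-1) powi snd k) *\<^sub>R A k) \<xi>"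
  "trig_sum K A (\<xi> + (1/2) *\<^sub>R corner 2) = trig_sum K (\<lambda>k. ((-1) powi fst k) *\<^sub>R A k) \<xi>"
proof -
  have 1: "2 * pi * det2 (\<xi> + (1/2) *\<^sub>R corner 1) (emb k) = 2 * pi * det2 \<xi> (emb k) + pi * of_int (snd k)" for k
    by (simp add: det2_def corner_def emb_def algebra_simps)
  have 2: "2 * pi * det2 (\<xi> + (1/2) *\<^sub>R corner 2) (emb k) = 2 * pi * det2 \<xi> (emb k) + pi * of_int (- fst k)" for k
    by (simp add: det2_def corner_def emb_def algebra_simps)
  show "trig_sum K A (\<xi> + (1/2) *\<^sub>R corner 1) = trig_sum K (\<lambda>k. ((-1) powi snd k) *\<^sub>R A k) \<xi>"
    by (simp only: trig_sum_def 1 phase_phase[symmetric] phase_pi_int)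
  show "trig_sum K A (\<xi> + (1/2) *\<^sub>R corner 2) = trig_sum K (\<lambda>k. ((-1) powi fst k) *\<^sub>R A k) \<xi>"
    by (simp only: trig_sum_def 2 phase_phase[symmetric] phase_pi_int power_int_minus_one_minus)
qed

lemma trig_sum_mult_left:
  assumes "S \<in> SVmat"
  shows "S ** trig_sum K A \<xi> = trig_sum K (\<lambda>k. S ** A k) \<xi>"
  by (simp add: trig_sum_def matrix_mult_sum_right phase_mult_right[OF assms])

lemma pure_mat_1: "pure p q ((mat 1 :: quat ^ 2 ^ 2) $ p $ q)"
  by (simp add: mat_def pure_def)

lemma sigma_SVmat: "sigma1 \<in> SVmat" "sigma2 \<in> SVmat"
  by (auto simp: SVmat_iff sigma1_def sigma2_def pure_mat_1)

lemma trig_poly_shift_iff: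
  assumes \<eta>: "\<eta> > 0" "even \<eta>"
  shows "(\<forall>\<xi>. trig_poly \<eta> A (\<xi> + (1/2) *\<^sub>R corner 1) = sigma1 ** trig_poly \<eta> A \<xi> \<and>
           trig_poly \<eta> A (\<xi> + (1/2) *\<^sub>R corner 2) = sigma2 ** trig_poly \<eta> A \<xi>) \<longleftrightarrow>
      (\<forall>k\<in>Q2 \<eta>. sigma1 ** A k = ((-1) powi snd k) *\<^sub>R A k \<and>
                  sigma2 ** A k = ((-1) powi fst k) *\<^sub>R A k)" (is ?A)
    and "(\<forall>k\<in>Q2 \<eta>. sigma1 ** A k = ((-1) powi snd k) *\<^sub>R A k \<and>
                  sigma2 ** A k = ((-1) powi fst k) *\<^sub>R A k) \<longleftrightarrow>
      (\<forall>j\<in>Q2 \<eta>. samples \<eta> (trig_poly \<eta> A) (j + (\<eta> div 2, 0)) = sigma1 ** samples \<eta> (trig_poly \<eta> A) j \<and>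
                  samples \<eta> (trig_poly \<eta> A) (j + (0, \<eta> div 2)) = sigma2 ** samples \<eta> (trig_poly \<eta> A) j)" (is ?B)
proof -
  have half: "(1 / of_int \<eta>) *\<^sub>R emb (\<eta> div 2, 0) = (1/2) *\<^sub>R corner 1"
    "(1 / of_int \<eta>) *\<^sub>R emb (0, \<eta> div 2) = (1/2) *\<^sub>R corner 2"
    using \<eta> by (auto simp: corner_def emb_def elim!: evenE)
  have one: "(1 :: real) \<in> {1, -1}" by simp
  have iff: "(\<forall>\<xi>. trig_sum (Q2 \<eta>) C \<xi> = trig_sum (Q2 \<eta>) D \<xi>) \<longleftrightarrow> (\<forall>k\<in>Q2 \<eta>. D k = C k)"
    "(\<forall>j\<in>Q2 \<eta>. trig_sum (Q2 \<eta>) C ((1 / of_int \<eta>) *\<^sub>R emb j) = trig_sum (Q2 \<eta>) D ((1 / of_int \<eta>) *\<^sub>R emb j))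
      \<longleftrightarrow> (\<forall>k\<in>Q2 \<eta>. D k = C k)" for C D :: "z2 \<Rightarrow> 4 bmat"
    using trig_sum_eq_iff[OF \<eta>(1) one, of D C, unfolded scaleR_one] by metis+
  show ?A
    unfolding trig_poly_eq trig_sum_shift_corner trig_sum_mult_left[OF sigma_SVmat(1)] trig_sum_mult_left[OF sigma_SVmat(2)]
      all_conj_distrib ball_conj_distrib iff ..
  show ?B
    unfolding samples_trig_poly[OF \<eta>(1)] emb_simps scaleR_add_right half
      trig_sum_shift_corner trig_sum_mult_left[OF sigma_SVmat(1)] trig_sum_mult_left[OF sigma_SVmat(2)]
      ball_conj_distrib iff ..
qed

lemma tau_nth: "tau $ (i, p) $ (j, q) = (if i = j \<and> p \<noteq> q then 1 else 0)"
  using exhaust_2_from_0[of p] exhaust_2_from_0[of q] by (auto simp: tau_def)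

lemma sum_UNIV_pair: "sum f (UNIV :: ('m::finite \<times> 2) set) = (\<Sum>i\<in>UNIV. f (i, 0) + f (i, 1))"
  by (simp add: UNIV_Times_UNIV[symmetric] sum.cartesian_product' sum_UNIV_2 del: UNIV_Times_UNIV)

definition swap2 :: "2 \<Rightarrow> 2" where "swap2 p = (if p = 0 then 1 else 0)"

lemma tau_mult_nth: "(tau ** A) $ (i, p) $ c = A $ (i, swap2 p) $ c"
proof -
  have "tau $ (i, p) $ (k, 0) * A $ (k, 0) $ c + tau $ (i, p) $ (k, 1) * A $ (k, 1) $ c
    = (if k = i then A $ (i, swap2 p) $ c else 0)" for k
    using exhaust_2_from_0[of p] by (auto simp: tau_nth swap2_def)
  then show ?thesis
    by (simp add: matrix_mult_nth sum_UNIV_pair)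
qed

lemma mult_tau_nth: "(A ** tau) $ r $ (j, q) = A $ r $ (j, swap2 q)"
proof -
  have "A $ r $ (k, 0) * tau $ (k, 0) $ (j, q) + A $ r $ (k, 1) * tau $ (k, 1) $ (j, q)
    = (if k = j then A $ r $ (j, swap2 q) else 0)" for k
    using exhaust_2_from_0[of q] by (auto simp: tau_nth swap2_def)
  then show ?thesis
    by (simp add: matrix_mult_nth sum_UNIV_pair)
qed

text \<open>
  Conjugation with \<open>tau\<close> exchanges the two positions in each block and thereby inverts the phase.
\<close>

lemma tau_phase_tau: "tau ** phase \<theta> A ** tau = phase (- \<theta>) (tau ** A ** tau)"
  unfolding vec_eq_iff
proof (intro allI)
  fix r c
  show "(tau ** phase \<theta> A ** tau) $ r $ c = phase (- \<theta>) (tau ** A ** tau) $ r $ c"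
    by (cases r; cases c) (simp add: tau_mult_nth mult_tau_nth swap2_def psign_def)
qed

lemma tau_trig_sum_tau: "tau ** trig_sum K A \<xi> ** tau = trig_sum K (\<lambda>k. tau ** A k ** tau) (- \<xi>)"
  by (simp add: trig_sum_def matrix_mult_sum_right matrix_mult_sum_left tau_phase_tau det2_simps)

lemma samples_reflect:
  assumes "\<eta> > 0"
  shows "samples \<eta> (trig_poly \<eta> A) ((\<eta>, \<eta>) - j) = trig_sum (Q2 \<eta>) A ((- 1 / of_int \<eta>) *\<^sub>R emb j)"
proof -
  have "(1 / of_int \<eta>) *\<^sub>R emb ((\<eta>, \<eta>) - j) = (- 1 / of_int \<eta>) *\<^sub>R emb j + emb (1, 1)"
    using assms by (simp add: emb_def field_simps)
  then show ?thesis
    by (simp only: samples_trig_poly[OF assms] trig_sum_periodic)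
qed

lemma trig_poly_reflect_iff:
  assumes \<eta>: "\<eta> > 0"
  shows "(\<forall>\<xi>. trig_poly \<eta> A (- \<xi>) = tau ** trig_poly \<eta> A \<xi> ** tau) \<longleftrightarrow> (\<forall>k\<in>Q2 \<eta>. A k = tau ** A k ** tau)"
    and "(\<forall>k\<in>Q2 \<eta>. A k = tau ** A k ** tau) \<longleftrightarrow>
      (\<forall>j\<in>Q2 \<eta>. samples \<eta> (trig_poly \<eta> A) ((\<eta>, \<eta>) - j) = tau ** samples \<eta> (trig_poly \<eta> A) j ** tau)"
proof -
  have m1: "(- 1 :: real) \<in> {1, - 1}" by simp
  have neg: "- ((1 / of_int \<eta>) *\<^sub>R emb j) = (- 1 / of_int \<eta>) *\<^sub>R emb j" for j
    by simp
  note iff = trig_sum_eq_iff[OF \<eta> m1, of A "\<lambda>k. tau ** A k ** tau", unfolded scaleR_minus1_left]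
  show "(\<forall>\<xi>. trig_poly \<eta> A (- \<xi>) = tau ** trig_poly \<eta> A \<xi> ** tau) \<longleftrightarrow> (\<forall>k\<in>Q2 \<eta>. A k = tau ** A k ** tau)"
    unfolding trig_poly_eq tau_trig_sum_tau by (rule iff(1))
  show "(\<forall>k\<in>Q2 \<eta>. A k = tau ** A k ** tau) \<longleftrightarrow>
      (\<forall>j\<in>Q2 \<eta>. samples \<eta> (trig_poly \<eta> A) ((\<eta>, \<eta>) - j) = tau ** samples \<eta> (trig_poly \<eta> A) j ** tau)"
    unfolding samples_reflect[OF \<eta>] unfolding samples_trig_poly[OF \<eta>] tau_trig_sum_tau neg by (rule iff(2))
qed

lemma qcis_sum_eq_iff:
  fixes c d :: "z2 \<Rightarrow> quat"
  assumes N: "N > 0"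
  shows "(\<forall>\<xi>. (\<Sum>k\<in>Q2 N. qcis (2 * pi * det2 \<xi> (emb k)) * c k) = (\<Sum>k\<in>Q2 N. qcis (2 * pi * det2 \<xi> (emb k)) * d k)) \<longleftrightarrow>
      (\<forall>k\<in>Q2 N. c k = d k)"
    and "(\<forall>k\<in>Q2 N. c k = d k) \<longleftrightarrow>
      (\<forall>j\<in>Q2 N. (\<Sum>k\<in>Q2 N. qcis (2 * pi * det2 ((1 / of_int N) *\<^sub>R emb j) (emb k)) * c k) =
        (\<Sum>k\<in>Q2 N. qcis (2 * pi * det2 ((1 / of_int N) *\<^sub>R emb j) (emb k)) * d k))"
proof -
  have *: "c k = d k" if "\<forall>j\<in>Q2 N. (\<Sum>k\<in>Q2 N. qcis (2 * pi * det2 ((1 / of_int N) *\<^sub>R emb j) (emb k)) * c k) =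
        (\<Sum>k\<in>Q2 N. qcis (2 * pi * det2 ((1 / of_int N) *\<^sub>R emb j) (emb k)) * d k)" "k \<in> Q2 N" for k
  proof -
    have "c k - d k = 0"
      by (rule trig_coeff_zero[of N 1 "Q2 N" "\<lambda>k. c k - d k", OF N _ finite_Q2 Q2_inj_mod _ that(2)])
        (use that(1) in \<open>simp_all add: right_diff_distrib sum_subtractf det2_simps\<close>)
    then show ?thesis by simp
  qed
  have 1: "(\<Sum>k\<in>Q2 N. qcis (2 * pi * det2 \<xi> (emb k)) * c k) = (\<Sum>k\<in>Q2 N. qcis (2 * pi * det2 \<xi> (emb k)) * d k)"
    if "\<forall>k\<in>Q2 N. c k = d k" for \<xi>
    by (rule sum.cong[OF refl]) (simp only: that[rule_format])
  show "(\<forall>\<xi>. (\<Sum>k\<in>Q2 N. qcis (2 * pi * det2 \<xi> (emb k)) * c k) = (\<Sum>k\<in>Q2 N. qcis (2 * pi * det2 \<xi> (emb k)) * d k)) \<longleftrightarrow>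
      (\<forall>k\<in>Q2 N. c k = d k)"
    using * 1 by blast
  show "(\<forall>k\<in>Q2 N. c k = d k) \<longleftrightarrow>
      (\<forall>j\<in>Q2 N. (\<Sum>k\<in>Q2 N. qcis (2 * pi * det2 ((1 / of_int N) *\<^sub>R emb j) (emb k)) * c k) =
        (\<Sum>k\<in>Q2 N. qcis (2 * pi * det2 ((1 / of_int N) *\<^sub>R emb j) (emb k)) * d k))"
    using * 1 by blast
qed

text \<open>
  The first row of a block \<open>[f(x)]\<close> contains the spinor and the vector part of \<open>f(x)\<close>; their sum
  recovers \<open>f(x)\<close>.
\<close>

definition row_coeff :: "4 bmat \<Rightarrow> 4 \<Rightarrow> quat" where
  "row_coeff A \<epsilon> = A $ (0, 0) $ (\<epsilon>, 0) + A $ (0, 0) $ (\<epsilon>, 1)"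

lemma row_coeff_trig_sum: "row_coeff (trig_sum K A \<xi>) \<epsilon> = (\<Sum>k\<in>K. qcis (2 * pi * det2 \<xi> (emb k)) * row_coeff (A k) \<epsilon>)"
  by (simp add: row_coeff_def trig_sum_nth distrib_left sum.distrib)

text \<open>
  Since \<open>2 P = (\<eta> - 1, \<eta> - 1)\<close>, the prefactor moves the frequency \<open>- k\<close> to \<open>2 P - k\<close>, which lies in
  \<open>Q2 \<eta>\<close> again.
\<close>

lemma row_coeff_reflect:
  assumes P: "P = ((of_int \<eta> - 1) / 2, (of_int \<eta> - 1) / 2)"
  shows "exp ((4 * pi) *\<^sub>R wedge \<xi> P) * row_coeff (trig_sum (Q2 \<eta>) A (- \<xi>)) 0 =
    (\<Sum>k\<in>Q2 \<eta>. qcis (2 * pi * det2 \<xi> (emb k)) * row_coeff (A ((\<eta> - 1, \<eta> - 1) - k)) 0)"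
proof -
  have "qcis (4 * pi * det2 \<xi> P) * (qcis (2 * pi * det2 (- \<xi>) (emb k)) * x)
     = qcis (2 * pi * det2 \<xi> (emb ((\<eta> - 1, \<eta> - 1) - k))) * x" for k x
    unfolding mult.assoc[symmetric] qcis_add[symmetric]
    by (rule arg_cong[where f = "\<lambda>y. qcis y * x"]) (simp add: P det2_def emb_def field_simps)
  then have "exp ((4 * pi) *\<^sub>R wedge \<xi> P) * row_coeff (trig_sum (Q2 \<eta>) A (- \<xi>)) 0 =
     (\<Sum>k\<in>Q2 \<eta>. qcis (2 * pi * det2 \<xi> (emb ((\<eta> - 1, \<eta> - 1) - k))) * row_coeff (A k) 0)"
    by (simp only: exp_wedge row_coeff_trig_sum sum_distrib_left)
  also have "\<dots> = (\<Sum>k\<in>Q2 \<eta>. qcis (2 * pi * det2 \<xi> (emb k)) * row_coeff (A ((\<eta> - 1, \<eta> - 1) - k)) 0)"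
    by (rule sum.reindex_bij_witness[where i = "\<lambda>k. (\<eta> - 1, \<eta> - 1) - k" and j = "\<lambda>k. (\<eta> - 1, \<eta> - 1) - k"])
      (auto simp: Q2_def)
  finally show ?thesis .
qed

lemma row_coeff_symmetry_iff:
  assumes \<eta>: "\<eta> > 0" and P: "P = ((of_int \<eta> - 1) / 2, (of_int \<eta> - 1) / 2)"
  shows "(\<forall>\<xi>. row_coeff (trig_poly \<eta> A \<xi>) 0 =
            exp ((4 * pi) *\<^sub>R wedge \<xi> P) * row_coeff (trig_poly \<eta> A (- \<xi>)) 0) \<longleftrightarrow>
      (\<forall>k\<in>Q2 \<eta>. row_coeff (A k) 0 = row_coeff (A ((\<eta> - 1, \<eta> - 1) - k)) 0)"
    and "(\<forall>k\<in>Q2 \<eta>. row_coeff (A k) 0 = row_coeff (A ((\<eta> - 1, \<eta> - 1) - k)) 0) \<longleftrightarrow>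
      (\<forall>j\<in>Q2 \<eta>. row_coeff (samples \<eta> (trig_poly \<eta> A) j) 0 =
            exp ((4 * pi / of_int \<eta>) *\<^sub>R wedge (emb j) P) *
              row_coeff (samples \<eta> (trig_poly \<eta> A) ((\<eta>, \<eta>) - j)) 0)"
proof -
  show "(\<forall>\<xi>. row_coeff (trig_poly \<eta> A \<xi>) 0 =
            exp ((4 * pi) *\<^sub>R wedge \<xi> P) * row_coeff (trig_poly \<eta> A (- \<xi>)) 0) \<longleftrightarrow>
      (\<forall>k\<in>Q2 \<eta>. row_coeff (A k) 0 = row_coeff (A ((\<eta> - 1, \<eta> - 1) - k)) 0)"
    unfolding trig_poly_eq row_coeff_reflect[OF P] unfolding row_coeff_trig_sum
    by (rule qcis_sum_eq_iff(1)[OF \<eta>])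
  have 1: "(4 * pi / of_int \<eta>) *\<^sub>R wedge (emb j) P = (4 * pi) *\<^sub>R wedge ((1 / of_int \<eta>) *\<^sub>R emb j) P" for j
    by (simp add: wedge_def right_diff_distrib diff_divide_distrib)
  have 2: "(- 1 / of_int \<eta>) *\<^sub>R emb j = - ((1 / of_int \<eta>) *\<^sub>R emb j)" for j
    by simp
  show "(\<forall>k\<in>Q2 \<eta>. row_coeff (A k) 0 = row_coeff (A ((\<eta> - 1, \<eta> - 1) - k)) 0) \<longleftrightarrow>
      (\<forall>j\<in>Q2 \<eta>. row_coeff (samples \<eta> (trig_poly \<eta> A) j) 0 =
            exp ((4 * pi / of_int \<eta>) *\<^sub>R wedge (emb j) P) *
              row_coeff (samples \<eta> (trig_poly \<eta> A) ((\<eta>, \<eta>) - j)) 0)"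
    unfolding samples_reflect[OF \<eta>] unfolding samples_trig_poly[OF \<eta>] 1 2 row_coeff_reflect[OF P]
    unfolding row_coeff_trig_sum by (rule qcis_sum_eq_iff(2)[OF \<eta>])
qed

section \<open>Block-diagonal matrices and derivatives at the origin\<close>

text \<open>
  Inverse of \<open>lower_index\<close>.
\<close>

definition upper_index :: "3 \<Rightarrow> 4" where
  "upper_index i = (if i = 0 then 1 else if i = 1 then 2 else 3)"

lemma exhaust_4_from_0: fixes i :: 4 shows "i = 0 \<or> i = 1 \<or> i = 2 \<or> i = 3"
  using exhaust_4[of i] by auto

lemma exhaust_3_from_0: fixes i :: 3 shows "i = 0 \<or> i = 1 \<or> i = 2"
  using exhaust_3[of i] by auto

lemma upper_lower_index: "i \<noteq> 0 \<Longrightarrow> upper_index (lower_index i) = i"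
  using exhaust_4_from_0[of i] by (auto simp: upper_index_def lower_index_def)

lemma lower_upper_index: "lower_index (upper_index i) = i"
  using exhaust_3_from_0[of i] by (auto simp: upper_index_def lower_index_def)

lemma upper_index_nonzero: "upper_index i \<noteq> 0"
  by (auto simp: upper_index_def)

lemma block_diag_nth: "block_diag s B $ (i, p) $ (j, q) =
   (if i = 0 \<and> j = 0 then s $ p $ q else if i \<noteq> 0 \<and> j \<noteq> 0 then B $ (lower_index i, p) $ (lower_index j, q) else 0)"
  by (simp add: block_diag_def)

definition off_diag_zero :: "4 bmat \<Rightarrow> bool" where
  "off_diag_zero X \<longleftrightarrow> (\<forall>r c. (fst r = 0) \<noteq> (fst c = 0) \<longrightarrow> X $ r $ c = 0)"

definition lower_part :: "4 bmat \<Rightarrow> 3 bmat" where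
  "lower_part X = (\<chi> r c. X $ (upper_index (fst r), snd r) $ (upper_index (fst c), snd c))"

lemma block_diag_decompose:
  assumes "off_diag_zero X"
  shows "X = block_diag (blk X 0 0) (lower_part X)"
  unfolding vec_eq_iff
proof (intro allI)
  fix r c
  show "X $ r $ c = block_diag (blk X 0 0) (lower_part X) $ r $ c"
    using assms by (cases r; cases c) (auto simp: block_diag_nth lower_part_def upper_lower_index off_diag_zero_def)
qed

text \<open>
  Turns existence of a block decomposition into conditions on single entries, which pass easily
  through multiplications by nonzero factors.
\<close>

lemma SV_tensor_SVmat_iff: "X \<in> SV \<otimes>\<^sub>b SVmat \<longleftrightarrow> X \<in> SVmat \<and> off_diag_zero X"
proof
  assume "X \<in> SV \<otimes>\<^sub>b SVmat"
  then obtain s B where X: "X = block_diag s B" and s: "s \<in> SV" and B: "B \<in> SVmat"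
    unfolding block_tensor_def by blast
  have "pure (snd r) (snd c) (X $ r $ c)" for r c
    using s SVmat_pure[OF B] unfolding X
    by (cases r; cases c) (auto simp: block_diag_nth SV_iff)
  moreover have "off_diag_zero X"
    unfolding X by (auto simp: off_diag_zero_def block_diag_nth)
  ultimately show "X \<in> SVmat \<and> off_diag_zero X"
    unfolding SVmat_iff by blast
next
  assume X: "X \<in> SVmat \<and> off_diag_zero X"
  then have "blk X 0 0 \<in> SV"
    by (simp add: SVmat_def)
  moreover have "lower_part X \<in> SVmat"
    using X SVmat_pure[of X] by (auto simp: SVmat_iff lower_part_def)
  ultimately show "X \<in> SV \<otimes>\<^sub>b SVmat"
    unfolding block_tensor_def using block_diag_decompose[of X] X by blast
qed

lemma SV_tensor_SVmat_scaleR_iff: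
  assumes "a \<noteq> 0"
  shows "a *\<^sub>R X \<in> SV \<otimes>\<^sub>b SVmat \<longleftrightarrow> X \<in> SV \<otimes>\<^sub>b SVmat"
proof -
  have "pure p q (a *\<^sub>R x) \<longleftrightarrow> pure p q x" for p q x
    using assms by (simp add: pure_def)
  with assms show ?thesis
    by (simp add: SV_tensor_SVmat_iff SVmat_iff off_diag_zero_def)
qed

text \<open>
  After exchanging the sums, the inner sum over \<open>j\<close> is the inverse transform of the samples.
\<close>

lemma sum_moment_coeff_samples:
  assumes \<eta>: "\<eta> > 0"
  shows "(\<Sum>j\<in>Q2 \<eta>. moment_coeff \<eta> \<alpha> j \<circledast> samples \<eta> (trig_poly \<eta> A) j) =
     (of_int \<eta>)\<^sup>2 *\<^sub>R (\<Sum>k\<in>Q2 \<eta>. svconst (of_int (snd k ^ fst \<alpha> * fst k ^ snd \<alpha>)) \<circledast> A k)"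
proof -
  have "(\<Sum>j\<in>Q2 \<eta>. moment_coeff \<eta> \<alpha> j \<circledast> samples \<eta> (trig_poly \<eta> A) j) =
     (\<Sum>j\<in>Q2 \<eta>. \<Sum>k\<in>Q2 \<eta>. of_int (snd k ^ fst \<alpha> * fst k ^ snd \<alpha>) *\<^sub>R
       phase (2 * pi / of_int \<eta> * det2 (emb k) (emb j)) (trig_sum (Q2 \<eta>) A ((1 / of_int \<eta>) *\<^sub>R emb j)))"
    by (simp only: moment_coeff_def circ_mult_sum_left circ_mult_assoc svexp_circ svconst_circ samples_trig_poly[OF \<eta>])
  also have "\<dots> = (\<Sum>k\<in>Q2 \<eta>. of_int (snd k ^ fst \<alpha> * fst k ^ snd \<alpha>) *\<^sub>R (of_int \<eta>)\<^sup>2 *\<^sub>R A k)"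
    by (subst sum.swap) (simp only: scaleR_sum_right[symmetric] trig_sum_inversion[OF \<eta>] cong: sum.cong)
  finally show ?thesis
    by (simp add: svconst_circ scaleR_sum_right mult.commute)
qed

text \<open>
  One entry of a matrix trigonometric polynomial, with \<open>s\<close> the sign of its row.
\<close>

definition qsum :: "real \<Rightarrow> z2 set \<Rightarrow> (z2 \<Rightarrow> quat) \<Rightarrow> r2 \<Rightarrow> quat" where
  "qsum s K c \<xi> = (\<Sum>k\<in>K. qcis (s * (2 * pi * det2 \<xi> (emb k))) * c k)"

lemma qcis_affine_has_vector_derivative:
  "((\<lambda>t. qcis (a * t + b) * c) has_vector_derivative qcis (a * t + b) * ((a *\<^sub>R quat_e12) * c)) (at t)"
proof -
  have 1: "qcis (a * t + b) * c = exp (t *\<^sub>R (a *\<^sub>R quat_e12)) * (qcis b * c)" for t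
    by (simp add: exp_e12 qcis_add mult.assoc mult.commute)
  have "((\<lambda>t. exp (t *\<^sub>R (a *\<^sub>R quat_e12)) * (qcis b * c)) has_vector_derivative
     exp (t *\<^sub>R (a *\<^sub>R quat_e12)) * (a *\<^sub>R quat_e12) * (qcis b * c)) (at t)"
    by (intro bounded_linear.has_vector_derivative[OF bounded_linear_mult_left] exp_scaleR_has_vector_derivative_right)
  also have "exp (t *\<^sub>R (a *\<^sub>R quat_e12)) * (a *\<^sub>R quat_e12) * (qcis b * c) = qcis (a * t + b) * ((a *\<^sub>R quat_e12) * c)"
  proof -
    have "quat_e12 * qcis b = qcis b * quat_e12"
      by (simp add: quat_eq_iff quat_sel_times quat_e12_def)
    then have "quat_e12 * (qcis b * c) = qcis b * (quat_e12 * c)"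
      by (simp add: mult.assoc[symmetric])
    then show ?thesis
      by (simp add: exp_e12 qcis_add mult.assoc mult.commute)
  qed
  finally show ?thesis unfolding 1 .
qed

lemma partial1_qsum: "partial1 (qsum s K c) = qsum s K (\<lambda>k. ((s * (2 * pi * of_int (snd k))) *\<^sub>R quat_e12) * c k)"
proof
  fix \<xi> :: r2
  have arg: "s * (2 * pi * det2 (t, snd \<xi>) (emb k)) =
    (s * (2 * pi * of_int (snd k))) * t + - (s * (2 * pi * (snd \<xi> * of_int (fst k))))" for t k
    by (simp add: det2_def emb_def algebra_simps)
  have "((\<lambda>t. qsum s K c (t, snd \<xi>)) has_vector_derivative
     (\<Sum>k\<in>K. qcis ((s * (2 * pi * of_int (snd k))) * fst \<xi> + - (s * (2 * pi * (snd \<xi> * of_int (fst k))))) *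
        (((s * (2 * pi * of_int (snd k))) *\<^sub>R quat_e12) * c k))) (at (fst \<xi>))"
    unfolding qsum_def arg
    by (intro has_vector_derivative_sum qcis_affine_has_vector_derivative)
  then show "partial1 (qsum s K c) \<xi> = qsum s K (\<lambda>k. ((s * (2 * pi * of_int (snd k))) *\<^sub>R quat_e12) * c k) \<xi>"
    unfolding partial1_def arg[symmetric] prod.collapse qsum_def by (rule vector_derivative_at)
qed

lemma partial2_qsum: "partial2 (qsum s K c) = qsum s K (\<lambda>k. ((- (s * (2 * pi * of_int (fst k)))) *\<^sub>R quat_e12) * c k)"
proof
  fix \<xi> :: r2
  have arg: "s * (2 * pi * det2 (fst \<xi>, t) (emb k)) =
    (- (s * (2 * pi * of_int (fst k)))) * t + s * (2 * pi * (fst \<xi> * of_int (snd k)))" for t k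
    by (simp add: det2_def emb_def algebra_simps)
  have "((\<lambda>t. qsum s K c (fst \<xi>, t)) has_vector_derivative
     (\<Sum>k\<in>K. qcis ((- (s * (2 * pi * of_int (fst k)))) * snd \<xi> + s * (2 * pi * (fst \<xi> * of_int (snd k)))) *
        (((- (s * (2 * pi * of_int (fst k)))) *\<^sub>R quat_e12) * c k))) (at (snd \<xi>))"
    unfolding qsum_def arg
    by (intro has_vector_derivative_sum qcis_affine_has_vector_derivative)
  then show "partial2 (qsum s K c) \<xi> = qsum s K (\<lambda>k. ((- (s * (2 * pi * of_int (fst k)))) *\<^sub>R quat_e12) * c k) \<xi>"
    unfolding partial2_def arg[symmetric] prod.collapse qsum_def by (rule vector_derivative_at)
qed

lemma partials_qsum:
  "(partial1 ^^ a) ((partial2 ^^ b) (qsum s K c)) = qsum s K (\<lambda>k.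
     ((s * (2 * pi * of_int (snd k))) *\<^sub>R quat_e12) ^ a * (((- (s * (2 * pi * of_int (fst k)))) *\<^sub>R quat_e12) ^ b * c k))"
proof -
  have 2: "(partial2 ^^ b) (qsum s K c) = qsum s K (\<lambda>k. ((- (s * (2 * pi * of_int (fst k)))) *\<^sub>R quat_e12) ^ b * c k)"
    by (induction b) (simp_all add: partial2_qsum mult.assoc)
  have 1: "(partial1 ^^ a) (qsum s K d) = qsum s K (\<lambda>k. ((s * (2 * pi * of_int (snd k))) *\<^sub>R quat_e12) ^ a * d k)" for d
    by (induction a) (simp_all add: partial1_qsum mult.assoc)
  show ?thesis unfolding 2 1 ..
qed

text \<open>
  Each derivative multiplies a coefficient by an integer coordinate of \<open>k\<close> and a nonzero
  multiple of \<open>e\<^sub>1\<^sub>2\<close> that is fixed for each row. At the origin the exponentials disappear and these fixed factors come out of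
  the sum as \<open>u\<close>.
\<close>

lemma matrix_partial_trig_sum_0:
  obtains u :: "2 \<Rightarrow> quat" where "\<And>p. pure p p (u p)" "\<And>p. u p \<noteq> 0"
    "\<And>r c. matrix_partial \<alpha> (trig_sum K A) 0 $ r $ c =
       u (snd r) * (\<Sum>k\<in>K. of_int (snd k ^ fst \<alpha> * fst k ^ snd \<alpha>) *\<^sub>R A k) $ r $ c"
proof
  define u where "u p = ((psign p * (2 * pi)) *\<^sub>R quat_e12) ^ fst \<alpha> * ((- (psign p * (2 * pi))) *\<^sub>R quat_e12) ^ snd \<alpha>" for p
  have pow: "pure p p (x ^ n)" if "pure p p x" for p x n
    by (induction n) (use that in \<open>auto simp: pure_def quat_sel_times\<close>)
  show "pure p p (u p)" for p
    unfolding u_def by (rule pure_mult[OF pow pow]) (auto simp: pure_def quat_e12_def)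
  show "u p \<noteq> 0" for p
    by (simp add: u_def) (simp add: psign_def quat_e12_def quat_eq_iff)
  fix r c :: "4 \<times> 2"
  have "(\<lambda>\<xi>. trig_sum K A \<xi> $ r $ c) = qsum (psign (snd r)) K (\<lambda>k. A k $ r $ c)"
    by (simp add: fun_eq_iff trig_sum_nth qsum_def)
  then have "matrix_partial \<alpha> (trig_sum K A) 0 $ r $ c =
     qsum (psign (snd r)) K (\<lambda>k. ((psign (snd r) * (2 * pi * of_int (snd k))) *\<^sub>R quat_e12) ^ fst \<alpha> *
       (((- (psign (snd r) * (2 * pi * of_int (fst k)))) *\<^sub>R quat_e12) ^ snd \<alpha> * A k $ r $ c)) 0"
    by (simp add: matrix_partial_def partials_qsum)
  also have "\<dots> = (\<Sum>k\<in>K. u (snd r) * (of_int (snd k ^ fst \<alpha> * fst k ^ snd \<alpha>) *\<^sub>R A k $ r $ c))"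
  proof -
    have "((\<sigma> * (2 * pi * x)) *\<^sub>R quat_e12) ^ a * (((- (\<sigma> * (2 * pi * y))) *\<^sub>R quat_e12) ^ b * z) =
      ((\<sigma> * (2 * pi)) *\<^sub>R quat_e12) ^ a * ((- (\<sigma> * (2 * pi))) *\<^sub>R quat_e12) ^ b * ((x ^ a * y ^ b) *\<^sub>R z)"
      for \<sigma> x y a b z
    proof -
      have e: "\<sigma> * (2 * pi * x) = (\<sigma> * (2 * pi)) * x" "- (\<sigma> * (2 * pi * y)) = (- (\<sigma> * (2 * pi))) * y"
        by simp_all
      show ?thesis
        unfolding e
        by (simp only: scaleR_power power_mult_distrib mult_scaleR_left mult_scaleR_right mult.assoc scaleR_scaleR)
          (simp only: mult_ac)
    qed
    then show ?thesis
      by (simp only: qsum_def u_def det2_simps mult_zero_right qcis_0 mult_1_left of_int_mult of_int_power)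
  qed
  finally show "matrix_partial \<alpha> (trig_sum K A) 0 $ r $ c =
       u (snd r) * (\<Sum>k\<in>K. of_int (snd k ^ fst \<alpha> * fst k ^ snd \<alpha>) *\<^sub>R A k) $ r $ c"
    by (simp add: sum_distrib_left)
qed

lemma matrix_partial_block_diag_iff:
  assumes A: "\<And>k. k \<in> K \<Longrightarrow> A k \<in> SVmat"
  shows "matrix_partial \<alpha> (trig_sum K A) 0 \<in> SV \<otimes>\<^sub>b SVmat \<longleftrightarrow>
    (\<Sum>k\<in>K. svconst (of_int (snd k ^ fst \<alpha> * fst k ^ snd \<alpha>)) \<circledast> A k) \<in> SV \<otimes>\<^sub>b SVmat"
proof -
  define S where "S = (\<Sum>k\<in>K. of_int (snd k ^ fst \<alpha> * fst k ^ snd \<alpha>) *\<^sub>R A k)"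
  have S: "S \<in> SVmat"
    unfolding S_def by (intro SVmat_sum SVmat_scaleR A)
  obtain u :: "2 \<Rightarrow> quat" where u: "\<And>p. pure p p (u p)" "\<And>p. u p \<noteq> 0"
    and eq: "\<And>r c. matrix_partial \<alpha> (trig_sum K A) 0 $ r $ c = u (snd r) * S $ r $ c"
    unfolding S_def using matrix_partial_trig_sum_0 by blast
  have "matrix_partial \<alpha> (trig_sum K A) 0 \<in> SVmat"
    unfolding SVmat_iff eq by (intro allI pure_mult[OF u(1)] SVmat_pure S)
  moreover have "off_diag_zero (matrix_partial \<alpha> (trig_sum K A) 0) \<longleftrightarrow> off_diag_zero S"
    using u(2) by (simp add: off_diag_zero_def eq)
  ultimately show ?thesis
    using S by (simp only: SV_tensor_SVmat_iff svconst_circ S_def[symmetric])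
qed

section \<open>Square integrable functions on the plane\<close>

lemma lborel_affine_r2:
  assumes "c \<noteq> 0"
  shows "lborel = density (distr lborel borel (\<lambda>x :: r2. t + c *\<^sub>R x)) (\<lambda>_. ennreal (c\<^sup>2))"
  using lborel_affine[OF assms, of t] by (simp add: power2_eq_square)

lemma AE_affine_r2:
  fixes t :: r2
  assumes c: "c \<noteq> 0" and P: "AE x in lborel. P x"
  shows "AE x in lborel. P (t + c *\<^sub>R x)"
proof -
  have "AE x in density (distr lborel borel (\<lambda>x :: r2. t + c *\<^sub>R x)) (\<lambda>_. ennreal (c\<^sup>2)). P x"
    using P by (subst (asm) lborel_affine_r2[OF c, of t])
  then have "AE x in distr lborel borel (\<lambda>x :: r2. t + c *\<^sub>R x). P x"
    using c by (simp add: AE_density)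
  then show ?thesis by (intro AE_distrD[of "\<lambda>x. t + c *\<^sub>R x" lborel borel]) simp_all
qed

lemma integrable_affine_r2:
  fixes f :: "r2 \<Rightarrow> 'b::{banach, second_countable_topology}"
  assumes c: "c \<noteq> 0" and f: "integrable lborel f"
  shows "integrable lborel (\<lambda>x. f (t + c *\<^sub>R x))"
proof -
  have [measurable]: "f \<in> borel_measurable borel" using f by auto
  have "integrable (density (distr lborel borel (\<lambda>x :: r2. t + c *\<^sub>R x)) (\<lambda>_. ennreal (c\<^sup>2))) f"
    using f by (subst (asm) lborel_affine_r2[OF c, of t])
  then have "integrable lborel (\<lambda>x. c\<^sup>2 *\<^sub>R f (t + c *\<^sub>R x))"
    by (subst (asm) integrable_density) (auto simp: integrable_distr_eq)
  from integrable_scaleR_right[OF this, of "1 / c\<^sup>2"] show ?thesis using c by simp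
qed

lemma integral_affine_r2:
  fixes f :: "r2 \<Rightarrow> 'b::{banach, second_countable_topology}"
  assumes c: "c \<noteq> 0" and f[measurable]: "f \<in> borel_measurable borel"
  shows "(\<integral>x. f (t + c *\<^sub>R x) \<partial>lborel) = (1 / c\<^sup>2) *\<^sub>R (\<integral>x. f x \<partial>lborel)"
proof -
  have "(\<integral>x. f x \<partial>lborel) = (\<integral>x. f x \<partial>density (distr lborel borel (\<lambda>x :: r2. t + c *\<^sub>R x)) (\<lambda>_. ennreal (c\<^sup>2)))"
    by (subst lborel_affine_r2[OF c, of t]) simp
  also have "\<dots> = c\<^sup>2 *\<^sub>R (\<integral>x. f (t + c *\<^sub>R x) \<partial>lborel)"
    by (subst integral_density) (auto simp: integral_distr)
  finally show ?thesis using c by simp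
qed

lemma L2_product_integrable:
  assumes f: "f \<in> L2 M" and g: "g \<in> L2 M"
  shows "integrable M (\<lambda>x. qcnj (f x) * g x)"
proof (rule Bochner_Integration.integrable_bound)
  show "integrable M (\<lambda>x. (norm (f x))\<^sup>2 + (norm (g x))\<^sup>2)"
    using f g by (simp add: L2_def)
  have [measurable]: "f \<in> borel_measurable M" "g \<in> borel_measurable M"
    using f g by (simp_all add: L2_def)
  have [measurable]: "qcnj \<in> borel_measurable borel"
    by (intro borel_measurable_continuous_onI linear_continuous_on bounded_linear_qcnj)
  show "(\<lambda>x. qcnj (f x) * g x) \<in> borel_measurable M" by simp
  have "norm (qcnj (f x) * g x) \<le> norm ((norm (f x))\<^sup>2 + (norm (g x))\<^sup>2)" for x
  proof -
    have "norm (f x) * norm (g x) \<le> (norm (f x))\<^sup>2 + (norm (g x))\<^sup>2"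
      using sum_squares_bound[of "norm (f x)" "norm (g x)"] mult_nonneg_nonneg[OF norm_ge_zero[of "f x"] norm_ge_zero[of "g x"]]
      by linarith
    then show ?thesis by (simp add: norm_mult)
  qed
  then show "AE x in M. norm (qcnj (f x) * g x) \<le> norm ((norm (f x))\<^sup>2 + (norm (g x))\<^sup>2)" by simp
qed

lemma L2_add:
  assumes f: "f \<in> L2 M" and g: "g \<in> L2 M"
  shows "(\<lambda>x. f x + g x) \<in> L2 M"
proof -
  have [measurable]: "f \<in> borel_measurable M" "g \<in> borel_measurable M"
    using f g by (simp_all add: L2_def)
  have "integrable M (\<lambda>x. (norm (f x + g x))\<^sup>2)"
  proof (rule Bochner_Integration.integrable_bound)
    show "integrable M (\<lambda>x. 2 * (norm (f x))\<^sup>2 + 2 * (norm (g x))\<^sup>2)"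
      using f g by (simp add: L2_def)
    have "norm ((norm (f x + g x))\<^sup>2) \<le> norm (2 * (norm (f x))\<^sup>2 + 2 * (norm (g x))\<^sup>2)" for x
    proof -
      have "(norm (f x + g x))\<^sup>2 \<le> (norm (f x) + norm (g x))\<^sup>2"
        by (intro power_mono norm_triangle_ineq) simp
      also have "\<dots> \<le> 2 * (norm (f x))\<^sup>2 + 2 * (norm (g x))\<^sup>2"
        using sum_squares_bound[of "norm (f x)" "norm (g x)"] by (simp add: power2_sum)
      finally show ?thesis by simp
    qed
    then show "AE x in M. norm ((norm (f x + g x))\<^sup>2) \<le> norm (2 * (norm (f x))\<^sup>2 + 2 * (norm (g x))\<^sup>2)" by simp
  qed simp
  then show ?thesis by (simp add: L2_def)
qed

lemma L2_mult_right:
  assumes f: "f \<in> L2 M"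
  shows "(\<lambda>x. f x * c) \<in> L2 M"
proof -
  have [measurable]: "f \<in> borel_measurable M" and "integrable M (\<lambda>x. (norm (f x))\<^sup>2)"
    using f by (simp_all add: L2_def)
  then show ?thesis by (simp add: L2_def norm_mult power_mult_distrib)
qed

lemma L2_zero: "(\<lambda>x. 0) \<in> L2 M"
  by (simp add: L2_def)

lemma L2_sum: "(\<And>i. i \<in> S \<Longrightarrow> f i \<in> L2 M) \<Longrightarrow> (\<lambda>x. \<Sum>i\<in>S. f i x) \<in> L2 M"
  by (induction S rule: infinite_finite_induct) (auto intro: L2_add L2_zero)

lemma L2_diff:
  assumes f: "f \<in> L2 M" and g: "g \<in> L2 M"
  shows "(\<lambda>x. f x - g x) \<in> L2 M"
  using L2_add[OF f L2_mult_right[OF g, of "- 1"]] by simp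

lemma L2_affine:
  assumes c: "c \<noteq> 0" and f: "f \<in> L2 lborel"
  shows "(\<lambda>x. f (t + c *\<^sub>R x)) \<in> L2 lborel"
proof -
  have f_borel[measurable]: "f \<in> borel_measurable borel" and "integrable lborel (\<lambda>x. (norm (f x))\<^sup>2)"
    using f by (simp_all add: L2_def)
  then have "integrable lborel (\<lambda>x. (norm (f (t + c *\<^sub>R x)))\<^sup>2)"
    using integrable_affine_r2[OF c, of "\<lambda>x. (norm (f x))\<^sup>2"] by simp
  then show ?thesis by (simp add: L2_def)
qed

lemma L2_shift: "f \<in> L2 lborel \<Longrightarrow> (\<lambda>x. f (x - t)) \<in> L2 lborel"
  using L2_affine[of 1 f "- t"] by (simp add: algebra_simps)

lemma l2inner_cnj:
  shows "l2inner g f = qcnj (l2inner f g)"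
proof -
  have "qcnj (l2inner f g) = (\<integral>x. qcnj (qcnj (f x) * g x) \<partial>lborel)"
    unfolding l2inner_def
    by (rule integral_bounded_linear'[OF bounded_linear_qcnj bounded_linear_qcnj, symmetric]) simp
  then show ?thesis by (simp add: l2inner_def qcnj_mult)
qed

lemma l2inner_sums:
  assumes u: "\<And>k. k \<in> K \<Longrightarrow> u k \<in> L2 lborel" and v: "\<And>l. l \<in> L \<Longrightarrow> v l \<in> L2 lborel"
  shows "l2inner (\<lambda>x. \<Sum>k\<in>K. u k x * a k) (\<lambda>x. \<Sum>l\<in>L. v l x * b l) =
    (\<Sum>k\<in>K. \<Sum>l\<in>L. qcnj (a k) * l2inner (u k) (v l) * b l)"
proof -
  have eq: "qcnj (\<Sum>k\<in>K. u k x * a k) * (\<Sum>l\<in>L. v l x * b l) =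
     (\<Sum>k\<in>K. \<Sum>l\<in>L. qcnj (a k) * (qcnj (u k x) * v l x) * b l)" for x
    by (simp add: qcnj_sum sum_product qcnj_mult mult.assoc)
  have int: "integrable lborel (\<lambda>x. qcnj (a k) * (qcnj (u k x) * v l x) * b l)" if "k \<in> K" "l \<in> L" for k l
    by (intro integrable_mult_left integrable_mult_right L2_product_integrable u v that)
  have "l2inner (\<lambda>x. \<Sum>k\<in>K. u k x * a k) (\<lambda>x. \<Sum>l\<in>L. v l x * b l) =
    (\<Sum>k\<in>K. \<Sum>l\<in>L. \<integral>x. qcnj (a k) * (qcnj (u k x) * v l x) * b l \<partial>lborel)"
    unfolding l2inner_def eq
    by (subst Bochner_Integration.integral_sum; (intro Bochner_Integration.integrable_sum int | (intro sum.cong refl Bochner_Integration.integral_sum int))?)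
  also have "\<dots> = (\<Sum>k\<in>K. \<Sum>l\<in>L. qcnj (a k) * l2inner (u k) (v l) * b l)"
    unfolding l2inner_def
    by (intro sum.cong refl) (simp add: L2_product_integrable u v integral_mult_left integral_mult_right)
  finally show ?thesis .
qed

lemma l2inner_cong_AE:
  assumes "AE x in lborel. f x = f' x" "AE x in lborel. g x = g' x"
    and "f \<in> L2 lborel" "f' \<in> L2 lborel" "g \<in> L2 lborel" "g' \<in> L2 lborel"
  shows "l2inner f g = l2inner f' g'"
  unfolding l2inner_def
proof (rule integral_cong_AE)
  show "AE x in lborel. qcnj (f x) * g x = qcnj (f' x) * g' x"
    using assms(1,2) by eventually_elim simp
qed (use L2_product_integrable assms in \<open>blast dest: borel_measurable_integrable\<close>)+

lemma l2inner_affine: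
  assumes c: "c \<noteq> 0" and f: "f \<in> L2 lborel" and g: "g \<in> L2 lborel"
  shows "l2inner (\<lambda>x. f (t + c *\<^sub>R x)) (\<lambda>x. g (t + c *\<^sub>R x)) = (1 / c\<^sup>2) *\<^sub>R l2inner f g"
  unfolding l2inner_def
  by (rule integral_affine_r2[OF c, of "\<lambda>x. qcnj (f x) * g x"])
    (use L2_product_integrable[OF f g] in auto)

lemma l2norm_eq_0_AE:
  assumes "f \<in> L2 lborel" "l2norm lborel f = 0"
  shows "AE x in lborel. f x = 0"
proof -
  have "integrable lborel (\<lambda>x. (norm (f x))\<^sup>2)" using assms(1) by (simp add: L2_def)
  moreover have "(\<integral>x. (norm (f x))\<^sup>2 \<partial>lborel) = 0" using assms(2) by (simp add: l2norm_def)
  ultimately have "AE x in lborel. (norm (f x))\<^sup>2 = 0"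
    by (subst (asm) integral_nonneg_eq_0_iff_AE) auto
  then show ?thesis by simp
qed

text \<open>
  The partial sums are eventually constant, so their distance to \<open>f\<close> is zero.
\<close>

lemma l2_has_sum_finite:
  assumes "l2_has_sum lborel b f" and fin: "finite K" and zero: "\<And>k x. k \<notin> K \<Longrightarrow> b k x = 0"
  shows "AE x in lborel. f x = (\<Sum>k\<in>K. b k x)"
proof -
  have f: "f \<in> L2 lborel" and b: "\<And>i. b i \<in> L2 lborel"
    and lim: "((\<lambda>F. l2norm lborel (\<lambda>x. f x - (\<Sum>i\<in>F. b i x))) \<longlongrightarrow> 0) (finite_subsets_at_top UNIV)"
    using assms(1) by (auto simp: l2_has_sum_def)
  have "\<forall>\<^sub>F F in finite_subsets_at_top UNIV. l2norm lborel (\<lambda>x. f x - (\<Sum>i\<in>F. b i x)) = l2norm lborel (\<lambda>x. f x - (\<Sum>i\<in>K. b i x))"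
    unfolding eventually_finite_subsets_at_top
  proof (intro exI[of _ K] conjI allI impI fin)
    fix F assume "finite F \<and> K \<subseteq> F \<and> F \<subseteq> UNIV"
    then have "(\<Sum>i\<in>F. b i x) = (\<Sum>i\<in>K. b i x)" for x
      by (intro sum.mono_neutral_right) (auto simp: zero)
    then show "l2norm lborel (\<lambda>x. f x - (\<Sum>i\<in>F. b i x)) = l2norm lborel (\<lambda>x. f x - (\<Sum>i\<in>K. b i x))" by simp
  qed simp
  then have "((\<lambda>F :: 'a set. l2norm lborel (\<lambda>x. f x - (\<Sum>i\<in>K. b i x))) \<longlongrightarrow> 0) (finite_subsets_at_top UNIV)"
    using lim by (rule tendsto_cong[THEN iffD1])
  then have "l2norm lborel (\<lambda>x. f x - (\<Sum>i\<in>K. b i x)) = 0"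
    using tendsto_unique[OF finite_subsets_at_top_neq_bot] tendsto_const by blast
  then have "AE x in lborel. f x - (\<Sum>i\<in>K. b i x) = 0"
    by (rule l2norm_eq_0_AE[rotated]) (intro L2_diff L2_sum f b)
  then show ?thesis by simp
qed

section \<open>Fourier coefficients on the unit cell\<close>

abbreviation cell :: "r2 measure" where
  "cell \<equiv> restrict_space lborel ({0..1} \<times> {0..1})"

lemma continuous_on_qcis [continuous_intros]:
  "continuous_on S f \<Longrightarrow> continuous_on S (\<lambda>x. qcis (f x))"
  unfolding qcis_def
  by (intro bounded_linear.continuous_on[OF bounded_linear_quat_of_complex] continuous_intros)

lemma integral_qcis_unit_interval:
  "(\<integral>x. indicator {0..1} x *\<^sub>R qcis (2 * pi * of_int n * x) \<partial>lborel) = (if n = 0 then 1 else 0)"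
proof (cases "n = 0")
  case False
  \<comment> \<open>The inverse of \<open>2 \<pi> n e\<^sub>1\<^sub>2\<close>, the factor produced by differentiation.\<close>
  define c where "c = (- 1 / (2 * pi * of_int n)) *\<^sub>R quat_e12"
  have c: "((2 * pi * of_int n) *\<^sub>R quat_e12) * c = 1"
    using False by (simp add: c_def quat_e_relations)
  have deriv: "((\<lambda>t. qcis (2 * pi * of_int n * t) * c) has_vector_derivative qcis (2 * pi * of_int n * x)) (at x)" for x
    using qcis_affine_has_vector_derivative[of "2 * pi * of_int n" 0 c x] unfolding c by simp
  have "(\<integral>x. indicator {0..1} x *\<^sub>R qcis (2 * pi * of_int n * x) \<partial>lborel) = qcis (2 * pi * of_int n * 1) * c - qcis (2 * pi * of_int n * 0) * c"
  proof (rule integral_FTC_Icc)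
    show "continuous_on {0..1} (\<lambda>x. qcis (2 * pi * of_int n * x))"
      by (intro continuous_intros)
  qed (simp_all only: has_vector_derivative_at_within[OF deriv] zero_le_one)
  also have "qcis (2 * pi * of_int n * 1) = 1"
    using qcis_plus_2pi_int[of 0 n] by simp
  finally show ?thesis using False by simp
qed simp

lemma integral_qcis_cell:
  "(\<integral>\<xi>. qcis (2 * pi * det2 \<xi> (emb n)) \<partial>cell) = (if n = 0 then 1 else 0)"
proof -
  define F where "F x y = (indicator {0..1} x *\<^sub>R qcis (2 * pi * of_int (snd n) * x)) * (indicator {0..1} y *\<^sub>R qcis (2 * pi * of_int (- fst n) * y))" for x y :: real
  have cont: "continuous_on UNIV (\<lambda>\<xi>. qcis (2 * pi * det2 \<xi> (emb n)))"
    unfolding det2_def by (intro continuous_intros)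
  have int1: "integrable lborel (\<lambda>x. indicator {0..1} x *\<^sub>R qcis (2 * pi * of_int m * x))" for m
    by (rule borel_integrable_compact) (auto intro!: continuous_intros)
  have F: "indicator ({0..1} \<times> {0..1}) \<xi> *\<^sub>R qcis (2 * pi * det2 \<xi> (emb n)) = F (fst \<xi>) (snd \<xi>)" for \<xi>
    unfolding F_def mult_scaleR_left mult_scaleR_right qcis_add[symmetric] scaleR_scaleR
    by (cases \<xi>) (auto simp: indicator_def det2_def emb_def algebra_simps)
  have int: "integrable (lborel \<Otimes>\<^sub>M lborel) (\<lambda>(x, y). F x y)"
  proof -
    have "integrable lborel (\<lambda>\<xi>. indicator ({0..1} \<times> {0..1}) \<xi> *\<^sub>R qcis (2 * pi * det2 \<xi> (emb n)))"
      by (rule borel_integrable_compact) (auto intro: compact_Times continuous_on_subset[OF cont])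
    then show ?thesis by (simp add: F lborel_prod split_def)
  qed
  have "(\<integral>\<xi>. qcis (2 * pi * det2 \<xi> (emb n)) \<partial>cell) = (\<integral>\<xi>. F (fst \<xi>) (snd \<xi>) \<partial>lborel)"
    by (subst integral_restrict_space) (simp_all add: F borel_closed closed_Times)
  also have "\<dots> = (\<integral>x. \<integral>y. F x y \<partial>lborel \<partial>lborel)"
    using lborel_pair.integral_fst'[OF int] by (simp add: lborel_prod split_def)
  also have "\<dots> = (\<integral>x. (indicator {0..1} x *\<^sub>R qcis (2 * pi * of_int (snd n) * x)) * (if - fst n = 0 then 1 else 0) \<partial>lborel)"
    unfolding F_def integral_qcis_unit_interval[symmetric]
    by (intro Bochner_Integration.integral_cong refl Bochner_Integration.integral_mult_right int1)
  also have "\<dots> = (if snd n = 0 then 1 else 0) * (if - fst n = 0 then 1 else 0)"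
    unfolding integral_qcis_unit_interval[symmetric] by (intro Bochner_Integration.integral_mult_left int1)
  finally show ?thesis by (auto simp: prod_eq_iff)
qed

lemma prob_space_cell: "emeasure cell (space cell) = 1" "finite_measure cell"
proof -
  have "emeasure lborel ({0..1 :: real} \<times> {0..1 :: real}) = emeasure lborel {0..1 :: real} * emeasure lborel {0..1 :: real}"
    unfolding lborel_prod[symmetric] by (rule lborel.emeasure_pair_measure_Times) simp_all
  then show 1: "emeasure cell (space cell) = 1"
    by (simp add: space_restrict_space emeasure_restrict_space borel_closed closed_Times)
  show "finite_measure cell"
    by (rule finite_measureI) (simp add: 1)
qed

text \<open>
  The cell has measure one, so this is the nonnegativity of the variance of \<open>norm \<circ> g\<close>.
\<close>

lemma norm_integral_cell_le_l2norm:
  assumes g: "g \<in> L2 cell"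
  shows "norm (\<integral>x. g x \<partial>cell) \<le> l2norm cell g"
proof -
  interpret finite_measure cell by (rule prob_space_cell)
  have [measurable]: "g \<in> borel_measurable cell" and int2: "integrable cell (\<lambda>x. (norm (g x))\<^sup>2)"
    using g by (simp_all add: L2_def)
  have int1: "integrable cell (\<lambda>x. norm (g x))"
  proof (rule Bochner_Integration.integrable_bound)
    show "integrable cell (\<lambda>x. 1 + (norm (g x))\<^sup>2)" using int2 by simp
    have "norm (g x) \<le> 1 + (norm (g x))\<^sup>2" for x
    proof -
      have "2 * norm (g x) \<le> (norm (g x))\<^sup>2 + 1"
        using sum_squares_bound[of "norm (g x)" 1] by simp
      with norm_ge_zero[of "g x"] show ?thesis by linarith
    qed
    then show "AE x in cell. norm (norm (g x)) \<le> norm (1 + (norm (g x))\<^sup>2)" by simp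
  qed simp
  define I where "I = (\<integral>x. norm (g x) \<partial>cell)"
  have m: "measure cell (space cell) = 1"
    by (simp only: measure_def prob_space_cell(1)) simp
  have "0 \<le> (\<integral>x. (norm (g x) - I)\<^sup>2 \<partial>cell)" by simp
  also have "(\<lambda>x. (norm (g x) - I)\<^sup>2) = (\<lambda>x. (norm (g x))\<^sup>2 - 2 * I * norm (g x) + I\<^sup>2)"
    by (simp add: power2_diff fun_eq_iff)
  also have "(\<integral>x. (norm (g x))\<^sup>2 - 2 * I * norm (g x) + I\<^sup>2 \<partial>cell) = (\<integral>x. (norm (g x))\<^sup>2 \<partial>cell) - 2 * I * I + I\<^sup>2"
    using int1 int2 by (simp add: m I_def)
  finally have "I\<^sup>2 \<le> (\<integral>x. (norm (g x))\<^sup>2 \<partial>cell)" by (simp add: power2_eq_square)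
  then have "I \<le> l2norm cell g"
    unfolding l2norm_def by (rule real_le_rsqrt)
  moreover have "norm (\<integral>x. g x \<partial>cell) \<le> I"
    unfolding I_def by (rule integral_norm_bound)
  ultimately show ?thesis by linarith
qed

lemma continuous_L2_cell:
  assumes "continuous_on UNIV g"
  shows "g \<in> L2 cell" "integrable cell g"
proof -
  have *: "integrable cell f" if "continuous_on UNIV f" for f :: "r2 \<Rightarrow> 'b::euclidean_space"
  proof -
    have "integrable lborel (\<lambda>x. indicator ({0..1} \<times> {0..1}) x *\<^sub>R f x)"
      by (rule borel_integrable_compact) (auto intro: compact_Times continuous_on_subset[OF that])
    then show ?thesis
      by (subst integrable_restrict_space) (simp_all add: borel_closed closed_Times)
  qed
  show "integrable cell g" using *[OF assms] .
  moreover have "continuous_on UNIV (\<lambda>x. (norm (g x))\<^sup>2)"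
    by (intro continuous_intros assms)
  ultimately show "g \<in> L2 cell"
    unfolding L2_def using *[of "\<lambda>x. (norm (g x))\<^sup>2"] by auto
qed

text \<open>
  A coefficient is the mean of the polynomial against the conjugate exponential. The exponential
  stands on the left, so it meets the other exponentials before the coefficients.
\<close>

lemma trig_coeff_le_l2norm:
  fixes c :: "z2 \<Rightarrow> quat"
  assumes "finite F" "k0 \<in> F"
  shows "norm (c k0) \<le> l2norm cell (\<lambda>\<xi>. \<Sum>k\<in>F. qcis (2 * pi * det2 \<xi> (emb k)) * c k)"
proof -
  define g where "g \<xi> = qcis (- (2 * pi * det2 \<xi> (emb k0))) * (\<Sum>k\<in>F. qcis (2 * pi * det2 \<xi> (emb k)) * c k)" for \<xi>
  have cont: "continuous_on UNIV (\<lambda>\<xi>. qcis (2 * pi * det2 \<xi> (emb k)))" for k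
    unfolding det2_def by (intro continuous_intros)
  have "qcis (- (2 * pi * det2 \<xi> (emb k0))) * (qcis (2 * pi * det2 \<xi> (emb k)) * x) = qcis (2 * pi * det2 \<xi> (emb (k - k0))) * x" for \<xi> k x
    unfolding mult.assoc[symmetric] qcis_add[symmetric]
    by (rule arg_cong[where f = "\<lambda>y. qcis y * x"]) (simp add: det2_simps algebra_simps)
  then have g: "g \<xi> = (\<Sum>k\<in>F. qcis (2 * pi * det2 \<xi> (emb (k - k0))) * c k)" for \<xi>
    by (simp only: g_def sum_distrib_left)
  have gc: "continuous_on UNIV g"
    unfolding g[abs_def] by (intro continuous_on_sum continuous_on_mult cont continuous_on_const)
  have "(\<integral>\<xi>. g \<xi> \<partial>cell) = (\<Sum>k\<in>F. (\<integral>\<xi>. qcis (2 * pi * det2 \<xi> (emb (k - k0))) \<partial>cell) * c k)"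
    unfolding g
    by (subst Bochner_Integration.integral_sum)
      (intro sum.cong refl Bochner_Integration.integral_mult_left Bochner_Integration.integrable_mult_left
        continuous_L2_cell(2) cont)+
  also have "\<dots> = (\<Sum>k\<in>F. if k = k0 then c k else 0)"
    unfolding integral_qcis_cell by (intro sum.cong refl) (auto simp: prod_eq_iff)
  also have "\<dots> = c k0" using assms by simp
  finally have "norm (c k0) \<le> l2norm cell g"
    using norm_integral_cell_le_l2norm[OF continuous_L2_cell(1)[OF gc]] by simp
  also have "l2norm cell g = l2norm cell (\<lambda>\<xi>. \<Sum>k\<in>F. qcis (2 * pi * det2 \<xi> (emb k)) * c k)"
    by (simp add: l2norm_def g_def norm_mult)
  finally show ?thesis .
qed

text \<open>
  Once a finite set of frequencies contains \<open>k0\<close>, the coefficient of \<open>m\<close> minus the partial sum at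
  \<open>k0\<close> no longer depends on it, while the norm of this difference tends to zero. This makes the
  refinement coefficients finitely supported.
\<close>

lemma has_filter_trig_poly_coeffs:
  assumes m: "has_filter a m" and fin: "finite K"
    and trig: "\<And>\<xi>. m \<xi> = (\<Sum>k\<in>K. qcis (2 * pi * det2 \<xi> (emb k)) * b k)"
  shows "a k0 = (if k0 \<in> K then b k0 else 0)"
proof -
  define d where "d F k = (if k \<in> K then b k else 0) - (if k \<in> F then a k else 0)" for F k
  \<comment> \<open>The filter series converges in the mean square sense only, so coefficients are compared in norm.\<close>
  have lim: "((\<lambda>F. l2norm cell (\<lambda>\<xi>. m \<xi> - (\<Sum>k\<in>F. qcis (2 * pi * det2 \<xi> (emb k)) * a k))) \<longlongrightarrow> 0) (finite_subsets_at_top UNIV)"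
    using m by (simp add: has_filter_def l2_has_sum_def exp_wedge)
  have bound: "norm (d F k0) \<le> l2norm cell (\<lambda>\<xi>. m \<xi> - (\<Sum>k\<in>F. qcis (2 * pi * det2 \<xi> (emb k)) * a k))"
    if "finite F" "k0 \<in> F" for F
  proof -
    have "m \<xi> - (\<Sum>k\<in>F. qcis (2 * pi * det2 \<xi> (emb k)) * a k) = (\<Sum>k\<in>F \<union> K. qcis (2 * pi * det2 \<xi> (emb k)) * d F k)" for \<xi>
    proof -
      have "(\<Sum>k\<in>K. qcis (2 * pi * det2 \<xi> (emb k)) * b k) = (\<Sum>k\<in>F \<union> K. qcis (2 * pi * det2 \<xi> (emb k)) * (if k \<in> K then b k else 0))"
        using fin that by (intro sum.mono_neutral_cong_left) auto
      moreover have "(\<Sum>k\<in>F. qcis (2 * pi * det2 \<xi> (emb k)) * a k) = (\<Sum>k\<in>F \<union> K. qcis (2 * pi * det2 \<xi> (emb k)) * (if k \<in> F then a k else 0))"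
        using fin that by (intro sum.mono_neutral_cong_left) auto
      ultimately show ?thesis
        by (simp add: trig d_def right_diff_distrib sum_subtractf)
    qed
    then show ?thesis
      using trig_coeff_le_l2norm[of "F \<union> K" k0 "d F"] fin that by simp
  qed
  define D where "D = (if k0 \<in> K then b k0 else 0) - a k0"
  have "\<forall>\<^sub>F F in finite_subsets_at_top UNIV. norm D \<le> l2norm cell (\<lambda>\<xi>. m \<xi> - (\<Sum>k\<in>F. qcis (2 * pi * det2 \<xi> (emb k)) * a k))"
    unfolding eventually_finite_subsets_at_top
  proof (intro exI[of _ "{k0}"] conjI allI impI)
    fix F assume F: "finite F \<and> {k0} \<subseteq> F \<and> F \<subseteq> UNIV"
    then have "d F k0 = D" by (simp add: d_def D_def)
    with bound[of F] F show "norm D \<le> l2norm cell (\<lambda>\<xi>. m \<xi> - (\<Sum>k\<in>F. qcis (2 * pi * det2 \<xi> (emb k)) * a k))"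
      by simp
  qed simp_all
  then have "norm D \<le> 0"
    by (rule tendsto_lowerbound[OF lim]) simp
  then show ?thesis by (simp add: D_def)
qed

section \<open>Refinement equations\<close>

lemma l2inner_scaleR: "l2inner (\<lambda>x. r *\<^sub>R f x) (\<lambda>x. s *\<^sub>R g x) = (r * s) *\<^sub>R l2inner f g"
  by (simp add: l2inner_def mult.commute flip: integral_scaleR_right)

lemma L2_scaleR: "f \<in> L2 M \<Longrightarrow> (\<lambda>x. r *\<^sub>R f x) \<in> L2 M"
  using L2_mult_right[of f M "of_real r"] by (simp add: of_real_def)

text \<open>
  A two-scale relation with finitely many coefficients, which act from the right.
\<close>

definition refines :: "z2 set \<Rightarrow> (r2 \<Rightarrow> quat) \<Rightarrow> (r2 \<Rightarrow> quat) \<Rightarrow> (z2 \<Rightarrow> quat) \<Rightarrow> bool" where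
  "refines K \<phi> f a \<longleftrightarrow> (AE x in lborel. (1/4) *\<^sub>R f ((1/2) *\<^sub>R x) = (\<Sum>k\<in>K. \<phi> (x - emb k) * a k))"

definition orthonormal_shifts :: "(r2 \<Rightarrow> quat) \<Rightarrow> bool" where
  "orthonormal_shifts \<phi> \<longleftrightarrow> \<phi> \<in> L2 lborel \<and>
     (\<forall>k l. l2inner (\<lambda>x. \<phi> (x - emb k)) (\<lambda>x. \<phi> (x - emb l)) = (if k = l then 1 else 0))"

lemma orthonormal_shifts_inner:
  "orthonormal_shifts \<phi> \<Longrightarrow> l2inner (\<lambda>x. \<phi> (x - emb k)) (\<lambda>x. \<phi> (x - emb l)) = (if k = l then 1 else 0)"
  unfolding orthonormal_shifts_def by blast

text \<open>
  Shifting \<open>f\<close> by \<open>n\<close> shifts the coefficients on the finer scale by \<open>2 n\<close>. The factor \<open>1/4\<close> is the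
  square of the normalisation \<open>1/4\<close> times the Jacobian 4 of the dilation.
\<close>

lemma refines_inner:
  assumes \<phi>: "orthonormal_shifts \<phi>" and f: "f \<in> L2 lborel" and g: "g \<in> L2 lborel" and K: "finite K"
    and rf: "refines K \<phi> f a" and rg: "refines K \<phi> g b"
  shows "(\<Sum>k\<in>K. \<Sum>l\<in>K. if l = k + (n + n) then qcnj (a k) * b l else 0) =
    (1/4) *\<^sub>R l2inner (\<lambda>x. f (x - emb n)) g"
proof -
  have \<phi>2: "\<phi> \<in> L2 lborel" using \<phi> by (simp add: orthonormal_shifts_def)
  define F where "F x = (1/4) *\<^sub>R f (- emb n + (1/2) *\<^sub>R x)" for x
  define G where "G x = (1/4) *\<^sub>R g (0 + (1/2) *\<^sub>R x)" for x
  define F' where "F' x = (\<Sum>k\<in>K. \<phi> (x - emb (k + (n + n))) * a k)" for x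
  define G' where "G' x = (\<Sum>k\<in>K. \<phi> (x - emb k) * b k)" for x
  have "AE x in lborel. F x = F' x"
  proof -
    have "AE x in lborel. (1/4) *\<^sub>R f ((1/2) *\<^sub>R (- emb (n + n) + 1 *\<^sub>R x)) = (\<Sum>k\<in>K. \<phi> (- emb (n + n) + 1 *\<^sub>R x - emb k) * a k)"
      using AE_affine_r2[OF _ rf[unfolded refines_def], of 1 "- emb (n + n)"] by simp
    moreover have "(1/2) *\<^sub>R (- emb (n + n) + 1 *\<^sub>R x) = - emb n + (1/2) *\<^sub>R x" for x
      by (simp add: emb_def algebra_simps prod_eq_iff)
    moreover have "- emb (n + n) + 1 *\<^sub>R x - emb k = x - emb (k + (n + n))" for x k
      by simp
    ultimately show ?thesis unfolding F_def F'_def by (simp only:)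
  qed
  moreover have "AE x in lborel. G x = G' x"
    using rg by (simp add: G_def G'_def refines_def)
  moreover have "F \<in> L2 lborel" "G \<in> L2 lborel"
    unfolding F_def G_def by (intro L2_scaleR L2_affine f g; simp)+
  moreover have "F' \<in> L2 lborel" "G' \<in> L2 lborel"
    unfolding F'_def G'_def by (intro L2_sum L2_mult_right L2_shift \<phi>2)+
  ultimately have "l2inner F G = l2inner F' G'"
    by (intro l2inner_cong_AE)
  also have "\<dots> = (\<Sum>k\<in>K. \<Sum>l\<in>K. qcnj (a k) * (if k + (n + n) = l then 1 else 0) * b l)"
    unfolding F'_def G'_def orthonormal_shifts_inner[OF \<phi>, symmetric]
    by (rule l2inner_sums) (intro L2_shift \<phi>2)+
  also have "\<dots> = (\<Sum>k\<in>K. \<Sum>l\<in>K. if l = k + (n + n) then qcnj (a k) * b l else 0)"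
    by (intro sum.cong refl) auto
  finally have "(\<Sum>k\<in>K. \<Sum>l\<in>K. if l = k + (n + n) then qcnj (a k) * b l else 0) = l2inner F G" by simp
  also have "\<dots> = (1/16) *\<^sub>R l2inner (\<lambda>x. (\<lambda>x. f (x - emb n)) (0 + (1/2) *\<^sub>R x)) (\<lambda>x. g (0 + (1/2) *\<^sub>R x))"
    unfolding F_def G_def by (subst l2inner_scaleR) (simp add: algebra_simps)
  also have "l2inner (\<lambda>x. (\<lambda>x. f (x - emb n)) (0 + (1/2) *\<^sub>R x)) (\<lambda>x. g (0 + (1/2) *\<^sub>R x)) = (1 / (1/2)\<^sup>2) *\<^sub>R l2inner (\<lambda>x. f (x - emb n)) g"
    by (rule l2inner_affine) (auto intro!: L2_shift f g)
  finally show ?thesis by (simp add: power2_eq_square)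
qed

text \<open>
  Integrating the refinement equation; quaternions from the coefficients stay on the right.
\<close>

lemma refines_integral:
  assumes \<phi>: "integrable lborel \<phi>" and r: "refines K \<phi> \<phi> a"
  shows "(\<integral>x. \<phi> x \<partial>lborel) = (\<integral>x. \<phi> x \<partial>lborel) * (\<Sum>k\<in>K. a k)"
proof -
  have [measurable]: "\<phi> \<in> borel_measurable borel" using \<phi> by auto
  have shift: "(\<lambda>x. \<phi> (x - emb k)) = (\<lambda>x. \<phi> (- emb k + 1 *\<^sub>R x))" for k
    by (simp add: algebra_simps)
  have int: "integrable lborel (\<lambda>x. \<phi> (x - emb k))" for k
    unfolding shift by (rule integrable_affine_r2[OF _ \<phi>]) simp
  have I: "(\<integral>x. \<phi> (x - emb k) \<partial>lborel) = (\<integral>x. \<phi> x \<partial>lborel)" for k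
    unfolding shift by (subst integral_affine_r2) simp_all
  have "(\<integral>x. (1/4) *\<^sub>R \<phi> (0 + (1/2) *\<^sub>R x) \<partial>lborel) = (\<integral>x. (\<Sum>k\<in>K. \<phi> (x - emb k) * a k) \<partial>lborel)"
    using r by (intro integral_cong_AE) (simp_all add: refines_def)
  also have "\<dots> = (\<Sum>k\<in>K. (\<integral>x. \<phi> x \<partial>lborel) * a k)"
    by (subst Bochner_Integration.integral_sum) (simp_all add: int I)
  also have "(\<integral>x. (1/4) *\<^sub>R \<phi> (0 + (1/2) *\<^sub>R x) \<partial>lborel) = (\<integral>x. \<phi> x \<partial>lborel)"
    using integral_affine_r2[of "1/2" \<phi> 0] by (simp add: power2_eq_square)
  finally show ?thesis by (simp add: sum_distrib_left)
qed

lemma spinor_plus_vector: "spinor_part x + vector_part x = x"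
  by (simp add: quat_eq_iff spinor_part_def vector_part_def quat_e1_def quat_e2_def quat_e12_def)

text \<open>
  What is needed of a multiresolution analysis: orthonormality of the integer shifts of scaling
  function and wavelets, and refinement equations whose coefficients are read off from the first
  block row of the wavelet matrix.
\<close>

lemma wavelet_matrix_trig_polyE:
  assumes W: "wavelet_matrix \<phi> \<psi> (trig_poly \<eta> A)"
  obtains m where "orthonormal_shifts \<phi>"
    "\<And>\<epsilon>. (\<psi>(0 := \<phi>)) \<epsilon> \<in> L2 lborel"
    "\<And>\<epsilon> \<delta> n. l2inner (\<lambda>x. (\<psi>(0 := \<phi>)) \<epsilon> (x - emb n)) ((\<psi>(0 := \<phi>)) \<delta>) = (if \<epsilon> = \<delta> \<and> n = 0 then 1 else 0)"
    "\<And>\<epsilon>. refines (Q2 \<eta>) \<phi> ((\<psi>(0 := \<phi>)) \<epsilon>) (\<lambda>k. row_coeff (A k) \<epsilon>)"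
    "\<And>\<epsilon> \<xi>. m \<epsilon> \<xi> = (\<Sum>k\<in>Q2 \<eta>. qcis (2 * pi * det2 \<xi> (emb k)) * row_coeff (A k) \<epsilon>)"
    "\<And>\<xi>. trig_poly \<eta> A \<xi> = from_blocks (\<lambda>j \<epsilon>. svmat (m \<epsilon>) (\<xi> + (1/2) *\<^sub>R corner j))"
proof -
  obtain V a m where mra: "mra V \<phi>" and ws: "wavelet_system V \<psi>"
    and rc: "\<And>\<epsilon>. refinement_coeffs \<phi> ((\<psi>(0 := \<phi>)) \<epsilon>) (a \<epsilon>)" and hf: "\<And>\<epsilon>. has_filter (a \<epsilon>) (m \<epsilon>)"
    and U: "\<And>\<xi>. trig_poly \<eta> A \<xi> = from_blocks (\<lambda>j \<epsilon>. svmat (m \<epsilon>) (\<xi> + (1/2) *\<^sub>R corner j))"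
    using W unfolding wavelet_matrix_def by blast
  have "\<forall>j. closed_right_submodule (V j)"
    using mra unfolding mra_def by (elim conjE)
  then have V: "V j \<subseteq> L2 lborel" for j
    by (simp add: closed_right_submodule_def)
  have basis\<phi>: "orthonormal_basis UNIV (\<lambda>k x. \<phi> (x - emb k)) (V 0)"
    using mra unfolding mra_def by (elim conjE)
  have \<phi>V: "\<phi> \<in> V 0"
    using mra unfolding mra_def by (elim conjE)
  have \<phi>k: "(\<lambda>x. \<phi> (x - emb k)) \<in> V 0" for k
    using basis\<phi> unfolding orthonormal_basis_def by blast
  have 1: "orthonormal_shifts \<phi>"
    using basis\<phi> \<phi>V V[of 0] unfolding orthonormal_shifts_def orthonormal_basis_def by blast
  have basis\<psi>: "orthonormal_basis ({1, 2, 3} \<times> UNIV) (\<lambda>(\<epsilon>, k) x. \<psi> \<epsilon> (x - emb k)) (detail_space V 0)"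
    using ws[unfolded wavelet_system_def, rule_format, of 0] by simp
  have \<psi>k: "(\<lambda>x. \<psi> \<epsilon> (x - emb k)) \<in> detail_space V 0" if "\<epsilon> \<noteq> 0" for \<epsilon> k
  proof -
    have "(\<epsilon>, k) \<in> {1, 2, 3} \<times> UNIV"
      using that exhaust_4_from_0[of \<epsilon>] by auto
    from bspec[OF conjunct1[OF basis\<psi>[unfolded orthonormal_basis_def]] this] show ?thesis by simp
  qed
  have \<psi>o: "l2inner (\<lambda>x. \<psi> \<epsilon> (x - emb k)) (\<lambda>x. \<psi> \<delta> (x - emb l)) = (if \<epsilon> = \<delta> \<and> k = l then 1 else 0)"
    if "\<epsilon> \<noteq> 0" "\<delta> \<noteq> 0" for \<epsilon> \<delta> k l
  proof -
    have "(\<epsilon>, k) \<in> {1, 2, 3} \<times> UNIV" "(\<delta>, l) \<in> {1, 2, 3} \<times> UNIV"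
      using that exhaust_4_from_0[of \<epsilon>] exhaust_4_from_0[of \<delta>] by auto
    from bspec[OF bspec[OF conjunct1[OF conjunct2[OF basis\<psi>[unfolded orthonormal_basis_def]]] this(1)] this(2)]
    show ?thesis by simp
  qed
  have \<phi>\<psi>: "l2inner (\<lambda>x. \<phi> (x - emb k)) (\<lambda>x. \<psi> \<delta> (x - emb l)) = 0" if "\<delta> \<noteq> 0" for \<delta> k l
    using \<psi>k[OF that, of l] \<phi>k[of k] unfolding detail_space_def by blast
  have \<psi>\<phi>: "l2inner (\<lambda>x. \<psi> \<delta> (x - emb l)) (\<lambda>x. \<phi> (x - emb k)) = 0" if "\<delta> \<noteq> 0" for \<delta> k l
    using \<phi>\<psi>[OF that, of k l] by (subst l2inner_cnj) simp
  have 2: "(\<psi>(0 := \<phi>)) \<epsilon> \<in> L2 lborel" for \<epsilon>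
  proof (cases "\<epsilon> = 0")
    case True
    then show ?thesis using \<phi>V V by auto
  next
    case False
    then show ?thesis using \<psi>k[OF False, of 0] V[of "0 + 1"] by (auto simp: detail_space_def)
  qed
  have 3: "l2inner (\<lambda>x. (\<psi>(0 := \<phi>)) \<epsilon> (x - emb n)) ((\<psi>(0 := \<phi>)) \<delta>) = (if \<epsilon> = \<delta> \<and> n = 0 then 1 else 0)" for \<epsilon> \<delta> n
    using \<psi>o[of \<epsilon> \<delta> n 0] \<phi>\<psi>[of \<delta> n 0] \<psi>\<phi>[of \<epsilon> n 0] orthonormal_shifts_inner[OF 1, of n 0]
    by (cases "\<epsilon> = 0"; cases "\<delta> = 0") auto
  have 5: "m \<epsilon> \<xi> = (\<Sum>k\<in>Q2 \<eta>. qcis (2 * pi * det2 \<xi> (emb k)) * row_coeff (A k) \<epsilon>)" for \<epsilon> \<xi>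
  proof -
    have "m \<epsilon> \<xi> = row_coeff (trig_poly \<eta> A \<xi>) \<epsilon>"
      by (simp add: U row_coeff_def corner_def svmat_def spinor_plus_vector flip: zero_prod_def)
    then show ?thesis
      by (simp add: trig_poly_eq row_coeff_trig_sum)
  qed
  have a: "a \<epsilon> k = (if k \<in> Q2 \<eta> then row_coeff (A k) \<epsilon> else 0)" for \<epsilon> k
    by (rule has_filter_trig_poly_coeffs[OF hf finite_Q2 5])
  have 4: "refines (Q2 \<eta>) \<phi> ((\<psi>(0 := \<phi>)) \<epsilon>) (\<lambda>k. row_coeff (A k) \<epsilon>)" for \<epsilon>
  proof -
    have "AE x in lborel. (1/4) *\<^sub>R (\<psi>(0 := \<phi>)) \<epsilon> ((1/2) *\<^sub>R x) = (\<Sum>k\<in>Q2 \<eta>. \<phi> (x - emb k) * a \<epsilon> k)"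
      by (rule l2_has_sum_finite) (use rc[of \<epsilon>] in \<open>auto simp: refinement_coeffs_def a\<close>)
    then show ?thesis
      by (simp add: refines_def a cong: sum.cong)
  qed
  show thesis by (rule that[OF 1 2 3 4 5 U])
qed

section \<open>The wavelet matrix at the origin\<close>

definition corner_int :: "4 \<Rightarrow> z2" where
  "corner_int l = (if l = 0 then (0,0) else if l = 1 then (1,0) else if l = 2 then (0,1) else (1,1))"

text \<open>
  The exponential \<open>exp (\<pi> v\<^sub>j \<and> k)\<close> is a real sign.
\<close>

definition corner_sign :: "4 \<Rightarrow> z2 \<Rightarrow> real" where
  "corner_sign j k = (-1) powi (fst (corner_int j) * snd k - snd (corner_int j) * fst k)"

lemma qcis_corner:
  "qcis (2 * pi * det2 ((1/2) *\<^sub>R corner j) (emb k)) * x = corner_sign j k *\<^sub>R x"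
  "qcis (2 * pi * det2 (- ((1/2) *\<^sub>R corner j)) (emb k)) * x = corner_sign j k *\<^sub>R x"
proof -
  have c: "corner j = emb (corner_int j)"
    by (simp add: corner_def corner_int_def emb_def)
  define d where "d = fst (corner_int j) * snd k - snd (corner_int j) * fst k"
  have "2 * pi * det2 ((1/2) *\<^sub>R corner j) (emb k) = pi * of_int d"
    "2 * pi * det2 (- ((1/2) *\<^sub>R corner j)) (emb k) = pi * of_int (- d)"
    by (simp_all add: c det2_simps det2_emb d_def algebra_simps)
  then show "qcis (2 * pi * det2 ((1/2) *\<^sub>R corner j) (emb k)) * x = corner_sign j k *\<^sub>R x"
    "qcis (2 * pi * det2 (- ((1/2) *\<^sub>R corner j)) (emb k)) * x = corner_sign j k *\<^sub>R x"
    by (simp_all only: qcis_pi_int corner_sign_def d_def[symmetric] power_int_minus_one_minus scaleR_conv_of_real)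
qed

lemma sum_UNIV_4: "sum f (UNIV :: 4 set) = f 0 + f 1 + f 2 + f 3"
proof -
  have "(UNIV :: 4 set) = {0, 1, 2, 3}" using exhaust_4_from_0 by blast
  moreover have "sum f {0, 1, 2, 3 :: 4} = f 0 + f 1 + f 2 + f 3" by (simp add: add.assoc)
  ultimately show ?thesis by (simp only:)
qed

lemma sum_UNIV_3: "sum f (UNIV :: 3 set) = f 0 + f 1 + f 2"
proof -
  have "(UNIV :: 3 set) = {0, 1, 2}" using exhaust_3_from_0 by blast
  moreover have "sum f {0, 1, 2 :: 3} = f 0 + f 1 + f 2" by (simp add: add.assoc)
  ultimately show ?thesis by (simp only:)
qed

lemma sum_corner_sign:
  "(\<Sum>j\<in>UNIV. corner_sign j k * corner_sign j l) = (if even (fst k - fst l) \<and> even (snd k - snd l) then 4 else 0)"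
  by (simp add: sum_UNIV_4 corner_sign_def corner_int_def power_int_minus_left)

text \<open>
  Summing over the corners selects the pairs with \<open>l - k\<close> even in both coordinates, that is
  \<open>l = k + 2 n\<close> for a unique \<open>n\<close>. These are the sums that orthonormality determines.
\<close>

lemma polyphase_orthonormal:
  fixes a b :: "z2 \<Rightarrow> quat"
  assumes \<eta>: "\<eta> > 0"
    and orth: "\<And>n. (\<Sum>k\<in>Q2 \<eta>. \<Sum>l\<in>Q2 \<eta>. if l = k + (n + n) then qcnj (a k) * b l else 0) = (if n = 0 then c else 0)"
  shows "(\<Sum>j\<in>UNIV. qcnj (\<Sum>k\<in>Q2 \<eta>. corner_sign j k *\<^sub>R a k) * (\<Sum>l\<in>Q2 \<eta>. corner_sign j l *\<^sub>R b l)) = 4 *\<^sub>R c"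
proof -
  \<comment> \<open>Large enough to contain half the difference of any two frequencies.\<close>
  define N where "N = {- \<eta>..\<eta>} \<times> {- \<eta>..\<eta>}"
  have "(\<Sum>j\<in>UNIV. qcnj (\<Sum>k\<in>Q2 \<eta>. corner_sign j k *\<^sub>R a k) * (\<Sum>l\<in>Q2 \<eta>. corner_sign j l *\<^sub>R b l))
    = (\<Sum>j\<in>UNIV. \<Sum>k\<in>Q2 \<eta>. \<Sum>l\<in>Q2 \<eta>. (corner_sign j k * corner_sign j l) *\<^sub>R (qcnj (a k) * b l))"
    by (simp add: qcnj_sum sum_product mult.commute)
  also have "\<dots> = (\<Sum>k\<in>Q2 \<eta>. \<Sum>l\<in>Q2 \<eta>. \<Sum>j\<in>UNIV. (corner_sign j k * corner_sign j l) *\<^sub>R (qcnj (a k) * b l))"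
    by (subst sum.swap, intro sum.cong refl sum.swap)
  also have "\<dots> = (\<Sum>k\<in>Q2 \<eta>. \<Sum>l\<in>Q2 \<eta>. \<Sum>n\<in>N. 4 *\<^sub>R (if l = k + (n + n) then qcnj (a k) * b l else 0))"
  proof (intro sum.cong refl)
    fix k l assume kl: "k \<in> Q2 \<eta>" "l \<in> Q2 \<eta>"
    define h where "h = ((fst l - fst k) div 2, (snd l - snd k) div 2)"
    have hN: "h \<in> N" using kl by (auto simp: h_def N_def Q2_def)
    have iff: "l = k + (n + n) \<longleftrightarrow> even (fst k - fst l) \<and> even (snd k - snd l) \<and> n = h" for n
      by (auto simp: h_def prod_eq_iff)
    have "(\<Sum>n\<in>N. if l = k + (n + n) then 4 *\<^sub>R (qcnj (a k) * b l) else 0)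
      = (\<Sum>n\<in>N. if n = h then (if even (fst k - fst l) \<and> even (snd k - snd l) then 4 *\<^sub>R (qcnj (a k) * b l) else 0) else 0)"
      unfolding iff by (intro sum.cong refl) auto
    also have "\<dots> = (if even (fst k - fst l) \<and> even (snd k - snd l) then 4 *\<^sub>R (qcnj (a k) * b l) else 0)"
      using hN by (simp add: N_def)
    finally show "(\<Sum>j\<in>UNIV. (corner_sign j k * corner_sign j l) *\<^sub>R (qcnj (a k) * b l)) =
       (\<Sum>n\<in>N. 4 *\<^sub>R (if l = k + (n + n) then qcnj (a k) * b l else 0))"
      by (simp add: scaleR_sum_left[symmetric] sum_corner_sign if_distrib[of "scaleR 4"] cong: if_cong)
  qed
  also have "\<dots> = (\<Sum>n\<in>N. \<Sum>k\<in>Q2 \<eta>. \<Sum>l\<in>Q2 \<eta>. 4 *\<^sub>R (if l = k + (n + n) then qcnj (a k) * b l else 0))"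
    by (subst (2) sum.swap, subst sum.swap, intro sum.cong refl sum.swap)
  also have "\<dots> = 4 *\<^sub>R (\<Sum>n\<in>N. if n = 0 then c else 0)"
    by (simp only: scaleR_sum_right[symmetric] orth)
  also have "\<dots> = 4 *\<^sub>R c"
    using \<eta> by (simp add: N_def zero_prod_def)
  finally show ?thesis .
qed

text \<open>
  The spinor-vector matrix of a constant function. It is a ring homomorphism compatible with
  adjoints, so quaternion matrices can replace block matrices.
\<close>

definition svquat :: "quat \<Rightarrow> quat ^ 2 ^ 2" where
  "svquat x = mat2 (spinor_part x) (vector_part x) (vector_part x) (spinor_part x)"

lemma svquat_nth: "svquat x $ p $ q = (if p = q then spinor_part x else vector_part x)"
  using exhaust_2_from_0[of p] exhaust_2_from_0[of q] by (auto simp: svquat_def)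

lemma part_sel [simp]:
  "qc0 (spinor_part x) = qc0 x" "qc1 (spinor_part x) = 0" "qc2 (spinor_part x) = 0" "qc12 (spinor_part x) = qc12 x"
  "qc0 (vector_part x) = 0" "qc1 (vector_part x) = qc1 x" "qc2 (vector_part x) = qc2 x" "qc12 (vector_part x) = 0"
  by (simp_all add: spinor_part_def vector_part_def quat_e1_def quat_e2_def quat_e12_def)

lemma svquat_add: "svquat (x + y) = svquat x + svquat y"
  by (simp add: vec_eq_iff svquat_nth quat_eq_iff)

lemma svquat_0: "svquat 0 = 0"
  by (simp add: vec_eq_iff svquat_nth quat_eq_iff)

lemma svquat_sum: "svquat (sum f S) = (\<Sum>i\<in>S. svquat (f i))"
  by (induction S rule: infinite_finite_induct) (auto simp: svquat_0 svquat_add)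

lemma svquat_1: "svquat 1 = svconst 1"
  by (simp add: svquat_def svconst_eq quat_eq_iff spinor_part_def vector_part_def)

lemma svquat_1_nth: "svquat 1 $ p $ q = (if p = q then 1 else 0)"
  by (simp add: svquat_nth quat_eq_iff)

lemma pure_svquat: "pure p q (svquat x $ p $ q)"
  by (simp add: svquat_nth pure_def)

lemma svquat_gram_nth:
  "(\<Sum>r\<in>UNIV. qcnj (svquat x $ r $ p) * svquat y $ r $ q) = svquat (qcnj x * y) $ p $ q"
  using exhaust_2_from_0[of p] exhaust_2_from_0[of q]
  by (auto simp: sum_UNIV_2 svquat_nth quat_eq_iff quat_sel_times algebra_simps)

text \<open>
  Determinants would need commutativity. Instead, the columns form a finite-dimensional real vector
  space, on which injective linear maps are surjective.
\<close>

lemma quat_left_inverse_imp_right_inverse: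
  fixes A B :: "quat ^ 'n ^ 'n"
  assumes "B ** A = mat 1"
  shows "A ** B = mat 1"
proof -
  have "linear (\<lambda>x. A *v x)"
    by (rule linearI) (simp_all add: vec_eq_iff matrix_vector_mult_def distrib_left sum.distrib scaleR_sum_right)
  moreover have BA: "B *v (A *v x) = x" for x
    by (simp add: matrix_vector_mul_assoc assms)
  then have "inj (\<lambda>x. A *v x)" by (metis injI)
  ultimately have "surj (\<lambda>x. A *v x)" by (rule linear_injective_imp_surjective) (rule refl)
  have "(A ** B) *v y = mat 1 *v y" for y
  proof -
    obtain x where y: "y = A *v x" using \<open>surj (\<lambda>x. A *v x)\<close> by (rule surjE)
    show ?thesis
      unfolding matrix_vector_mul_assoc[symmetric] y BA by simp
  qed
  then show ?thesis by (simp add: matrix_eq)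
qed

text \<open>
  A unit entry in the corner uses up the length of the first column of \<open>M\<close>, so the rest of this
  column vanishes; orthogonality to the other columns then clears the first row.
\<close>

lemma unitary_svquat_blocks:
  fixes M :: "4 \<Rightarrow> 4 \<Rightarrow> quat"
  assumes X: "\<And>i p j q. X $ (i, p) $ (j, q) = svquat (M i j) $ p $ q"
    and gram: "\<And>\<epsilon> \<delta>. (\<Sum>j\<in>UNIV. qcnj (M j \<epsilon>) * M j \<delta>) = (if \<epsilon> = \<delta> then 1 else 0)"
    and M00: "M 0 0 = 1"
  shows "X \<in> {svconst 1} \<otimes>\<^sub>b USVmat"
proof -
  have split: "sum g (UNIV :: 4 set) = g 0 + (\<Sum>k\<in>UNIV. g (upper_index k))" for g :: "4 \<Rightarrow> quat"
    by (simp add: sum_UNIV_4 sum_UNIV_3 upper_index_def add.assoc)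
  have "of_real (\<Sum>j\<in>UNIV. (norm (M j 0))\<^sup>2) = (1 :: quat)"
    using gram[of 0 0] by (simp add: qcnj_mult_self)
  then have "(\<Sum>j\<in>UNIV. (norm (M j 0))\<^sup>2) = 1"
    by (simp only: of_real_eq_1_iff)
  then have norms: "(norm (M 1 0))\<^sup>2 + (norm (M 2 0))\<^sup>2 + (norm (M 3 0))\<^sup>2 = 0"
    by (simp add: sum_UNIV_4 M00)
  then have "M 1 0 = 0 \<and> M 2 0 = 0 \<and> M 3 0 = 0"
    by (simp add: add_nonneg_eq_0_iff)
  then have col: "M j 0 = 0" if "j \<noteq> 0" for j
    using exhaust_4_from_0[of j] that by auto
  have row: "M 0 \<delta> = 0" if "\<delta> \<noteq> 0" for \<delta>
    using gram[of 0 \<delta>] that by (simp add: split M00 col upper_index_nonzero)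
  \<comment> \<open>Hence the block matrix splits, and its lower part inherits the relations of \<open>M\<close>.\<close>
  have off: "off_diag_zero X"
    using row col by (auto simp: off_diag_zero_def X svquat_0)
  have SV: "X \<in> SVmat"
    by (simp add: SVmat_iff X pure_svquat)
  define B where "B = lower_part X"
  have B: "B $ (i, p) $ (j, q) = svquat (M (upper_index i) (upper_index j)) $ p $ q" for i p j q
    by (simp add: B_def lower_part_def X)
  have "qadjoint B ** B = mat 1"
  proof -
    have "(qadjoint B ** B) $ (i, p) $ (j, q) = (mat 1 :: 3 bmat) $ (i, p) $ (j, q)" for i p j q
    proof -
      have "(qadjoint B ** B) $ (i, p) $ (j, q) =
          (\<Sum>k\<in>UNIV. \<Sum>r\<in>UNIV. qcnj (B $ (k, r) $ (i, p)) * B $ (k, r) $ (j, q))"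
        by (simp add: matrix_mult_nth sum_UNIV_pair sum_UNIV_2)
      also have "\<dots> = svquat (\<Sum>k\<in>UNIV. qcnj (M (upper_index k) (upper_index i)) * M (upper_index k) (upper_index j)) $ p $ q"
        by (simp add: B svquat_gram_nth svquat_sum)
      also have "(\<Sum>k\<in>UNIV. qcnj (M (upper_index k) (upper_index i)) * M (upper_index k) (upper_index j)) =
          (if upper_index i = upper_index j then 1 else 0)"
        using gram[of "upper_index i" "upper_index j"] by (simp add: split row upper_index_nonzero)
      also have "upper_index i = upper_index j \<longleftrightarrow> i = j"
        by (metis lower_upper_index)
      finally show ?thesis
        by (simp add: svquat_0 svquat_1_nth mat_def)
    qed
    then show ?thesis by (simp add: vec_eq_iff)
  qed
  then have "qunitary B"
    by (simp add: qunitary_def quat_left_inverse_imp_right_inverse)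
  moreover have "B \<in> SVmat"
    unfolding SVmat_iff by (auto simp: B pure_svquat)
  moreover have "blk X 0 0 = svconst 1"
    by (simp add: vec_eq_iff X M00 svquat_1)
  ultimately show ?thesis
    using block_diag_decompose[OF off] unfolding block_tensor_def USVmat_def B_def by auto
qed

text \<open>
  At \<open>\<xi> = 0\<close> the blocks are \<open>[m\<^sub>\<epsilon>(v\<^sub>j / 2)]\<close>. By periodicity they come from single quaternions \<open>M j \<epsilon>\<close>,
  which are signed sums of the refinement coefficients and form a unitary matrix. The normalisation
  of the Fourier transform gives \<open>M 0 0 = 1\<close>.
\<close>

lemma wavelet_matrix_at_0:
  assumes \<eta>: "\<eta> > 0" and W: "wavelet_matrix \<phi> \<psi> (trig_poly \<eta> A)"
    and int: "integrable lborel \<phi>" and one: "quat_fourier \<phi> 0 = 1"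
  shows "samples \<eta> (trig_poly \<eta> A) (0, 0) \<in> {svconst 1} \<otimes>\<^sub>b USVmat"
proof -
  define f where "f = \<psi>(0 := \<phi>)"
  define a where "a \<epsilon> k = row_coeff (A k) \<epsilon>" for \<epsilon> k
  obtain m where \<phi>: "orthonormal_shifts \<phi>" and f2: "\<And>\<epsilon>. f \<epsilon> \<in> L2 lborel"
    and fo: "\<And>\<epsilon> \<delta> n. l2inner (\<lambda>x. f \<epsilon> (x - emb n)) (f \<delta>) = (if \<epsilon> = \<delta> \<and> n = 0 then 1 else 0)"
    and ref: "\<And>\<epsilon>. refines (Q2 \<eta>) \<phi> (f \<epsilon>) (a \<epsilon>)"
    and m: "\<And>\<epsilon> \<xi>. m \<epsilon> \<xi> = (\<Sum>k\<in>Q2 \<eta>. qcis (2 * pi * det2 \<xi> (emb k)) * a \<epsilon> k)"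
    and U: "\<And>\<xi>. trig_poly \<eta> A \<xi> = from_blocks (\<lambda>j \<epsilon>. svmat (m \<epsilon>) (\<xi> + (1/2) *\<^sub>R corner j))"
    using wavelet_matrix_trig_polyE[OF W] unfolding f_def a_def by blast
  define M where "M j \<epsilon> = (\<Sum>k\<in>Q2 \<eta>. corner_sign j k *\<^sub>R a \<epsilon> k)" for j \<epsilon>
  have mM: "m \<epsilon> ((1/2) *\<^sub>R corner j) = M j \<epsilon>" "m \<epsilon> (- ((1/2) *\<^sub>R corner j)) = M j \<epsilon>" for j \<epsilon>
    by (simp_all only: m M_def qcis_corner)
  have X: "samples \<eta> (trig_poly \<eta> A) (0, 0) $ (i, p) $ (j, q) = svquat (M i j) $ p $ q" for i p j q
    by (simp add: samples_def emb_def U svmat_def mM svquat_def flip: zero_prod_def)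
  have orth: "(\<Sum>k\<in>Q2 \<eta>. \<Sum>l\<in>Q2 \<eta>. if l = k + (n + n) then qcnj (a \<epsilon> k) * a \<delta> l else 0) =
      (if n = 0 then (if \<epsilon> = \<delta> then of_real (1/4) else 0) else 0)" for \<epsilon> \<delta> n
    by (subst refines_inner[OF \<phi> f2 f2 finite_Q2 ref ref]) (simp add: fo of_real_def)
  have gram: "(\<Sum>j\<in>UNIV. qcnj (M j \<epsilon>) * M j \<delta>) = (if \<epsilon> = \<delta> then 1 else 0)" for \<epsilon> \<delta>
    unfolding M_def by (subst polyphase_orthonormal[OF \<eta> orth]) (simp add: of_real_def)
  have "(\<integral>x. \<phi> x \<partial>lborel) = 1"
    using one by (simp add: quat_fourier_def wedge_def)
  moreover have "refines (Q2 \<eta>) \<phi> \<phi> (a 0)" using ref[of 0] by (simp add: f_def)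
  ultimately have "(\<Sum>k\<in>Q2 \<eta>. a 0 k) = 1"
    using refines_integral[OF int, of "Q2 \<eta>" "a 0"] by simp
  then have "M 0 0 = 1"
    by (simp add: M_def corner_sign_def corner_int_def)
  from unitary_svquat_blocks[OF X gram this] show ?thesis .
qed

section \<open>Iterated refinement\<close>

primrec refine_supp :: "z2 set \<Rightarrow> nat \<Rightarrow> z2 set" where
  "refine_supp K 0 = {0}"
| "refine_supp K (Suc n) = (\<lambda>p. fst p + fst p + snd p) ` (refine_supp K n \<times> K)"

text \<open>
  Coefficients of the \<open>n\<close>-fold refinement. They depend only on \<open>a\<close>, not on the refinable function;
  products appear in reversed order because coefficients act from the right.
\<close>

primrec refine_coeff :: "z2 set \<Rightarrow> (z2 \<Rightarrow> quat) \<Rightarrow> nat \<Rightarrow> z2 \<Rightarrow> quat" where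
  "refine_coeff K a 0 = (\<lambda>m. if m = 0 then 1 else 0)"
| "refine_coeff K a (Suc n) = (\<lambda>m. \<Sum>p\<in>{p \<in> refine_supp K n \<times> K. fst p + fst p + snd p = m}. a (snd p) * refine_coeff K a n (fst p))"

lemma finite_refine_supp: "finite K \<Longrightarrow> finite (refine_supp K n)"
  by (induction n) auto

lemma refines_iterate:
  assumes K: "finite K" and r: "refines K f f a"
  shows "AE x in lborel. (1 / 4 ^ n) *\<^sub>R f ((1 / 2 ^ n) *\<^sub>R x) = (\<Sum>m\<in>refine_supp K n. f (x - emb m) * refine_coeff K a n m)"
proof (induction n)
  case 0
  show ?case by simp
next
  case (Suc n)
  have half: "AE x in lborel. (1 / 4 ^ n) *\<^sub>R f ((1 / 2 ^ n) *\<^sub>R (0 + (1/2) *\<^sub>R x)) =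
      (\<Sum>k\<in>refine_supp K n. f (0 + (1/2) *\<^sub>R x - emb k) * refine_coeff K a n k)"
    using AE_affine_r2[OF _ Suc.IH, of "1/2" 0] by simp
  have "AE x in lborel. \<forall>k\<in>refine_supp K n. (1/4) *\<^sub>R f ((1/2) *\<^sub>R (- emb (k + k) + 1 *\<^sub>R x)) = (\<Sum>l\<in>K. f (- emb (k + k) + 1 *\<^sub>R x - emb l) * a l)"
    by (intro AE_finite_allI finite_refine_supp K AE_affine_r2[OF _ r[unfolded refines_def]]) simp
  with half show ?case
  proof eventually_elim
    case (elim x)
    have shift: "(1/4) *\<^sub>R f (0 + (1/2) *\<^sub>R x - emb k) = (\<Sum>l\<in>K. f (x - emb (k + k + l)) * a l)" if "k \<in> refine_supp K n" for k
    proof -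
      have "0 + (1/2) *\<^sub>R x - emb k = (1/2) *\<^sub>R (- emb (k + k) + 1 *\<^sub>R x)"
        by (simp add: prod_eq_iff emb_def algebra_simps)
      moreover have "- emb (k + k) + 1 *\<^sub>R x - emb l = x - emb (k + k + l)" for l
        by simp
      ultimately show ?thesis using elim(2) that by (simp only:)
    qed
    have "(1 / 4 ^ Suc n) *\<^sub>R f ((1 / 2 ^ Suc n) *\<^sub>R x) = (1/4) *\<^sub>R (1 / 4 ^ n) *\<^sub>R f ((1 / 2 ^ n) *\<^sub>R (0 + (1/2) *\<^sub>R x))"
      by (simp add: mult.commute)
    also have "\<dots> = (\<Sum>k\<in>refine_supp K n. ((1/4) *\<^sub>R f (0 + (1/2) *\<^sub>R x - emb k)) * refine_coeff K a n k)"
      unfolding elim(1) by (simp add: scaleR_sum_right)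
    also have "\<dots> = (\<Sum>k\<in>refine_supp K n. \<Sum>l\<in>K. f (x - emb (k + k + l)) * (a l * refine_coeff K a n k))"
      by (intro sum.cong refl) (simp only: shift sum_distrib_right mult.assoc)
    also have "\<dots> = (\<Sum>p\<in>refine_supp K n \<times> K. f (x - emb (fst p + fst p + snd p)) * (a (snd p) * refine_coeff K a n (fst p)))"
      unfolding sum.cartesian_product by (simp only: split_def)
    also have "\<dots> = (\<Sum>m\<in>refine_supp K (Suc n). \<Sum>p\<in>{p \<in> refine_supp K n \<times> K. fst p + fst p + snd p = m}.
        f (x - emb (fst p + fst p + snd p)) * (a (snd p) * refine_coeff K a n (fst p)))"
      by (rule sum.group[symmetric]) (simp_all add: K finite_refine_supp)
    also have "\<dots> = (\<Sum>m\<in>refine_supp K (Suc n). f (x - emb m) * refine_coeff K a (Suc n) m)"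
      unfolding refine_coeff.simps sum_distrib_left by (intro sum.cong refl) auto
    finally show ?case .
  qed
qed

text \<open>
  By orthonormality the squares of the coefficients add up to the squared norm of
  \<open>4\<^sup>-\<^sup>n \<phi>(2\<^sup>-\<^sup>n x)\<close>.
\<close>

lemma refine_coeff_norm:
  assumes K: "finite K" and \<phi>: "orthonormal_shifts \<phi>" and r: "refines K \<phi> \<phi> a"
  shows "(\<Sum>m\<in>refine_supp K n. (norm (refine_coeff K a n m))\<^sup>2) = 1 / 4 ^ n"
proof -
  have \<phi>2: "\<phi> \<in> L2 lborel" using \<phi> by (simp add: orthonormal_shifts_def)
  define F where "F x = (1 / 4 ^ n) *\<^sub>R \<phi> (0 + (1 / 2 ^ n) *\<^sub>R x)" for x
  define G where "G x = (\<Sum>m\<in>refine_supp K n. \<phi> (x - emb m) * refine_coeff K a n m)" for x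
  have AE: "AE x in lborel. F x = G x"
    using refines_iterate[OF K r, of n] by (simp add: F_def G_def)
  have F: "F \<in> L2 lborel" unfolding F_def by (intro L2_scaleR L2_affine \<phi>2) simp
  have G: "G \<in> L2 lborel" unfolding G_def by (intro L2_sum L2_mult_right L2_shift \<phi>2)
  have "l2inner G G = (\<Sum>k\<in>refine_supp K n. \<Sum>l\<in>refine_supp K n.
      qcnj (refine_coeff K a n k) * (if k = l then 1 else 0) * refine_coeff K a n l)"
    unfolding G_def orthonormal_shifts_inner[OF \<phi>, symmetric]
    by (rule l2inner_sums) (intro L2_shift \<phi>2)+
  also have "\<dots> = (\<Sum>k\<in>refine_supp K n. \<Sum>l\<in>refine_supp K n. if k = l then of_real ((norm (refine_coeff K a n k))\<^sup>2) else 0)"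
    by (intro sum.cong refl) (auto simp: qcnj_mult_self)
  also have "\<dots> = of_real (\<Sum>k\<in>refine_supp K n. (norm (refine_coeff K a n k))\<^sup>2)"
    using finite_refine_supp[OF K] by simp
  finally have 1: "l2inner G G = of_real (\<Sum>k\<in>refine_supp K n. (norm (refine_coeff K a n k))\<^sup>2)" .
  have one: "l2inner \<phi> \<phi> = 1"
    using orthonormal_shifts_inner[OF \<phi>, of 0 0] by simp
  have "l2inner F F = (1 / 4 ^ n * (1 / 4 ^ n)) *\<^sub>R l2inner (\<lambda>x. \<phi> (0 + (1 / 2 ^ n) *\<^sub>R x)) (\<lambda>x. \<phi> (0 + (1 / 2 ^ n) *\<^sub>R x))"
    unfolding F_def by (rule l2inner_scaleR)
  also have "\<dots> = (1 / 4 ^ n * (1 / 4 ^ n)) *\<^sub>R (1 / (1 / 2 ^ n)\<^sup>2) *\<^sub>R 1"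
    by (subst l2inner_affine[OF _ \<phi>2 \<phi>2]) (simp_all add: one)
  also have "\<dots> = of_real (1 / 4 ^ n)"
  proof -
    have "(2 ^ n)\<^sup>2 = (4 :: real) ^ n" by (simp add: power2_eq_square flip: power_mult_distrib)
    then show ?thesis by (simp add: of_real_def power_divide)
  qed
  finally have 2: "l2inner F F = of_real (1 / 4 ^ n)" .
  have "of_real (\<Sum>k\<in>refine_supp K n. (norm (refine_coeff K a n k))\<^sup>2) = (of_real (1 / 4 ^ n) :: quat)"
    using l2inner_cong_AE[OF AE AE F G F G] 1 2 by (simp only:)
  then show ?thesis by (simp only: of_real_eq_iff)
qed

section \<open>Uniqueness of refinable functions\<close>

text \<open>
  The sets over which \<open>g\<close> has integral zero form a Dynkin system, and boxes are stable under
  intersection.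
\<close>

lemma AE_zero_if_box_integrals_zero:
  fixes g :: "'a::euclidean_space \<Rightarrow> 'b::{banach, second_countable_topology}"
  assumes g: "integrable lborel g" and total: "(\<integral>x. g x \<partial>lborel) = 0"
    and box: "\<And>u v. (\<integral>x. indicator (box u v) x *\<^sub>R g x \<partial>lborel) = 0"
  shows "AE x in lborel. g x = 0"
proof (rule sigma_finite_measure.density_zero[OF lborel.sigma_finite_measure_axioms g])
  fix A :: "'a set" assume "A \<in> sets lborel"
  then have A: "A \<in> sigma_sets UNIV (range (\<lambda>(a, b). box a b))"
    by (simp add: borel_eq_box)
  have meas: "B \<in> sets lborel" if "B \<in> sigma_sets UNIV (range (\<lambda>(a, b). box a b))" for B :: "'a set"
    using that by (simp add: borel_eq_box)
  have int: "set_integrable lborel B g" if "B \<in> sets lborel" for B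
    using that g by (simp add: set_integrable_def integrable_mult_indicator)
  show "set_lebesgue_integral lborel A g = 0"
  proof (rule sigma_sets_induct_disjoint[OF _ _ A])
    show "Int_stable (range (\<lambda>(a, b). box a b :: 'a set))"
      by (auto simp: Int_stable_def box_Int_box)
    show "set_lebesgue_integral lborel B g = 0" if "B \<in> range (\<lambda>(a, b). box a b)" for B
      using that box by (auto simp: set_lebesgue_integral_def)
    show "set_lebesgue_integral lborel (UNIV - B) g = 0"
      if "B \<in> sigma_sets UNIV (range (\<lambda>(a, b). box a b))" "set_lebesgue_integral lborel B g = 0" for B
    proof -
      have "set_lebesgue_integral lborel (B \<union> (UNIV - B)) g = set_lebesgue_integral lborel B g + set_lebesgue_integral lborel (UNIV - B) g"
        using meas[OF that(1)] by (intro set_integral_Un int) auto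
      then show ?thesis using that(2) total by (simp add: set_lebesgue_integral_def)
    qed
    show "set_lebesgue_integral lborel (\<Union>i. B i) g = 0"
      if "disjoint_family B" "range B \<subseteq> sigma_sets UNIV (range (\<lambda>(a, b). box a b))" "\<And>i. set_lebesgue_integral lborel (B i) g = 0"
      for B :: "nat \<Rightarrow> 'a set"
    proof -
      have Bm: "B i \<in> sets lborel" for i using that(2) by (intro meas) auto
      have "set_lebesgue_integral lborel (\<Union>i. B i) g = (\<Sum>i. set_lebesgue_integral lborel (B i) g)"
        using that(1) by (intro lebesgue_integral_countable_add Bm int sets.countable_UN) (auto simp: disjoint_family_on_def Bm[simplified])
      then show ?thesis by (simp add: that(3))
    qed
  qed (auto simp: set_lebesgue_integral_def)
qed

lemma card_int_between:
  assumes "\<alpha> \<le> \<beta>"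
  shows "finite {m :: int. \<alpha> \<le> of_int m \<and> of_int m \<le> \<beta>}" "real (card {m :: int. \<alpha> \<le> of_int m \<and> of_int m \<le> \<beta>}) \<le> \<beta> - \<alpha> + 1"
proof -
  have eq: "{m :: int. \<alpha> \<le> of_int m \<and> of_int m \<le> \<beta>} = {\<lceil>\<alpha>\<rceil>..\<lfloor>\<beta>\<rfloor>}"
    by (auto simp: ceiling_le_iff le_floor_iff)
  show "finite {m :: int. \<alpha> \<le> of_int m \<and> of_int m \<le> \<beta>}" unfolding eq by simp
  have "real_of_int (\<lfloor>\<beta>\<rfloor> - \<lceil>\<alpha>\<rceil> + 1) \<le> \<beta> - \<alpha> + 1"
    using of_int_floor_le[of \<beta>] le_of_int_ceiling[of \<alpha>] by (simp only: of_int_add of_int_diff of_int_1)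
  then show "real (card {m :: int. \<alpha> \<le> of_int m \<and> of_int m \<le> \<beta>}) \<le> \<beta> - \<alpha> + 1"
    unfolding eq using assms by (simp add: of_nat_nat split: if_splits)
qed

text \<open>
  For \<open>0 < N\<close>, whether \<open>(y + m) / N\<close> lies in the interval from \<open>u\<close> to \<open>v\<close>; the sets below
  compare this for the displacement \<open>y\<close> and for no displacement.
\<close>

definition in_ival :: "real \<Rightarrow> real \<Rightarrow> real \<Rightarrow> real \<Rightarrow> int \<Rightarrow> bool" where
  "in_ival N u v y m \<longleftrightarrow> N * u < y + of_int m \<and> y + of_int m < N * v"

definition either_in :: "real \<Rightarrow> real \<Rightarrow> real \<Rightarrow> real \<Rightarrow> int set" where
  "either_in N u v y = {m. in_ival N u v y m \<or> in_ival N u v 0 m}"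

definition one_in :: "real \<Rightarrow> real \<Rightarrow> real \<Rightarrow> real \<Rightarrow> int set" where
  "one_in N u v y = {m. in_ival N u v y m \<noteq> in_ival N u v 0 m}"

lemma either_in_bounds:
  assumes "0 \<le> N"
  shows "finite (either_in N u v y)" "real (card (either_in N u v y)) \<le> 2 * (N * \<bar>v - u\<bar> + 1)"
proof -
  define S where "S y = {m :: int. N * min u v - y \<le> of_int m \<and> of_int m \<le> N * max u v - y}" for y
  have le: "N * min u v \<le> N * max u v" using assms by (intro mult_left_mono) auto
  have S: "finite (S y)" "real (card (S y)) \<le> N * \<bar>v - u\<bar> + 1" for y
  proof -
    have "N * max u v - y - (N * min u v - y) = N * \<bar>v - u\<bar>"
      by (auto simp: max_def min_def right_diff_distrib)
    then show "finite (S y)" "real (card (S y)) \<le> N * \<bar>v - u\<bar> + 1"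
      using card_int_between[of "N * min u v - y" "N * max u v - y"] le by (simp_all add: S_def)
  qed
  have u: "N * min u v \<le> N * u" "N * v \<le> N * max u v" using assms by (auto intro!: mult_left_mono)
  have sub: "either_in N u v y \<subseteq> S y \<union> S 0"
    using u by (auto simp: either_in_def in_ival_def S_def)
  show "finite (either_in N u v y)" by (rule finite_subset[OF sub]) (simp add: S)
  have "card (either_in N u v y) \<le> card (S y) + card (S 0)"
    using card_mono[OF _ sub] card_Un_le[of "S y" "S 0"] S(1) by (meson finite_UnI le_trans)
  then have "real (card (either_in N u v y)) \<le> real (card (S y)) + real (card (S 0))" by linarith
  then show "real (card (either_in N u v y)) \<le> 2 * (N * \<bar>v - u\<bar> + 1)"
    using add_mono[OF S(2)[of y] S(2)[of 0]] by (simp add: algebra_simps)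
qed

text \<open>
  Moving a point by \<open>y\<close> changes membership only across one of the two endpoints, so the number of
  affected integers does not grow with \<open>N\<close>.
\<close>

lemma one_in_bounds:
  assumes "0 \<le> N"
  shows "finite (one_in N u v y)" "real (card (one_in N u v y)) \<le> 2 * (\<bar>y\<bar> + 1)"
    "real (card (one_in N u v y)) \<le> 2 * (N * \<bar>v - u\<bar> + 1)"
proof -
  have sub1: "one_in N u v y \<subseteq> either_in N u v y"
    by (auto simp: one_in_def either_in_def)
  show fin: "finite (one_in N u v y)" by (rule finite_subset[OF sub1 either_in_bounds(1)[OF assms]])
  show "real (card (one_in N u v y)) \<le> 2 * (N * \<bar>v - u\<bar> + 1)"
    using card_mono[OF either_in_bounds(1)[OF assms] sub1] either_in_bounds(2)[OF assms, of u v y] by linarith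
  \<comment> \<open>The integers \<open>m\<close> for which \<open>w\<close> lies between \<open>m\<close> and \<open>m + y\<close>.\<close>
  define S where "S w = {m :: int. w - max y 0 \<le> of_int m \<and> of_int m \<le> w - min y 0}" for w
  have S: "finite (S w)" "real (card (S w)) \<le> \<bar>y\<bar> + 1" for w
    using card_int_between[of "w - max y 0" "w - min y 0"] by (auto simp: S_def max_def min_def split: if_splits)
  have sub: "one_in N u v y \<subseteq> S (N * u) \<union> S (N * v)"
    by (auto simp: one_in_def in_ival_def S_def)
  have "card (one_in N u v y) \<le> card (S (N * u)) + card (S (N * v))"
    using card_mono[OF _ sub] card_Un_le[of "S (N * u)" "S (N * v)"] S(1) by (meson finite_UnI le_trans)
  then have "real (card (one_in N u v y)) \<le> real (card (S (N * u))) + real (card (S (N * v)))" by linarith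
  then show "real (card (one_in N u v y)) \<le> 2 * (\<bar>y\<bar> + 1)"
    using add_mono[OF S(2)[of "N * u"] S(2)[of "N * v"]] by (simp add: algebra_simps)
qed

text \<open>
  The error made by replacing \<open>y + m\<close> by \<open>m\<close> in the indicator of a box at scale \<open>N\<close>.
\<close>

definition box_jump :: "r2 \<Rightarrow> r2 \<Rightarrow> real \<Rightarrow> r2 \<Rightarrow> z2 \<Rightarrow> real" where
  "box_jump u v N y m = \<bar>indicator (box u v) ((1 / N) *\<^sub>R (y + emb m)) - indicator (box u v) ((1 / N) *\<^sub>R emb m)\<bar>"

lemma box_r2_iff:
  fixes u v y :: r2
  assumes N: "0 < N"
  shows "(1 / N) *\<^sub>R (y + emb m) \<in> box u v \<longleftrightarrow>
    in_ival N (fst u) (fst v) (fst y) (fst m) \<and> in_ival N (snd u) (snd v) (snd y) (snd m)"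
proof -
  have "x \<in> box u v \<longleftrightarrow> fst u < fst x \<and> fst x < fst v \<and> snd u < snd x \<and> snd x < snd v" for x
    by (cases u; cases v; cases x) (auto simp: mem_box Basis_prod_def)
  then show ?thesis
    using N by (auto simp: in_ival_def emb_def field_simps)
qed

text \<open>
  If exactly one of the points \<open>(y + m) / N\<close> and \<open>m / N\<close> lies in the box, then some coordinate changes
  membership while the other one belongs to its interval for at least one of the points. The first
  bound is of lower order than \<open>N\<^sup>2\<close> for fixed \<open>y\<close>, the second one is uniform in \<open>y\<close>.
\<close>

lemma sum_box_jump_le:
  fixes u v y :: r2
  assumes N: "0 < N" and fin: "finite K"
  defines "R \<equiv> \<bar>fst v - fst u\<bar> + \<bar>snd v - snd u\<bar>"
  shows "(\<Sum>m\<in>K. box_jump u v N y m) \<le> 4 * (\<bar>fst y\<bar> + \<bar>snd y\<bar> + 2) * (N * R + 1)"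
    and "(\<Sum>m\<in>K. box_jump u v N y m) \<le> 8 * (N * R + 1)\<^sup>2"
proof -
  define X1 where "X1 = one_in N (fst u) (fst v) (fst y)"
  define X2 where "X2 = one_in N (snd u) (snd v) (snd y)"
  define Y1 where "Y1 = either_in N (fst u) (fst v) (fst y)"
  define Y2 where "Y2 = either_in N (snd u) (snd v) (snd y)"
  have N0: "0 \<le> N" using N by simp
  have fins: "finite X1" "finite X2" "finite Y1" "finite Y2"
    unfolding X1_def X2_def Y1_def Y2_def by (intro one_in_bounds either_in_bounds N0)+
  have jump: "box_jump u v N y m \<le> (if m \<in> X1 \<times> Y2 \<union> Y1 \<times> X2 then 1 else 0)" for m
    using box_r2_iff[OF N, of y m u v] box_r2_iff[OF N, of 0 m u v]
    by (cases m) (auto simp: box_jump_def indicator_def X1_def X2_def Y1_def Y2_def one_in_def either_in_def)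
  have "(\<Sum>m\<in>K. box_jump u v N y m) \<le> (\<Sum>m\<in>K. if m \<in> X1 \<times> Y2 \<union> Y1 \<times> X2 then 1 else 0)"
    by (intro sum_mono jump)
  also have "\<dots> = real (card (K \<inter> (X1 \<times> Y2 \<union> Y1 \<times> X2)))"
    using fin by (simp add: sum.If_cases Int_def)
  also have "\<dots> \<le> real (card (X1 \<times> Y2 \<union> Y1 \<times> X2))"
    using fins by (intro of_nat_mono card_mono) auto
  also have "\<dots> \<le> real (card X1) * real (card Y2) + real (card Y1) * real (card X2)"
    using card_Un_le[of "X1 \<times> Y2" "Y1 \<times> X2"] by (simp add: card_cartesian_product flip: of_nat_mult of_nat_add)
  finally have main: "(\<Sum>m\<in>K. box_jump u v N y m) \<le> real (card X1) * real (card Y2) + real (card Y1) * real (card X2)" .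
  have R: "N * \<bar>fst v - fst u\<bar> \<le> N * R" "N * \<bar>snd v - snd u\<bar> \<le> N * R"
    using N by (auto simp: R_def intro!: mult_left_mono)
  have grow: "x \<le> 2 * (N * R + 1)" if "x \<le> 2 * (s + 1)" "s \<le> N * R" for x s :: real
  proof -
    have "2 * (s + 1) \<le> 2 * (N * R + 1)" using that(2) by simp
    with that(1) show ?thesis by (rule order_trans)
  qed
  have Y: "real (card Y1) \<le> 2 * (N * R + 1)" "real (card Y2) \<le> 2 * (N * R + 1)"
    unfolding Y1_def Y2_def by (rule grow[OF either_in_bounds(2)[OF N0] R(1)], rule grow[OF either_in_bounds(2)[OF N0] R(2)])
  have X: "real (card X1) \<le> 2 * (\<bar>fst y\<bar> + 1)" "real (card X2) \<le> 2 * (\<bar>snd y\<bar> + 1)"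
    unfolding X1_def X2_def by (rule one_in_bounds(2)[OF N0])+
  have X': "real (card X1) \<le> 2 * (N * R + 1)" "real (card X2) \<le> 2 * (N * R + 1)"
    unfolding X1_def X2_def by (rule grow[OF one_in_bounds(3)[OF N0] R(1)], rule grow[OF one_in_bounds(3)[OF N0] R(2)])
  have NR: "0 \<le> N * R" using N by (simp add: R_def)
  have "real (card X1) * real (card Y2) + real (card Y1) * real (card X2) \<le>
      2 * (\<bar>fst y\<bar> + 1) * (2 * (N * R + 1)) + 2 * (N * R + 1) * (2 * (\<bar>snd y\<bar> + 1))"
    by (intro add_mono mult_mono X Y) (use NR in auto)
  also have "\<dots> = 4 * (\<bar>fst y\<bar> + \<bar>snd y\<bar> + 2) * (N * R + 1)" by (simp add: algebra_simps)
  finally show "(\<Sum>m\<in>K. box_jump u v N y m) \<le> 4 * (\<bar>fst y\<bar> + \<bar>snd y\<bar> + 2) * (N * R + 1)"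
    by (rule order_trans[OF main])
  have "real (card X1) * real (card Y2) + real (card Y1) * real (card X2) \<le>
      2 * (N * R + 1) * (2 * (N * R + 1)) + 2 * (N * R + 1) * (2 * (N * R + 1))"
    by (intro add_mono mult_mono X' Y) (use NR in auto)
  also have "\<dots> = 8 * (N * R + 1)\<^sup>2" by (simp add: algebra_simps power2_eq_square)
  finally show "(\<Sum>m\<in>K. box_jump u v N y m) \<le> 8 * (N * R + 1)\<^sup>2"
    by (rule order_trans[OF main])
qed

lemma box_jump_measurable [measurable]: "(\<lambda>y. box_jump u v N y m) \<in> borel_measurable borel"
proof -
  have "(\<lambda>y. indicator (box u v) ((1 / N) *\<^sub>R (y + emb m)) :: real) \<in> borel_measurable borel"
    by (rule measurable_compose[of "\<lambda>y. (1 / N) *\<^sub>R (y + emb m)" borel borel]) simp_all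
  then show ?thesis unfolding box_jump_def by measurable
qed

lemma box_jump_bounds: "0 \<le> box_jump u v N y m" "box_jump u v N y m \<le> 1"
  by (auto simp: box_jump_def indicator_def)

text \<open>
  After \<open>n\<close> refinements the integral over a box is a combination of integrals of \<open>g\<close> over translates of
  the dilated box. Because \<open>g\<close> has mean zero, each of them only sees the jump of the indicator.
  The Cauchy-Schwarz inequality separates these from the coefficients, which contribute \<open>4\<^sup>-\<^sup>n\<close>.
\<close>

lemma box_integral_refinable_le:
  assumes K: "finite K" and g: "integrable lborel g" and zero: "(\<integral>x. g x \<partial>lborel) = 0"
    and r: "refines K g g a"
    and c: "(\<Sum>m\<in>refine_supp K n. (norm (refine_coeff K a n m))\<^sup>2) = 1 / 4 ^ n"
  shows "(norm (\<integral>x. indicator (box u v) x *\<^sub>R g x \<partial>lborel))\<^sup>2 \<le> (\<integral>x. norm (g x) \<partial>lborel) *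
    (\<integral>y. (\<Sum>m\<in>refine_supp K n. box_jump u v (2 ^ n) y m) / 4 ^ n * norm (g y) \<partial>lborel)"
proof -
  define N :: real where "N = 2 ^ n"
  have N: "0 < N" and N2: "N\<^sup>2 = 4 ^ n"
    by (simp_all add: N_def power2_eq_square flip: power_mult_distrib)
  define S where "S = refine_supp K n"
  define b where "b = refine_coeff K a n"
  define B where "B = (indicator (box u v) :: r2 \<Rightarrow> real)"
  have Bm [measurable]: "B \<in> borel_measurable borel" by (simp add: B_def)
  have gm [measurable]: "g \<in> borel_measurable borel" using g by auto
  have B01: "\<bar>B x\<bar> \<le> 1" for x by (simp add: B_def indicator_def)
  define G where "G = (\<integral>x. norm (g x) \<partial>lborel)"
  define I where "I = (\<integral>x. B x *\<^sub>R g x \<partial>lborel)"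
  define cm where "cm m = (\<integral>y. B ((1 / N) *\<^sub>R (y + emb m)) *\<^sub>R g y \<partial>lborel)" for m
  define d where "d m = (\<integral>y. box_jump u v N y m * norm (g y) \<partial>lborel)" for m
  have intB: "integrable lborel (\<lambda>y. B (T y) *\<^sub>R g y)" if [measurable]: "T \<in> borel_measurable borel" for T :: "r2 \<Rightarrow> r2"
    by (rule Bochner_Integration.integrable_bound[OF g]) (auto simp: B01 intro!: mult_left_le_one_le)
  have intd: "integrable lborel (\<lambda>y. box_jump u v N y m * norm (g y))" for m
    by (rule Bochner_Integration.integrable_bound[OF integrable_norm[OF g]])
      (auto simp: abs_mult box_jump_bounds intro!: mult_left_le_one_le)
  have shift: "(\<integral>x. B ((1 / N) *\<^sub>R x) *\<^sub>R g (x - emb m) \<partial>lborel) = cm m" for m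
  proof -
    have "cm m = (\<integral>y. (\<lambda>x. B ((1 / N) *\<^sub>R x) *\<^sub>R g (x - emb m)) (emb m + 1 *\<^sub>R y) \<partial>lborel)"
      by (simp add: cm_def add.commute)
    also have "\<dots> = (1 / 1\<^sup>2) *\<^sub>R (\<integral>x. B ((1 / N) *\<^sub>R x) *\<^sub>R g (x - emb m) \<partial>lborel)"
      by (rule integral_affine_r2) simp_all
    finally show ?thesis by simp
  qed
  have int_shift: "integrable lborel (\<lambda>x. B ((1 / N) *\<^sub>R x) *\<^sub>R g (x - emb m))" for m
  proof -
    have "integrable lborel (\<lambda>x. (\<lambda>y. B ((1 / N) *\<^sub>R (y + emb m)) *\<^sub>R g y) (- emb m + 1 *\<^sub>R x))"
      by (rule integrable_affine_r2) (simp_all add: intB)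
    then show ?thesis by simp
  qed
  have "4 ^ n *\<^sub>R I = (\<integral>x. B (0 + (1 / N) *\<^sub>R x) *\<^sub>R g (0 + (1 / N) *\<^sub>R x) \<partial>lborel)"
    unfolding I_def using N integral_affine_r2[of "1 / N" "\<lambda>x. B x *\<^sub>R g x" 0] by (simp add: power_divide N2)
  then have scale: "4 ^ n *\<^sub>R I = (\<integral>x. B ((1 / N) *\<^sub>R x) *\<^sub>R g ((1 / N) *\<^sub>R x) \<partial>lborel)" by simp
  have "I = (1 / 4 ^ n) *\<^sub>R (4 ^ n *\<^sub>R I)" by simp
  also have "\<dots> = (\<integral>x. (1 / 4 ^ n) *\<^sub>R (B ((1 / N) *\<^sub>R x) *\<^sub>R g ((1 / N) *\<^sub>R x)) \<partial>lborel)"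
    unfolding scale by (rule Bochner_Integration.integral_scaleR_right[symmetric])
  also have "\<dots> = (\<integral>x. (\<Sum>m\<in>S. (B ((1 / N) *\<^sub>R x) *\<^sub>R g (x - emb m)) * b m) \<partial>lborel)"
  proof (rule integral_cong_AE)
    show "AE x in lborel. (1 / 4 ^ n) *\<^sub>R (B ((1 / N) *\<^sub>R x) *\<^sub>R g ((1 / N) *\<^sub>R x)) =
        (\<Sum>m\<in>S. (B ((1 / N) *\<^sub>R x) *\<^sub>R g (x - emb m)) * b m)"
      using refines_iterate[OF K r, of n]
    proof eventually_elim
      case (elim x)
      have "(1 / 4 ^ n) *\<^sub>R (B ((1 / N) *\<^sub>R x) *\<^sub>R g ((1 / N) *\<^sub>R x)) = B ((1 / N) *\<^sub>R x) *\<^sub>R ((1 / 4 ^ n) *\<^sub>R g ((1 / 2 ^ n) *\<^sub>R x))"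
        by (simp add: N_def)
      also have "\<dots> = (\<Sum>m\<in>S. (B ((1 / N) *\<^sub>R x) *\<^sub>R g (x - emb m)) * b m)"
        unfolding elim S_def b_def by (simp add: scaleR_sum_right)
      finally show ?case .
    qed
  qed simp_all
  also have "\<dots> = (\<Sum>m\<in>S. cm m * b m)"
    by (simp only: Bochner_Integration.integral_sum[OF Bochner_Integration.integrable_mult_left[OF int_shift]]
        Bochner_Integration.integral_mult_left[OF int_shift] shift)
  finally have I: "I = (\<Sum>m\<in>S. cm m * b m)" .
  \<comment> \<open>Since \<open>g\<close> has mean zero, a constant may be subtracted from the indicator.\<close>
  have cd: "norm (cm m) \<le> d m" for m
  proof -
    have "cm m = cm m - B ((1 / N) *\<^sub>R emb m) *\<^sub>R (\<integral>x. g x \<partial>lborel)" by (simp add: zero)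
    also have "\<dots> = (\<integral>y. B ((1 / N) *\<^sub>R (y + emb m)) *\<^sub>R g y - B ((1 / N) *\<^sub>R emb m) *\<^sub>R g y \<partial>lborel)"
      unfolding cm_def using g by (subst Bochner_Integration.integral_diff) (simp_all add: intB)
    also have "norm \<dots> \<le> (\<integral>y. norm (B ((1 / N) *\<^sub>R (y + emb m)) *\<^sub>R g y - B ((1 / N) *\<^sub>R emb m) *\<^sub>R g y) \<partial>lborel)"
      by (rule integral_norm_bound)
    also have "\<dots> = d m"
      unfolding d_def by (intro Bochner_Integration.integral_cong refl)
        (simp add: box_jump_def B_def flip: scaleR_diff_left)
    finally show ?thesis .
  qed
  have dG: "d m \<le> G" for m
    unfolding d_def G_def
    by (intro integral_mono intd integrable_norm g) (simp add: box_jump_bounds mult_left_le_one_le)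
  have d0: "0 \<le> d m" for m
    unfolding d_def by (intro Bochner_Integration.integral_nonneg) (simp add: box_jump_bounds)
  have "norm I \<le> (\<Sum>m\<in>S. d m * norm (b m))"
    unfolding I by (rule order_trans[OF norm_sum]) (auto simp: norm_mult intro!: sum_mono mult_right_mono cd)
  then have "(norm I)\<^sup>2 \<le> (\<Sum>m\<in>S. d m * norm (b m))\<^sup>2"
    by (rule power_mono) simp
  also have "\<dots> \<le> (\<Sum>m\<in>S. (d m)\<^sup>2) * (\<Sum>m\<in>S. (norm (b m))\<^sup>2)"
    by (rule Cauchy_Schwarz_ineq_sum)
  also have "\<dots> = (\<Sum>m\<in>S. (d m)\<^sup>2) / 4 ^ n"
    using c by (simp add: S_def b_def)
  also have "\<dots> \<le> (\<Sum>m\<in>S. G * d m) / 4 ^ n"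
    by (intro divide_right_mono sum_mono) (simp_all add: power2_eq_square mult_right_mono dG d0)
  also have "\<dots> = G * (\<integral>y. (\<Sum>m\<in>S. box_jump u v N y m * norm (g y)) / 4 ^ n \<partial>lborel)"
    by (simp add: sum_distrib_left[symmetric] Bochner_Integration.integral_sum[OF intd] d_def)
  finally show ?thesis
    by (simp add: I_def B_def G_def S_def N_def sum_distrib_right)
qed

text \<open>
  Uniqueness of refinable functions: the jumps affect a number of lattice points of order \<open>2\<^sup>n\<close>, which
  is negligible against the \<open>4\<^sup>n\<close> points in the dilated box, so dominated convergence makes all
  integrals over boxes vanish.
\<close>

lemma refinable_zero_mean_eq_0:
  assumes K: "finite K" and g: "integrable lborel g" and zero: "(\<integral>x. g x \<partial>lborel) = 0"
    and r: "refines K g g a"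
    and c: "\<And>n. (\<Sum>m\<in>refine_supp K n. (norm (refine_coeff K a n m))\<^sup>2) = 1 / 4 ^ n"
  shows "AE x in lborel. g x = 0"
proof (rule AE_zero_if_box_integrals_zero[OF g zero])
  fix u v :: r2
  define R where "R = \<bar>fst v - fst u\<bar> + \<bar>snd v - snd u\<bar>"
  have R: "0 \<le> R" by (simp add: R_def)
  define s where "s n y = (\<Sum>m\<in>refine_supp K n. box_jump u v (2 ^ n) y m) / 4 ^ n * norm (g y)" for n y
  have fin: "finite (refine_supp K n)" for n by (rule finite_refine_supp[OF K])
  have gm [measurable]: "g \<in> borel_measurable borel" using g by auto
  have four: "(4 :: real) ^ n = 2 ^ n * 2 ^ n" for n by (simp flip: power_mult_distrib)
  have s0: "0 \<le> s n y" for n y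
    unfolding s_def by (intro mult_nonneg_nonneg divide_nonneg_nonneg sum_nonneg) (simp_all add: box_jump_bounds)
  have "(\<lambda>n. \<integral>y. s n y \<partial>lborel) \<longlonglongrightarrow> (\<integral>y. 0 \<partial>(lborel :: r2 measure))"
  proof (rule integral_dominated_convergence[where s = s and w = "\<lambda>y. 8 * (R + 1)\<^sup>2 * norm (g y)"])
    show "(\<lambda>y :: r2. 0 :: real) \<in> borel_measurable lborel" by simp
    show "s n \<in> borel_measurable lborel" for n unfolding s_def by measurable
    show "integrable lborel (\<lambda>y. 8 * (R + 1)\<^sup>2 * norm (g y))" using g by simp
    show "AE y in lborel. norm (s n y) \<le> 8 * (R + 1)\<^sup>2 * norm (g y)" for n
    proof (rule AE_I2)
      fix y
      have "(\<Sum>m\<in>refine_supp K n. box_jump u v (2 ^ n) y m) \<le> 8 * (2 ^ n * R + 1)\<^sup>2"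
        unfolding R_def by (rule sum_box_jump_le(2)[OF _ fin]) simp
      also have "\<dots> \<le> 8 * (2 ^ n * (R + 1))\<^sup>2"
        using R by (intro mult_left_mono power_mono) (simp_all add: distrib_left)
      also have "\<dots> = 8 * (R + 1)\<^sup>2 * 4 ^ n" by (simp add: four power2_eq_square)
      finally have "(\<Sum>m\<in>refine_supp K n. box_jump u v (2 ^ n) y m) / 4 ^ n \<le> 8 * (R + 1)\<^sup>2"
        by (simp add: divide_le_eq)
      then have "s n y \<le> 8 * (R + 1)\<^sup>2 * norm (g y)"
        unfolding s_def by (rule mult_right_mono) simp
      then show "norm (s n y) \<le> 8 * (R + 1)\<^sup>2 * norm (g y)" using s0[of n y] by simp
    qed
    show "AE y in lborel. (\<lambda>n. s n y) \<longlonglongrightarrow> 0"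
    proof (rule AE_I2)
      fix y
      define C where "C = 4 * (\<bar>fst y\<bar> + \<bar>snd y\<bar> + 2) * norm (g y)"
      have le: "s n y \<le> C * (R * (1/2) ^ n + (1/4) ^ n)" for n
      proof -
        have "s n y \<le> 4 * (\<bar>fst y\<bar> + \<bar>snd y\<bar> + 2) * (2 ^ n * R + 1) / 4 ^ n * norm (g y)"
          unfolding s_def R_def by (intro mult_right_mono divide_right_mono sum_box_jump_le(1)[OF _ fin]) simp_all
        also have "\<dots> = C * ((2 ^ n * R + 1) / 4 ^ n)" by (simp add: C_def)
        also have "(2 ^ n * R + 1) / 4 ^ n = R * (1/2) ^ n + (1/4) ^ n"
          by (simp add: add_divide_distrib four power_divide)
        finally show ?thesis .
      qed
      have "(\<lambda>n. C * (R * (1/2) ^ n + (1/4) ^ n)) \<longlonglongrightarrow> C * (R * 0 + 0)"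
        by (intro tendsto_intros LIMSEQ_realpow_zero) simp_all
      then have lim: "(\<lambda>n. C * (R * (1/2) ^ n + (1/4) ^ n)) \<longlonglongrightarrow> 0" by simp
      show "(\<lambda>n. s n y) \<longlonglongrightarrow> 0"
        by (rule tendsto_sandwich[OF _ _ tendsto_const lim]) (simp_all add: s0 le)
    qed
  qed
  then have "(\<lambda>n. (\<integral>x. norm (g x) \<partial>lborel) * (\<integral>y. s n y \<partial>lborel)) \<longlonglongrightarrow> (\<integral>x. norm (g x) \<partial>lborel) * 0"
    by (intro tendsto_mult tendsto_const) simp
  moreover have "(norm (\<integral>x. indicator (box u v) x *\<^sub>R g x \<partial>lborel))\<^sup>2 \<le> (\<integral>x. norm (g x) \<partial>lborel) * (\<integral>y. s n y \<partial>lborel)" for n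
    unfolding s_def by (rule box_integral_refinable_le[OF K g zero r c])
  ultimately have "(norm (\<integral>x. indicator (box u v) x *\<^sub>R g x \<partial>lborel))\<^sup>2 \<le> (\<integral>x. norm (g x) \<partial>lborel) * 0"
    by (intro LIMSEQ_le_const) auto
  then show "(\<integral>x. indicator (box u v) x *\<^sub>R g x \<partial>lborel) = 0" by simp
qed

section \<open>Symmetric scaling functions\<close>

text \<open>
  The coefficient \<open>a k\<close> is the inner product of \<open>\<phi>(x - k)\<close> with \<open>\<phi>(x / 2) / 4\<close>. The reflection
  \<open>x \<mapsto> 2 p - x\<close> preserves the second function and maps the first one to \<open>\<phi>(x - (p - k))\<close>.
\<close>

lemma symmetric_imp_coeff_symmetric:
  assumes \<phi>: "orthonormal_shifts \<phi>" and r: "refines (Q2 \<eta>) \<phi> \<phi> a"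
    and sym: "AE x in lborel. \<phi> x = \<phi> (emb p - x)" and p: "p = (\<eta> - 1, \<eta> - 1)" and k: "k \<in> Q2 \<eta>"
  shows "a k = a (p - k)"
proof -
  have \<phi>2: "\<phi> \<in> L2 lborel" using \<phi> by (simp add: orthonormal_shifts_def)
  define H where "H x = (1/4) *\<^sub>R \<phi> (0 + (1/2) *\<^sub>R x)" for x
  have H: "H \<in> L2 lborel" unfolding H_def by (intro L2_scaleR L2_affine \<phi>2) simp
  have coeff: "l2inner (\<lambda>x. \<phi> (x - emb m)) H = a m" if "m \<in> Q2 \<eta>" for m
  proof -
    have "l2inner (\<lambda>x. \<phi> (x - emb m)) H = l2inner (\<lambda>x. \<Sum>k\<in>{m}. \<phi> (x - emb k) * 1) (\<lambda>x. \<Sum>l\<in>Q2 \<eta>. \<phi> (x - emb l) * a l)"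
    proof (rule l2inner_cong_AE)
      show "AE x in lborel. H x = (\<Sum>l\<in>Q2 \<eta>. \<phi> (x - emb l) * a l)"
        using r by (simp add: refines_def H_def)
    qed (intro L2_sum L2_mult_right L2_shift \<phi>2 H | simp)+
    also have "\<dots> = (\<Sum>k\<in>{m}. \<Sum>l\<in>Q2 \<eta>. qcnj 1 * (if k = l then 1 else 0) * a l)"
      unfolding orthonormal_shifts_inner[OF \<phi>, symmetric] by (rule l2inner_sums) (intro L2_shift \<phi>2)+
    also have "\<dots> = (\<Sum>l\<in>Q2 \<eta>. if m = l then a l else 0)"
      by (simp add: if_distrib[of "\<lambda>x. x * _"] cong: if_cong)
    finally show ?thesis using that by simp
  qed
  have pk: "p - k \<in> Q2 \<eta>" using k by (auto simp: p Q2_def)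
  have sym': "AE x in lborel. \<phi> (t + c *\<^sub>R x) = \<phi> (emb p - (t + c *\<^sub>R x))" if "c \<noteq> 0" for t c
    using AE_affine_r2[OF that sym] .
  have "a k = (1 / (-1)\<^sup>2) *\<^sub>R l2inner (\<lambda>x. \<phi> (x - emb k)) H"
    using coeff[OF k] by simp
  also have "\<dots> = l2inner (\<lambda>x. (\<lambda>x. \<phi> (x - emb k)) (emb (p + p) + (-1) *\<^sub>R x)) (\<lambda>x. H (emb (p + p) + (-1) *\<^sub>R x))"
    by (rule l2inner_affine[symmetric]) (simp_all add: L2_shift \<phi>2 H)
  also have "\<dots> = l2inner (\<lambda>x. \<phi> (x - emb (p - k))) H"
  proof (rule l2inner_cong_AE)
    show "AE x in lborel. \<phi> (emb (p + p) + (-1) *\<^sub>R x - emb k) = \<phi> (x - emb (p - k))"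
      using sym'[of "-1" "emb (p + p) - emb k"] by (simp add: algebra_simps)
    show "AE x in lborel. H (emb (p + p) + (-1) *\<^sub>R x) = H x"
    proof -
      have "AE x in lborel. \<phi> (emb p + (- 1/2) *\<^sub>R x) = \<phi> (emb p - (emb p + (- 1/2) *\<^sub>R x))"
        by (rule sym') simp
      moreover have "emb p + (- 1/2) *\<^sub>R x = 0 + (1/2) *\<^sub>R (emb (p + p) + (-1) *\<^sub>R x)" for x
        by (simp add: prod_eq_iff emb_def algebra_simps)
      moreover have "emb p - (emb p + (- 1/2) *\<^sub>R x) = 0 + (1/2) *\<^sub>R x" for x
        by simp
      ultimately have "AE x in lborel. \<phi> (0 + (1/2) *\<^sub>R (emb (p + p) + (-1) *\<^sub>R x)) = \<phi> (0 + (1/2) *\<^sub>R x)"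
        by (simp only:)
      then show ?thesis unfolding H_def by eventually_elim (rule arg_cong)
    qed
    show "(\<lambda>x. \<phi> (emb (p + p) + (-1) *\<^sub>R x - emb k)) \<in> L2 lborel"
      using L2_affine[of "-1" "\<lambda>x. \<phi> (x - emb k)", OF _ L2_shift[OF \<phi>2]] by simp
    show "(\<lambda>x. H (emb (p + p) + (-1) *\<^sub>R x)) \<in> L2 lborel"
      by (rule L2_affine[OF _ H]) simp
  qed (intro L2_shift \<phi>2 H)+
  also have "\<dots> = a (p - k)" by (rule coeff[OF pk])
  finally show ?thesis .
qed

text \<open>
  The reflected function satisfies the same refinement equation and has the same integral, so the
  difference is refinable with mean zero.
\<close>

lemma coeff_symmetric_imp_symmetric:
  assumes \<phi>: "orthonormal_shifts \<phi>" and int: "integrable lborel \<phi>" and r: "refines (Q2 \<eta>) \<phi> \<phi> a"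
    and sym: "\<And>k. k \<in> Q2 \<eta> \<Longrightarrow> a k = a (p - k)" and p: "p = (\<eta> - 1, \<eta> - 1)"
  shows "AE x in lborel. \<phi> x = \<phi> (emb p - x)"
proof -
  define \<phi>' where "\<phi>' x = \<phi> (emb p + (-1) *\<^sub>R x)" for x
  define g where "g x = \<phi> x - \<phi>' x" for x
  have [measurable]: "\<phi> \<in> borel_measurable borel" using int by auto
  have int': "integrable lborel \<phi>'"
    unfolding \<phi>'_def by (rule integrable_affine_r2[OF _ int]) simp
  have "(\<integral>x. \<phi>' x \<partial>lborel) = (\<integral>x. \<phi> x \<partial>lborel)"
    unfolding \<phi>'_def by (subst integral_affine_r2) simp_all
  then have zero: "(\<integral>x. g x \<partial>lborel) = 0"
    unfolding g_def using int int' by (subst Bochner_Integration.integral_diff) simp_all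
  have "AE x in lborel. (1/4) *\<^sub>R \<phi>' ((1/2) *\<^sub>R x) = (\<Sum>k\<in>Q2 \<eta>. \<phi>' (x - emb k) * a k)"
  proof -
    have "AE x in lborel. (1/4) *\<^sub>R \<phi> ((1/2) *\<^sub>R (emb (p + p) + (-1) *\<^sub>R x)) = (\<Sum>k\<in>Q2 \<eta>. \<phi> (emb (p + p) + (-1) *\<^sub>R x - emb k) * a k)"
      by (rule AE_affine_r2[OF _ r[unfolded refines_def]]) simp
    moreover have "\<phi> ((1/2) *\<^sub>R (emb (p + p) + (-1) *\<^sub>R x)) = \<phi>' ((1/2) *\<^sub>R x)" for x
      unfolding \<phi>'_def by (rule arg_cong[where f = \<phi>]) (simp add: prod_eq_iff emb_def algebra_simps)
    moreover have "(\<Sum>k\<in>Q2 \<eta>. \<phi> (emb (p + p) + (-1) *\<^sub>R x - emb k) * a k) = (\<Sum>k\<in>Q2 \<eta>. \<phi>' (x - emb k) * a k)" for x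
    proof (rule sum.reindex_bij_witness[where i = "\<lambda>k. p - k" and j = "\<lambda>k. p - k"])
      fix k assume k: "k \<in> Q2 \<eta>"
      have "\<phi>' (x - emb (p - k)) = \<phi> (emb (p + p) + (-1) *\<^sub>R x - emb k)"
        unfolding \<phi>'_def by (rule arg_cong[where f = \<phi>]) (simp add: prod_eq_iff emb_def algebra_simps)
      then show "\<phi>' (x - emb (p - k)) * a (p - k) = \<phi> (emb (p + p) + (-1) *\<^sub>R x - emb k) * a k"
        using sym[OF k] by simp
    qed (auto simp: p Q2_def)
    ultimately show ?thesis by (simp only:)
  qed
  with r have rg: "refines (Q2 \<eta>) g g a"
    unfolding refines_def g_def
    by eventually_elim (simp add: scaleR_diff_right left_diff_distrib sum_subtractf)
  have "integrable lborel g"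
    unfolding g_def using int int' by (rule Bochner_Integration.integrable_diff)
  from refinable_zero_mean_eq_0[OF finite_Q2 this zero rg refine_coeff_norm[OF finite_Q2 \<phi> r]]
  show ?thesis by (simp add: g_def \<phi>'_def)
qed

lemma wavelet_symmetric_iff:
  assumes W: "wavelet_matrix \<phi> \<psi> (trig_poly \<eta> A)" and int: "integrable lborel \<phi>"
    and P: "P = ((of_int \<eta> - 1) / 2, (of_int \<eta> - 1) / 2)"
  shows "(AE x in lborel. \<phi> x = \<phi> (2 *\<^sub>R P - x)) \<longleftrightarrow>
    (\<forall>k\<in>Q2 \<eta>. row_coeff (A k) 0 = row_coeff (A ((\<eta> - 1, \<eta> - 1) - k)) 0)"
proof -
  have \<phi>: "orthonormal_shifts \<phi>" and "refines (Q2 \<eta>) \<phi> ((\<psi>(0 := \<phi>)) 0) (\<lambda>k. row_coeff (A k) 0)"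
    using wavelet_matrix_trig_polyE[OF W] by blast+
  then have r: "refines (Q2 \<eta>) \<phi> \<phi> (\<lambda>k. row_coeff (A k) 0)" by simp
  have p: "2 *\<^sub>R P = emb (\<eta> - 1, \<eta> - 1)"
    by (simp add: P emb_def)
  show ?thesis
    unfolding p
  proof
    assume "AE x in lborel. \<phi> x = \<phi> (emb (\<eta> - 1, \<eta> - 1) - x)"
    from symmetric_imp_coeff_symmetric[OF \<phi> r this refl]
    show "\<forall>k\<in>Q2 \<eta>. row_coeff (A k) 0 = row_coeff (A ((\<eta> - 1, \<eta> - 1) - k)) 0" by blast
  next
    assume "\<forall>k\<in>Q2 \<eta>. row_coeff (A k) 0 = row_coeff (A ((\<eta> - 1, \<eta> - 1) - k)) 0"
    then show "AE x in lborel. \<phi> x = \<phi> (emb (\<eta> - 1, \<eta> - 1) - x)"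
      by (intro coeff_symmetric_imp_symmetric[OF \<phi> int r _ refl]) blast
  qed
qed

section \<open>Characterisations by coefficients and samples\<close>

theorem theorem4p10:
  fixes \<eta> :: int and A :: "int \<times> int \<Rightarrow> 4 bmat" and U :: "real \<times> real \<Rightarrow> 4 bmat"
    and P :: "real \<times> real"
    and \<phi> :: "real \<times> real \<Rightarrow> quat" and \<psi> :: "4 \<Rightarrow> real \<times> real \<Rightarrow> quat"
    and \<mu> :: nat
  assumes "\<eta> \<ge> 4" and "even \<eta>"
    and "P = ((real_of_int \<eta> - 1) / 2, (real_of_int \<eta> - 1) / 2)"
    and "\<forall>k\<in>Q2 \<eta>. A k \<in> SVmat"
    and "\<forall>\<xi>. U \<xi> = trig_poly \<eta> A \<xi>"
  shows
    \<comment> \<open>(a)\<close>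
    "((\<forall>\<xi>. qunitary (U \<xi>)) \<longleftrightarrow>
      (\<forall>l. \<forall>j\<in>Q2 \<eta>. qunitary (dft \<eta> (modulate \<eta> l (idft \<eta> (samples \<eta> U))) j)))
   \<and> \<comment> \<open>(b)\<close>
     (wavelet_matrix \<phi> \<psi> U \<longrightarrow> integrable lborel \<phi> \<and> quat_fourier \<phi> 0 = 1 \<longrightarrow>
        samples \<eta> U (0, 0) \<in> {svconst 1} \<otimes>\<^sub>b USVmat)
   \<and> \<comment> \<open>(c)\<close>
     (wavelet_matrix \<phi> \<psi> U \<longrightarrow> vanishing_moments \<mu> \<psi> \<longrightarrow>
        ((\<forall>\<alpha>. fst \<alpha> + snd \<alpha> \<le> \<mu> \<longrightarrow> matrix_partial \<alpha> U 0 \<in> SV \<otimes>\<^sub>b SVmat) \<longleftrightarrow>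
         (\<forall>\<alpha>. fst \<alpha> + snd \<alpha> \<le> \<mu> \<longrightarrow>
            (\<Sum>k\<in>Q2 \<eta>. svconst (real_of_int (snd k ^ fst \<alpha> * fst k ^ snd \<alpha>)) \<circledast> A k)
              \<in> SV \<otimes>\<^sub>b SVmat)) \<and>
        ((\<forall>\<alpha>. fst \<alpha> + snd \<alpha> \<le> \<mu> \<longrightarrow>
            (\<Sum>k\<in>Q2 \<eta>. svconst (real_of_int (snd k ^ fst \<alpha> * fst k ^ snd \<alpha>)) \<circledast> A k)
              \<in> SV \<otimes>\<^sub>b SVmat) \<longleftrightarrow>
         (\<forall>\<alpha>. fst \<alpha> + snd \<alpha> \<le> \<mu> \<longrightarrow>
            (\<Sum>j\<in>Q2 \<eta>. moment_coeff \<eta> \<alpha> j \<circledast> samples \<eta> U j) \<in> SV \<otimes>\<^sub>b SVmat)))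
   \<and> \<comment> \<open>(d)\<close>
     ((\<forall>\<xi>. U (\<xi> + (1/2) *\<^sub>R corner 1) = sigma1 ** U \<xi> \<and>
           U (\<xi> + (1/2) *\<^sub>R corner 2) = sigma2 ** U \<xi>) \<longleftrightarrow>
      (\<forall>k\<in>Q2 \<eta>. sigma1 ** A k = ((-1) powi snd k) *\<^sub>R A k \<and>
                  sigma2 ** A k = ((-1) powi fst k) *\<^sub>R A k)) \<and>
     ((\<forall>k\<in>Q2 \<eta>. sigma1 ** A k = ((-1) powi snd k) *\<^sub>R A k \<and>
                  sigma2 ** A k = ((-1) powi fst k) *\<^sub>R A k) \<longleftrightarrow>
      (\<forall>j\<in>Q2 \<eta>. samples \<eta> U (j + (\<eta> div 2, 0)) = sigma1 ** samples \<eta> U j \<and>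
                  samples \<eta> U (j + (0, \<eta> div 2)) = sigma2 ** samples \<eta> U j))
   \<and> \<comment> \<open>(e)\<close>
     ((\<forall>\<xi>. U (- \<xi>) = tau ** U \<xi> ** tau) \<longleftrightarrow> (\<forall>k\<in>Q2 \<eta>. A k = tau ** A k ** tau)) \<and>
     ((\<forall>k\<in>Q2 \<eta>. A k = tau ** A k ** tau) \<longleftrightarrow>
      (\<forall>j\<in>Q2 \<eta>. samples \<eta> U ((\<eta>, \<eta>) - j) = tau ** samples \<eta> U j ** tau))
   \<and> \<comment> \<open>(f)\<close>
     (wavelet_matrix \<phi> \<psi> U \<longrightarrow> integrable lborel \<phi> \<longrightarrow>
        ((AE x in lborel. \<phi> x = \<phi> (2 *\<^sub>R P - x)) \<longleftrightarrow>
         (\<forall>\<xi>. U \<xi> $ (0,0) $ (0,0) + U \<xi> $ (0,0) $ (0,1) =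
            exp ((4 * pi) *\<^sub>R wedge \<xi> P) *
              (U (- \<xi>) $ (0,0) $ (0,0) + U (- \<xi>) $ (0,0) $ (0,1)))) \<and>
        ((\<forall>\<xi>. U \<xi> $ (0,0) $ (0,0) + U \<xi> $ (0,0) $ (0,1) =
            exp ((4 * pi) *\<^sub>R wedge \<xi> P) *
              (U (- \<xi>) $ (0,0) $ (0,0) + U (- \<xi>) $ (0,0) $ (0,1))) \<longleftrightarrow>
         (\<forall>k\<in>Q2 \<eta>. A k $ (0,0) $ (0,0) + A k $ (0,0) $ (0,1) =
            A ((\<eta> - 1, \<eta> - 1) - k) $ (0,0) $ (0,0) +
            A ((\<eta> - 1, \<eta> - 1) - k) $ (0,0) $ (0,1))) \<and>
        ((\<forall>k\<in>Q2 \<eta>. A k $ (0,0) $ (0,0) + A k $ (0,0) $ (0,1) =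
            A ((\<eta> - 1, \<eta> - 1) - k) $ (0,0) $ (0,0) +
            A ((\<eta> - 1, \<eta> - 1) - k) $ (0,0) $ (0,1)) \<longleftrightarrow>
         (\<forall>j\<in>Q2 \<eta>. samples \<eta> U j $ (0,0) $ (0,0) + samples \<eta> U j $ (0,0) $ (0,1) =
            exp ((4 * pi / real_of_int \<eta>) *\<^sub>R wedge (emb j) P) *
              (samples \<eta> U ((\<eta>, \<eta>) - j) $ (0,0) $ (0,0) +
               samples \<eta> U ((\<eta>, \<eta>) - j) $ (0,0) $ (0,1)))))"
proof -
  have U: "U = trig_poly \<eta> A"
    using assms(5) by blast
  have \<eta>: "\<eta> > 0" using assms(1) by simp
  have A: "A k \<in> SVmat" if "k \<in> Q2 \<eta>" for k
    using assms(4) that by blast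
  have derivative: "matrix_partial \<alpha> (trig_poly \<eta> A) 0 \<in> SV \<otimes>\<^sub>b SVmat \<longleftrightarrow>
    (\<Sum>k\<in>Q2 \<eta>. svconst (real_of_int (snd k ^ fst \<alpha> * fst k ^ snd \<alpha>)) \<circledast> A k) \<in> SV \<otimes>\<^sub>b SVmat" for \<alpha>
    unfolding trig_poly_eq by (rule matrix_partial_block_diag_iff) (rule A)
  have moment: "(\<Sum>j\<in>Q2 \<eta>. moment_coeff \<eta> \<alpha> j \<circledast> samples \<eta> (trig_poly \<eta> A) j) \<in> SV \<otimes>\<^sub>b SVmat \<longleftrightarrow>
    (\<Sum>k\<in>Q2 \<eta>. svconst (real_of_int (snd k ^ fst \<alpha> * fst k ^ snd \<alpha>)) \<circledast> A k) \<in> SV \<otimes>\<^sub>b SVmat" for \<alpha>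
    unfolding sum_moment_coeff_samples[OF \<eta>]
    by (rule SV_tensor_SVmat_scaleR_iff) (use \<eta> in simp)
  note row = row_coeff_symmetry_iff[OF \<eta> assms(3), unfolded row_coeff_def]
  show ?thesis
    unfolding U
  proof (intro conjI impI, goal_cases)
    case 1
    show ?case by (rule qunitary_trig_poly_iff[OF \<eta>]) (rule A)
  next
    case 2
    then show ?case using wavelet_matrix_at_0[OF \<eta>] by blast
  next
    case 3
    show ?case unfolding derivative ..
  next
    case 4
    show ?case unfolding moment ..
  next
    case 5
    show ?case by (rule trig_poly_shift_iff(1)[OF \<eta> assms(2)])
  next
    case 6
    show ?case by (rule trig_poly_shift_iff(2)[OF \<eta> assms(2)])
  next
    case 7
    show ?case by (rule trig_poly_reflect_iff(1)[OF \<eta>])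
  next
    case 8
    show ?case by (rule trig_poly_reflect_iff(2)[OF \<eta>])
  next
    case 9
    then show ?case
      unfolding row(1) by (rule wavelet_symmetric_iff[OF _ _ assms(3), unfolded row_coeff_def])
  next
    case 10
    show ?case by (rule row(1))
  next
    case 11
    show ?case by (rule row(2))
  qed
qed

end
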